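(* Let $G$ be a finite nonabelian group and $S$ a component of $\hat Y(G)$ with $|E|$ edges (in its cell structure) and representative edge $[(x,1),(y,1)]$, and let $Q$ be a subquotient associated to $S$ (either $Q_S$ or $\bar Q_S$). Then: (1) The quotient map $S\to S/Q$ is a $|Q|$-fold branched covering, branched over exactly three points, and $S/Q$ is homeomorphic to the 2-sphere. (2) If the type 1 vertices of $S$ form two $Q$-orbits, then the three branch points are the images of $(x,1)$, of $(y,1)$, and of the centres of faces, with ramification indices $\lambda_1$, $\lambda_2$ and $n/2$ respectively (where $\lambda_1=\lambda_2$ is possible). In this case $Q$ is a subgroup of index at most $2$ in the group of orientation preserving automorphisms of the cell structure of $S$ and $|Q|=|E|$; if moreover $\lambda_1\ne\lambda_2$, then $Q$ is the whole group of orientation preserving automorphisms of the cell structure of $S$. (3) If the type 1 vertices of $S$ form a single $Q$-orbit, then the three branch points are the images of $(x,1)$, of the midpoints of edges, and of the centres of faces, with ramification indices $\lambda$, $2$ and $n$ respectively. In this case $Q$ is the group of orientation preserving automorphisms of the cell structure of $S$ and $|Q|=2|E|$.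
   Context: Construction: for a finite nonabelian group $G$, $X(G)$ is the 2-dimensional simplicial complex with vertices $(g,1)$ ("type 1") and $(g,2)$ ("type 2"), $g\in G$, and oriented triangles $[(a,1),(b,1),(ab,2)]$ for $ab\ne ba$; $\hat Y(G)$ is its canonical resolution of singularities (vertices whose links are several circles are split, one vertex per circle), a disjoint union of closed connected oriented triangulated surfaces called components. Each component has a closed 2-cell structure: 0-cells the type 1 vertices, 1-cells the edges joining type 1 vertices, 2-cells the unions of triangles around a type 2 vertex (its centre); faces are all $n$-gons, and $\lambda_1,\lambda_2$ (or $\lambda$ when they coincide as a single orbit) denote the valencies (number of incident 2-cells) of $(x,1)$ and $(y,1)$. $\mathrm{Aut}(G)$ acts by $\varphi(g,i)=(\varphi(g),i)$ and $G$ by conjugation. $Q_S=\mathrm{Aut}(G)_S/(\mathrm{Aut}_x\cap\mathrm{Aut}_y)$, where $\mathrm{Aut}(G)_S$ is the stabilizer of $S$ and $\mathrm{Aut}_x,\mathrm{Aut}_y$ the stabilizers of $(x,1),(y,1)$; $\bar Q_S=G_S/(C(x)\cap C(y))$ with $G_S$ the conjugation stabilizer of $S$. Both act faithfully on $S$ by orientation preserving cell automorphisms. *)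

theory Defs
  imports "HOL-Analysis.Analysis" "HOL-Algebra.Algebra"
begin

type_synonym 'g xvert = "'g \<times> nat"
type_synonym 'g yvert = "'g xvert \<times> 'g xvert set set"
type_synonym 'v tri = "'v \<times> 'v \<times> 'v"

definition tri_vs :: "'v tri \<Rightarrow> 'v set" where
  "tri_vs t = {fst t, fst (snd t), snd (snd t)}"

definition Xtri :: "('g, 'b) monoid_scheme \<Rightarrow> 'g xvert tri set" where
  "Xtri G = {((a, 1), (b, 1), (a \<otimes>\<^bsub>G\<^esub> b, 2)) | a b.
      a \<in> carrier G \<and> b \<in> carrier G \<and> a \<otimes>\<^bsub>G\<^esub> b \<noteq> b \<otimes>\<^bsub>G\<^esub> a}"

definition link_edges :: "('g, 'b) monoid_scheme \<Rightarrow> 'g xvert \<Rightarrow> 'g xvert set set" where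
  "link_edges G v = {tri_vs t - {v} | t. t \<in> Xtri G \<and> v \<in> tri_vs t}"

definition link_adj :: "('g, 'b) monoid_scheme \<Rightarrow> 'g xvert \<Rightarrow> ('g xvert set \<times> 'g xvert set) set" where
  "link_adj G v = {(e, f). e \<in> link_edges G v \<and> f \<in> link_edges G v \<and> e \<inter> f \<noteq> {}}"

definition link_circle :: "('g, 'b) monoid_scheme \<Rightarrow> 'g xvert \<Rightarrow> 'g xvert set \<Rightarrow> 'g xvert set set" where
  "link_circle G v e = {f \<in> link_edges G v. (e, f) \<in> (link_adj G v)\<^sup>*}"

text \<open>Lift of the vertex v of the triangle t to the resolution: v together with the
  circle of its link in which t lies.\<close>
definition ylift :: "('g, 'b) monoid_scheme \<Rightarrow> 'g xvert \<Rightarrow> 'g xvert tri \<Rightarrow> 'g yvert" where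
  "ylift G v t = (v, link_circle G v (tri_vs t - {v}))"

definition Ytri :: "('g, 'b) monoid_scheme \<Rightarrow> 'g yvert tri set" where
  "Ytri G = {(ylift G a t, ylift G b t, ylift G c t) | t a b c. t \<in> Xtri G \<and> t = (a, b, c)}"

definition tri_adj :: "'v tri set \<Rightarrow> ('v tri \<times> 'v tri) set" where
  "tri_adj T = {(s, t). s \<in> T \<and> t \<in> T \<and> tri_vs s \<inter> tri_vs t \<noteq> {}}"

definition cx_components :: "'v tri set \<Rightarrow> 'v tri set set" where
  "cx_components T = {{t \<in> T. (s, t) \<in> (tri_adj T)\<^sup>*} | s. s \<in> T}"

definition Y_components :: "('g, 'b) monoid_scheme \<Rightarrow> 'g yvert tri set set" where
  "Y_components G = cx_components (Ytri G)"

definition verts :: "'v tri set \<Rightarrow> 'v set" where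
  "verts T = \<Union> (tri_vs ` T)"

definition vtype :: "'g yvert \<Rightarrow> nat" where
  "vtype v = snd (fst v)"

definition type1_verts :: "'g yvert tri set \<Rightarrow> 'g yvert set" where
  "type1_verts S = {v \<in> verts S. vtype v = 1}"

definition centres :: "'g yvert tri set \<Rightarrow> 'g yvert set" where
  "centres S = {v \<in> verts S. vtype v = 2}"

definition cell_edges :: "'v tri set \<Rightarrow> 'v set set" where
  "cell_edges S = {{fst t, fst (snd t)} | t. t \<in> S}"

text \<open>Valency of a type 1 vertex: number of incident 2-cells (counted with
  multiplicity, i.e. corners); each corner consists of two triangles.\<close>
definition valency :: "'v tri set \<Rightarrow> 'v \<Rightarrow> nat" where
  "valency S v = card {t \<in> S. v \<in> tri_vs t} div 2"

definition xvmap :: "('g \<Rightarrow> 'g) \<Rightarrow> 'g xvert \<Rightarrow> 'g xvert" where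
  "xvmap \<phi> = (\<lambda>(g, i). (\<phi> g, i))"

definition yvmap :: "('g \<Rightarrow> 'g) \<Rightarrow> 'g yvert \<Rightarrow> 'g yvert" where
  "yvmap \<phi> = (\<lambda>(v, C). (xvmap \<phi> v, (\<lambda>e. xvmap \<phi> ` e) ` C))"

definition tmap :: "('v \<Rightarrow> 'v) \<Rightarrow> 'v tri \<Rightarrow> 'v tri" where
  "tmap \<sigma> = (\<lambda>(a, b, c). (\<sigma> a, \<sigma> b, \<sigma> c))"

definition conjf :: "('g, 'b) monoid_scheme \<Rightarrow> 'g \<Rightarrow> 'g \<Rightarrow> 'g" where
  "conjf G g = (\<lambda>h. g \<otimes>\<^bsub>G\<^esub> h \<otimes>\<^bsub>G\<^esub> inv\<^bsub>G\<^esub> g)"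

definition AutStab :: "('g, 'b) monoid_scheme \<Rightarrow> 'g yvert tri set \<Rightarrow> ('g \<Rightarrow> 'g) set" where
  "AutStab G S = {\<phi> \<in> auto G. tmap (yvmap \<phi>) ` S = S}"

definition ConjStab :: "('g, 'b) monoid_scheme \<Rightarrow> 'g yvert tri set \<Rightarrow> 'g set" where
  "ConjStab G S = {g \<in> carrier G. tmap (yvmap (conjf G g)) ` S = S}"

definition centralizer_of :: "('g, 'b) monoid_scheme \<Rightarrow> 'g \<Rightarrow> 'g set" where
  "centralizer_of G x = {g \<in> carrier G. g \<otimes>\<^bsub>G\<^esub> x = x \<otimes>\<^bsub>G\<^esub> g}"

definition Q_order :: "('g, 'b) monoid_scheme \<Rightarrow> 'g yvert tri set \<Rightarrow> 'g \<Rightarrow> 'g \<Rightarrow> nat" where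
  "Q_order G S x y = card (rcosets\<^bsub>(AutoGroup G)\<lparr>carrier := AutStab G S\<rparr>\<^esub>
                             {\<phi> \<in> auto G. \<phi> x = x \<and> \<phi> y = y})"

definition Qbar_order :: "('g, 'b) monoid_scheme \<Rightarrow> 'g yvert tri set \<Rightarrow> 'g \<Rightarrow> 'g \<Rightarrow> nat" where
  "Qbar_order G S x y = card (rcosets\<^bsub>G\<lparr>carrier := ConjStab G S\<rparr>\<^esub>
                             (centralizer_of G x \<inter> centralizer_of G y))"

definition Q_maps :: "('g, 'b) monoid_scheme \<Rightarrow> 'g yvert tri set \<Rightarrow> ('g yvert \<Rightarrow> 'g yvert) set" where
  "Q_maps G S = yvmap ` AutStab G S"

definition Qbar_maps :: "('g, 'b) monoid_scheme \<Rightarrow> 'g yvert tri set \<Rightarrow> ('g yvert \<Rightarrow> 'g yvert) set" where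
  "Qbar_maps G S = (\<lambda>g. yvmap (conjf G g)) ` ConjStab G S"

text \<open>Orientation preserving automorphisms of the cell structure of S, realised as
  type preserving, orientation preserving simplicial automorphisms of the triangulation
  (a 2-cell is the cone over its boundary from its centre).\<close>
definition cell_aut_plus :: "'g yvert tri set \<Rightarrow> ('g yvert \<Rightarrow> 'g yvert) set" where
  "cell_aut_plus S = {\<sigma>. \<sigma> \<in> extensional (verts S) \<and> bij_betw \<sigma> (verts S) (verts S) \<and>
       (\<forall>v \<in> verts S. vtype (\<sigma> v) = vtype v) \<and> tmap \<sigma> ` S = S}"

definition vpt :: "'v \<Rightarrow> 'v \<Rightarrow> real" where
  "vpt v = (\<lambda>w. if w = v then 1 else 0)"

definition tri_simplex :: "'v tri \<Rightarrow> ('v \<Rightarrow> real) set" where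
  "tri_simplex t = (case t of (a, b, c) \<Rightarrow>
     {(\<lambda>w. \<alpha> * vpt a w + \<beta> * vpt b w + \<gamma> * vpt c w) | \<alpha> \<beta> \<gamma>.
        \<alpha> \<ge> 0 \<and> \<beta> \<ge> 0 \<and> \<gamma> \<ge> 0 \<and> \<alpha> + \<beta> + \<gamma> = 1})"

definition realize :: "'v tri set \<Rightarrow> ('v \<Rightarrow> real) set" where
  "realize T = \<Union> (tri_simplex ` T)"

definition geo :: "'v tri set \<Rightarrow> ('v \<Rightarrow> real) topology" where
  "geo T = subtopology (powertop_real UNIV) (realize T)"

text \<open>Affine extension of a vertex map to the realisation (vpush-forward of
  barycentric coordinates).\<close>
definition vpush :: "('v \<Rightarrow> 'v) \<Rightarrow> ('v \<Rightarrow> real) \<Rightarrow> ('v \<Rightarrow> real)" where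
  "vpush \<sigma> p = (\<lambda>w. sum p {u. p u \<noteq> 0 \<and> \<sigma> u = w})"

definition midpt :: "'v \<Rightarrow> 'v \<Rightarrow> 'v \<Rightarrow> real" where
  "midpt a b = (\<lambda>w. (vpt a w + vpt b w) / 2)"

definition edge_midpoints :: "'v tri set \<Rightarrow> ('v \<Rightarrow> real) set" where
  "edge_midpoints S = {midpt (fst t) (fst (snd t)) | t. t \<in> S}"

definition cover_map :: "'a topology \<Rightarrow> 'b topology \<Rightarrow> ('a \<Rightarrow> 'b) \<Rightarrow> bool" where
  "cover_map TX TY p \<longleftrightarrow> continuous_map TX TY p \<and> p ` topspace TX = topspace TY \<and>
     (\<forall>y \<in> topspace TY. \<exists>V. openin TY V \<and> y \<in> V \<and>
        (\<exists>Us. Union Us = {x \<in> topspace TX. p x \<in> V} \<and> pairwise disjnt Us \<and>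
             (\<forall>U \<in> Us. openin TX U \<and> homeomorphic_map (subtopology TX U) (subtopology TY V) p)))"

definition branched_cover :: "'a topology \<Rightarrow> 'b topology \<Rightarrow> ('a \<Rightarrow> 'b) \<Rightarrow> nat \<Rightarrow> 'b set \<Rightarrow> bool" where
  "branched_cover TX TY p d B \<longleftrightarrow> continuous_map TX TY p \<and> p ` topspace TX = topspace TY \<and> d > 0 \<and>
     B = {y \<in> topspace TY. card {x \<in> topspace TX. p x = y} \<noteq> d} \<and>
     (\<forall>y \<in> topspace TY. finite {x \<in> topspace TX. p x = y}) \<and>
     cover_map (subtopology TX {x \<in> topspace TX. p x \<notin> B}) (subtopology TY (topspace TY - B)) p"

definition ram_index :: "'a topology \<Rightarrow> 'b topology \<Rightarrow> ('a \<Rightarrow> 'b) \<Rightarrow> 'a \<Rightarrow> nat \<Rightarrow> bool" where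
  "ram_index TX TY p x e \<longleftrightarrow> x \<in> topspace TX \<and>
     (\<forall>W. openin TX W \<and> x \<in> W \<longrightarrow>
        (\<exists>U. openin TX U \<and> x \<in> U \<and> U \<subseteq> W \<and> openin TY (p ` U) \<and>
             {u \<in> U. p u = p x} = {x} \<and>
             (\<forall>y \<in> p ` U - {p x}. card {u \<in> U. p u = y} = e)))"

end

(*
  A component S is a closed surface on which Q acts by simplicial automorphisms, freely on the
  triangles. A triangle corresponds to an ordered noncommuting pair (a,b); crossing its edges
  leads to (b,a), (a b a^-1, a) and (b, b^-1 a b), the last two being conjugate to (b,a) by a and by
  b^-1. Hence Q has at most two orbits of triangles, represented by the base triangle (x,y) and its
  neighbour (y,x), and there is only one precisely if Q exchanges x and y, precisely if the type 1
  vertices form one orbit. With two orbits S/Q is the double of a triangle. With one orbit it is a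
  triangle with one edge folded at its midpoint and the other two glued together, that is, the
  double of half a triangle. Both are mapped onto the sphere by radial projection
  of a bipyramid, in coordinates given by invariant continuous functions of the barycentric
  coordinates on S. The branched covering statement is then general topology of a finite group acting
  on a compact Hausdorff space, freely off a finite set; ramification indices are orders of
  stabilizers, which are counted by triangles. An orientation preserving automorphism is determined
  by the image of one triangle, which bounds the full automorphism group.
*)
theory Submission
  imports Defs
begin

section \<open>Quotients by finite groups\<close>

text \<open>A continuous map from a compact space to a Hausdorff space is closed, so S/Q never has
  to be constructed: a continuous map onto the sphere whose fibres are exactly the orbits is the
  quotient map. Formulas given triangle by triangle would have to be compared along edges; sums over
  vertices or triangles avoid this, and a height that vanishes on the boundary of every triangle
  makes the sheets fit. On the surface, the only group theory needed is that the stabilizer of a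
  type 1 vertex is transitive on the triangles around it: crossing two edges at (a, 1) amounts to
  conjugation by a or its inverse, and a stabilizes S. Automorphisms in \<open>auto G\<close> are
  extensional and conjugations \<open>conjf G g\<close> are not, so both subquotients are treated as
  families of maps closed under the group operations only up to agreement on the carrier. The order
  of Q is an index; it equals the number of distinct maps on S because a symmetry is determined
  there by the images of x and y.\<close>

lemma image_singleton: "A \<noteq> {} \<Longrightarrow> (\<And>a. a \<in> A \<Longrightarrow> f a = k) \<Longrightarrow> f ` A = {k}"
  by force

text \<open>Group laws are required only pointwise on the space, since the maps may do anything
  elsewhere. As \<open>free\<close> asks for an injective orbit map rather than a trivial
  stabilizer, distinct indices act differently at points outside \<open>Z\<close>, and
  \<open>card A\<close> itself counts the sheets.\<close>

locale finite_quotient =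
  fixes TX :: "'a topology" and TY :: "'b topology" and pr :: "'a \<Rightarrow> 'b"
    and A :: "'i set" and act :: "'i \<Rightarrow> 'a \<Rightarrow> 'a" and Z :: "'a set"
  assumes compact: "compact_space TX" and HX: "Hausdorff_space TX" and HY: "Hausdorff_space TY"
    and cont: "continuous_map TX TY pr" and onto: "pr ` topspace TX = topspace TY"
    and fin: "finite A"
    and act_cont: "g \<in> A \<Longrightarrow> continuous_map TX TX (act g)"
    and act_one: "\<exists>e\<in>A. \<forall>x\<in>topspace TX. act e x = x"
    and act_inv: "g \<in> A \<Longrightarrow> \<exists>h\<in>A. \<forall>x\<in>topspace TX. act h (act g x) = x"
    and act_mult: "g \<in> A \<Longrightarrow> h \<in> A \<Longrightarrow> \<exists>k\<in>A. \<forall>x\<in>topspace TX. act k x = act g (act h x)"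
    and fibre: "x \<in> topspace TX \<Longrightarrow> x' \<in> topspace TX \<Longrightarrow> pr x = pr x' \<longleftrightarrow> (\<exists>g\<in>A. act g x = x')"
    and Zfin: "finite Z" and Zsub: "Z \<subseteq> topspace TX"
    and free: "x \<in> topspace TX \<Longrightarrow> inj_on (\<lambda>g. act g x) A \<longleftrightarrow> x \<notin> Z"
begin

lemma act_in: "g \<in> A \<Longrightarrow> x \<in> topspace TX \<Longrightarrow> act g x \<in> topspace TX"
  using act_cont by (auto simp: continuous_map_def)

text \<open>The element k plays the role of g^-1 h; its fixed points are points where g and h
  agree.\<close>

lemma act_diff:
  assumes "g \<in> A" "h \<in> A"
  obtains k where "k \<in> A" "\<And>x. x \<in> topspace TX \<Longrightarrow> act g (act k x) = act h x"
    "\<And>x. x \<in> topspace TX \<Longrightarrow> act k x = x \<Longrightarrow> act g x = act h x"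
proof -
  obtain g' where g': "g' \<in> A" "\<forall>x\<in>topspace TX. act g' (act g x) = x"
    using act_inv assms(1) by blast
  obtain g'' where g'': "g'' \<in> A" "\<forall>x\<in>topspace TX. act g'' (act g' x) = x"
    using act_inv g'(1) by blast
  \<comment> \<open>Applying \<open>g''\<close> to \<open>g' (g x) = x\<close> shows that
    \<open>g''\<close> agrees with \<open>g\<close> on the space, so the left inverse
    \<open>g'\<close> is also a right inverse.\<close>
  have gg: "act g (act g' x) = x" if "x \<in> topspace TX" for x
    using g' g'' that act_in assms(1) by metis
  obtain k where k: "k \<in> A" "\<forall>x\<in>topspace TX. act k x = act g' (act h x)"
    using act_mult g'(1) assms(2) by blast
  have *: "act g (act k x) = act h x" if "x \<in> topspace TX" for x
    using gg k that act_in assms(2) by simp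
  then show thesis
    using that[OF k(1)] by metis
qed

lemma act_inj: "g \<in> A \<Longrightarrow> inj_on (act g) (topspace TX)"
  using act_inv by (metis inj_onI)

lemma pr_act: "g \<in> A \<Longrightarrow> x \<in> topspace TX \<Longrightarrow> pr (act g x) = pr x"
  using fibre act_in by metis

lemma fibre_eq:
  assumes x: "x \<in> topspace TX"
  shows " {x' \<in> topspace TX. pr x' = pr x} = (\<lambda>g. act g x) ` A"
proof (intro equalityI subsetI)
  fix x' assume "x' \<in> {x' \<in> topspace TX. pr x' = pr x}"
  then obtain g where "g \<in> A" "act g x = x'" using fibre[OF x, of x'] by auto
  then show "x' \<in> (\<lambda>g. act g x) ` A" by blast
qed (use pr_act act_in x in auto)

lemma openin_act_vimage:
  "g \<in> A \<Longrightarrow> openin TX U \<Longrightarrow> openin TX {x \<in> topspace TX. act g x \<in> U}"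
  using act_cont by (rule openin_continuous_map_preimage)

lemma openin_act_image:
  assumes "g \<in> A" "openin TX U"
  shows "openin TX (act g ` U)"
proof -
  obtain h where h: "h \<in> A" "\<forall>x\<in>topspace TX. act h (act g x) = x" using act_inv assms(1) by blast
  obtain k where k: "k \<in> A" "\<forall>x\<in>topspace TX. act k (act h x) = x" using act_inv h(1) by blast
  have kg: "act k x = act g x" if "x \<in> topspace TX" for x
    using h k that act_in assms(1) by metis
  have U: "U \<subseteq> topspace TX" using assms(2) by (rule openin_subset)
  have "act g ` U = {x \<in> topspace TX. act h x \<in> U}"
  proof (intro equalityI subsetI)
    fix y assume "y \<in> act g ` U"
    then show "y \<in> {x \<in> topspace TX. act h x \<in> U}"
      using U h act_in assms(1) by auto
  next
    fix y assume "y \<in> {x \<in> topspace TX. act h x \<in> U}"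
    then have "y = act g (act h y)" "act h y \<in> U"
      using k kg act_in[OF h(1)] by auto
    then show "y \<in> act g ` U" by blast
  qed
  then show ?thesis using openin_act_vimage[OF h(1) assms(2)] by simp
qed

text \<open>Compactness of the source and the Hausdorff property of the target make
  \<open>pr\<close> closed, and a closed continuous surjection is a quotient map.\<close>

lemma quotient: "quotient_map TX TY pr"
  using continuous_closed_imp_quotient_map[OF cont _ onto]
    continuous_imp_closed_map[OF cont compact HY] by blast

text \<open>The saturation of an open set is the union of its translates, hence open, and a quotient
  map sends a set with open saturation to an open set.\<close>

lemma open_map_pr: "open_map TX TY pr"
  unfolding open_map_def
proof (intro allI impI)
  fix U assume U: "openin TX U"
  then have Us: "U \<subseteq> topspace TX" by (rule openin_subset)
  have "{x \<in> topspace TX. pr x \<in> pr ` U} = (\<Union>g\<in>A. act g ` U)"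
  proof (intro equalityI subsetI)
    fix x assume "x \<in> {x \<in> topspace TX. pr x \<in> pr ` U}"
    then obtain u where "u \<in> U" "x \<in> topspace TX" "pr u = pr x" by auto
    then show "x \<in> (\<Union>g\<in>A. act g ` U)"
      using fibre Us by blast
  qed (use Us act_in pr_act in auto)
  then have "openin TX {x \<in> topspace TX. pr x \<in> pr ` U}"
    using openin_act_image[OF _ U] by auto
  moreover have "pr ` U \<subseteq> topspace TY" using Us onto by blast
  ultimately show "openin TY (pr ` U)" using quotient by (auto simp: quotient_map_def)
qed

text \<open>Each of the finitely many g that move x displaces some neighbourhood of x from itself,
  by the Hausdorff property; the intersection serves all g at once.\<close>

lemma separating_nbhd:
  assumes "x \<in> topspace TX"
  obtains U where "openin TX U" "x \<in> U"
    "\<And>g u. g \<in> A \<Longrightarrow> u \<in> U \<Longrightarrow> act g u \<in> U \<Longrightarrow> act g x = x"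
proof -
  have "\<exists>U. openin TX U \<and> x \<in> U \<and> (\<forall>u\<in>U. act g u \<in> U \<longrightarrow> act g x = x)" if g: "g \<in> A" for g
  proof (cases "act g x = x")
    case True
    then show ?thesis using assms by blast
  next
    case False
    then obtain N M where NM: "openin TX N" "openin TX M" "x \<in> N" "act g x \<in> M" "disjnt N M"
      using HX assms act_in[OF g assms] unfolding Hausdorff_space_def by metis
    show ?thesis
    proof (intro exI conjI)
      show "openin TX (N \<inter> {u \<in> topspace TX. act g u \<in> M})"
        using NM openin_act_vimage[OF g] by blast
      show "x \<in> N \<inter> {u \<in> topspace TX. act g u \<in> M}" using NM assms by blast
      show "\<forall>u\<in>N \<inter> {u \<in> topspace TX. act g u \<in> M}.
          act g u \<in> N \<inter> {u \<in> topspace TX. act g u \<in> M} \<longrightarrow> act g x = x"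
        using NM(5) by (auto simp: disjnt_iff)
    qed
  qed
  then obtain F where F: "\<And>g. g \<in> A \<Longrightarrow> openin TX (F g) \<and> x \<in> F g \<and>
      (\<forall>u\<in>F g. act g u \<in> F g \<longrightarrow> act g x = x)"
    by metis
  have ne: "F ` A \<noteq> {}" using act_one by auto
  show thesis
  proof (rule that)
    have "openin TX W" if "W \<in> F ` A" for W using that F by blast
    then show "openin TX (\<Inter> (F ` A))" using openin_Inter ne fin by blast
    show "x \<in> \<Inter> (F ` A)" using F by blast
    show "act g x = x" if "g \<in> A" "u \<in> \<Inter> (F ` A)" "act g u \<in> \<Inter> (F ` A)" for g u
      using F that by blast
  qed
qed

text \<open>The orbit map from the finite set \<open>A\<close> is injective exactly when the orbit
  has full size. This turns deficient fibres into images of \<open>Z\<close>.\<close>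

lemma card_stabilizer_orbit:
  assumes "x \<in> topspace TX"
  shows "card {x' \<in> topspace TX. pr x' = pr x} = card A \<longleftrightarrow> x \<notin> Z"
  unfolding fibre_eq[OF assms] free[OF assms, symmetric]
  using fin by (auto simp: inj_on_iff_eq_card)

text \<open>The sheets are the translates of a neighbourhood that meets none of its images unless x
  is fixed. The set \<open>X'\<close> confines the base, so that the same sheets serve after the
  branch points are removed.\<close>

lemma evenly_covered:
  assumes x: "x \<in> topspace TX" "x \<notin> Z" and X': "openin TX X'" "x \<in> X'"
  obtains V Us where "openin TY V" "pr x \<in> V" "V \<subseteq> pr ` X'"
    "\<Union>Us = {x \<in> topspace TX. pr x \<in> V}" "pairwise disjnt Us"
    "\<forall>U\<in>Us. openin TX U \<and> homeomorphic_map (subtopology TX U) (subtopology TY V) pr"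
proof -
  obtain U0 where U0: "openin TX U0" "x \<in> U0"
    and sep: "\<And>g u. g \<in> A \<Longrightarrow> u \<in> U0 \<Longrightarrow> act g u \<in> U0 \<Longrightarrow> act g x = x"
    using separating_nbhd x(1) by blast
  define U where "U = U0 \<inter> X'"
  have U: "openin TX U" "x \<in> U" "U \<subseteq> X'" using U0 X' unfolding U_def by auto
  then have Us: "U \<subseteq> topspace TX" by (auto dest: openin_subset)
  \<comment> \<open>If two sheets meet, g^-1 h carries a point of U into U, hence fixes x, and
    freeness at x gives g = h.\<close>
  have dis: "g = h" if gh: "g \<in> A" "h \<in> A" "u \<in> U" "u' \<in> U" "act g u = act h u'" for g h u u'
  proof -
    obtain k where k: "k \<in> A" "\<And>x. x \<in> topspace TX \<Longrightarrow> act g (act k x) = act h x"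
      "\<And>x. x \<in> topspace TX \<Longrightarrow> act k x = x \<Longrightarrow> act g x = act h x"
      using act_diff[OF gh(1,2)] by blast
    have uX: "u \<in> topspace TX" "u' \<in> topspace TX" using gh Us by auto
    have "act g (act k u') = act g u" using k(2)[OF uX(2)] gh by simp
    then have "act k u' = u"
      using inj_onD[OF act_inj[OF gh(1)]] uX act_in[OF k(1)] by blast
    then have "act k x = x" using sep[OF k(1), of u'] gh unfolding U_def by auto
    then have "act g x = act h x" using k(3) x by blast
    then show ?thesis using free[OF x(1)] x(2) gh by (auto dest: inj_onD)
  qed
  show thesis
  proof (rule that[of "pr ` U" "(\<lambda>g. act g ` U) ` A"])
    show V: "openin TY (pr ` U)" using open_map_pr U by (auto simp: open_map_def)
    show "pr x \<in> pr ` U" "pr ` U \<subseteq> pr ` X'" using U by auto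
    show "\<Union> ((\<lambda>g. act g ` U) ` A) = {x \<in> topspace TX. pr x \<in> pr ` U}"
    proof (intro equalityI subsetI)
      fix z assume "z \<in> {x \<in> topspace TX. pr x \<in> pr ` U}"
      then obtain u where u: "u \<in> U" "z \<in> topspace TX" "pr u = pr z" by auto
      then obtain g where "g \<in> A" "act g u = z" using fibre[of u z] Us by auto
      then show "z \<in> \<Union> ((\<lambda>g. act g ` U) ` A)" using u by blast
    qed (use Us act_in pr_act in auto)
    show "pairwise disjnt ((\<lambda>g. act g ` U) ` A)"
    proof (rule pairwiseI)
      fix W W' assume W: "W \<in> (\<lambda>g. act g ` U) ` A" "W' \<in> (\<lambda>g. act g ` U) ` A" "W \<noteq> W'"
      then obtain g h where gh: "g \<in> A" "h \<in> A" "W = act g ` U" "W' = act h ` U" by blast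
      show "disjnt W W'"
      proof (rule ccontr)
        assume "\<not> disjnt W W'"
        then obtain u u' where "u \<in> U" "u' \<in> U" "act g u = act h u'"
          unfolding disjnt_iff gh(3,4) by (metis imageE)
        then have "g = h" using dis gh(1,2) by blast
        then show False using gh W(3) by blast
      qed
    qed
    show "\<forall>W\<in>(\<lambda>g. act g ` U) ` A.
        openin TX W \<and> homeomorphic_map (subtopology TX W) (subtopology TY (pr ` U)) pr"
    proof
      fix W assume "W \<in> (\<lambda>g. act g ` U) ` A"
      obtain g where g: "g \<in> A" "W = act g ` U" using \<open>W \<in> _\<close> by blast
      have W: "openin TX W" using openin_act_image U g by blast
      then have Ws: "W \<subseteq> topspace TX" by (rule openin_subset)
      have im: "pr ` W = pr ` U" using pr_act[OF g(1)] Us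
        unfolding g(2) image_image by (auto intro!: image_cong)
      have "homeomorphic_map (subtopology TX W) (subtopology TY (pr ` U)) pr"
      proof (rule bijective_open_imp_homeomorphic_map)
        show "continuous_map (subtopology TX W) (subtopology TY (pr ` U)) pr"
          using cont im by (auto simp: continuous_map_in_subtopology continuous_map_from_subtopology)
        show "open_map (subtopology TX W) (subtopology TY (pr ` U)) pr"
          unfolding open_map_def
        proof (intro allI impI)
          fix O' assume "openin (subtopology TX W) O'"
          then have "openin TX O'" "O' \<subseteq> W"
            using W openin_open_subtopology by blast+
          then have "openin TY (pr ` O')" "pr ` O' \<subseteq> pr ` U"
            using open_map_pr image_mono[of O' W pr] im by (auto simp: open_map_def)
          then show "openin (subtopology TY (pr ` U)) (pr ` O')"
            using V openin_open_subtopology by blast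
        qed
        show "pr ` topspace (subtopology TX W) = topspace (subtopology TY (pr ` U))"
          using Ws im openin_subset[OF V] by (simp add: Int_absorb1)
        show "inj_on pr (topspace (subtopology TX W))"
        proof (rule inj_onI)
          fix p p' assume "p \<in> topspace (subtopology TX W)" "p' \<in> topspace (subtopology TX W)"
            "pr p = pr p'"
          then obtain u u' where u: "u \<in> U" "u' \<in> U" "p = act g u" "p' = act g u'"
            "pr (act g u) = pr (act g u')"
            using g(2) by auto
          have "u \<in> topspace TX" "u' \<in> topspace TX" using u Us by auto
          then have "pr u = pr u'" using pr_act[OF g(1)] u(5) by metis
          note u = u this
          then obtain h where h: "h \<in> A" "act h u = u'" using fibre[of u u'] Us by auto
          obtain e where e: "e \<in> A" "\<forall>x\<in>topspace TX. act e x = x" using act_one by blast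
          have "h = e" using dis[OF h(1) e(1), of u u'] u h e Us by auto
          then show "p = p'" using u h e Us by auto
        qed
      qed
      then show "openin TX W \<and> homeomorphic_map (subtopology TX W) (subtopology TY (pr ` U)) pr"
        using W by blast
    qed
  qed
qed

lemma branched: "branched_cover TX TY pr (card A) (pr ` Z)"
proof -
  have fib: "finite {x \<in> topspace TX. pr x = y}" if "y \<in> topspace TY" for y
  proof -
    obtain x where "x \<in> topspace TX" "y = pr x" using onto \<open>y \<in> topspace TY\<close> by blast
    then show ?thesis using fibre_eq fin by simp
  qed
  have B: "pr ` Z = {y \<in> topspace TY. card {x \<in> topspace TX. pr x = y} \<noteq> card A}"
  proof (intro equalityI subsetI)
    fix y assume "y \<in> pr ` Z"
    then obtain z where "z \<in> Z" "y = pr z" by blast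
    then show "y \<in> {y \<in> topspace TY. card {x \<in> topspace TX. pr x = y} \<noteq> card A}"
      using card_stabilizer_orbit[of z] Zsub onto by auto
  next
    fix y assume y: "y \<in> {y \<in> topspace TY. card {x \<in> topspace TX. pr x = y} \<noteq> card A}"
    then obtain x where "x \<in> topspace TX" "y = pr x" using onto by blast
    then show "y \<in> pr ` Z" using card_stabilizer_orbit[of x] y by auto
  qed
  define X' where "X' = {x \<in> topspace TX. pr x \<notin> pr ` Z}"
  have notZ: "x \<notin> Z" if "x \<in> X'" for x using that unfolding X'_def by blast
  have "closedin TY (pr ` Z)"
    using HY Zfin Zsub onto by (intro closedin_Hausdorff_finite) auto
  then have oY: "openin TY (topspace TY - pr ` Z)" by (simp add: openin_diff)
  have "X' = {x \<in> topspace TX. pr x \<in> topspace TY - pr ` Z}"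
    using onto unfolding X'_def by auto
  then have oX: "openin TX X'" using openin_continuous_map_preimage[OF cont oY] by simp
  have im: "pr ` X' = topspace TY - pr ` Z"
  proof (intro equalityI subsetI)
    fix y assume "y \<in> topspace TY - pr ` Z"
    then obtain x where "x \<in> topspace TX" "y = pr x" "y \<notin> pr ` Z" using onto by blast
    then show "y \<in> pr ` X'" unfolding X'_def by blast
  qed (use onto in \<open>auto simp: X'_def\<close>)
  have "cover_map (subtopology TX X') (subtopology TY (topspace TY - pr ` Z)) pr"
    unfolding cover_map_def
  proof (intro conjI ballI)
    show "continuous_map (subtopology TX X') (subtopology TY (topspace TY - pr ` Z)) pr"
    proof -
      have "pr \<in> topspace (subtopology TX X') \<rightarrow> topspace TY - pr ` Z"
        unfolding im[symmetric] by auto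
      then show ?thesis
        using cont by (simp add: continuous_map_in_subtopology continuous_map_from_subtopology)
    qed
    show "pr ` topspace (subtopology TX X') = topspace (subtopology TY (topspace TY - pr ` Z))"
      using im openin_subset[OF oX] by (simp add: Int_absorb1)
  next
    fix y assume "y \<in> topspace (subtopology TY (topspace TY - pr ` Z))"
    then have "y \<in> pr ` X'" unfolding im by simp
    then obtain x where x: "x \<in> X'" "y = pr x" by blast
    then have xX: "x \<in> topspace TX" "x \<notin> Z" using notZ[OF x(1)] unfolding X'_def by simp_all
    obtain V Us where V: "openin TY V" "pr x \<in> V" "V \<subseteq> pr ` X'"
      and Us: "\<Union>Us = {x \<in> topspace TX. pr x \<in> V}" "pairwise disjnt Us"
       "\<forall>U\<in>Us. openin TX U \<and> homeomorphic_map (subtopology TX U) (subtopology TY V) pr"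
      by (rule evenly_covered[OF xX oX x(1)])
    have UX: "U \<subseteq> X'" if "U \<in> Us" for U
    proof -
      have "U \<subseteq> {x \<in> topspace TX. pr x \<in> V}" using that Us(1) by blast
      then show ?thesis using V(3) im unfolding X'_def by blast
    qed
    show "\<exists>V. openin (subtopology TY (topspace TY - pr ` Z)) V \<and> y \<in> V \<and>
        (\<exists>Us. \<Union> Us = {x \<in> topspace (subtopology TX X'). pr x \<in> V} \<and> pairwise disjnt Us \<and>
          (\<forall>U\<in>Us. openin (subtopology TX X') U \<and>
             homeomorphic_map (subtopology (subtopology TX X') U)
               (subtopology (subtopology TY (topspace TY - pr ` Z)) V) pr))"
    proof (intro exI conjI ballI)
      show "openin (subtopology TY (topspace TY - pr ` Z)) V"
        using V oY im by (simp add: openin_open_subtopology)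
      show "y \<in> V" using V x by simp
      show "\<Union> Us = {x \<in> topspace (subtopology TX X'). pr x \<in> V}"
        using Us(1) UX by auto
      show "pairwise disjnt Us" by fact
      fix U assume U: "U \<in> Us"
      show "openin (subtopology TX X') U"
        using Us(3) U UX oX by (simp add: openin_open_subtopology)
      show "homeomorphic_map (subtopology (subtopology TX X') U)
               (subtopology (subtopology TY (topspace TY - pr ` Z)) V) pr"
        using bspec[OF Us(3) U] UX[OF U] V(3) im
        by (simp add: subtopology_subtopology Int_absorb1)
    qed
  qed
  moreover have "card A > 0" using act_one fin card_gt_0_iff by blast
  ultimately show ?thesis
    unfolding branched_cover_def X'_def B[symmetric] using cont onto fib B by simp
qed

text \<open>Near x only the stabilizer identifies points: on a small neighbourhood invariant under
  it, the fibres of \<open>pr\<close> are its orbits, and these are free away from x.\<close>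

lemma ramification:
  assumes x: "x \<in> topspace TX"
  shows "ram_index TX TY pr x (card {g \<in> A. act g x = x})"
  unfolding ram_index_def
proof (intro conjI allI impI x)
  fix W assume W: "openin TX W \<and> x \<in> W"
  define St where "St = {g \<in> A. act g x = x}"
  obtain U0 where U0: "openin TX U0" "x \<in> U0"
    and sep: "\<And>g u. g \<in> A \<Longrightarrow> u \<in> U0 \<Longrightarrow> act g u \<in> U0 \<Longrightarrow> act g x = x"
    using separating_nbhd x by blast
  \<comment> \<open>The other non-free points are removed, so that every orbit in the neighbourhood
    except {x} is free.\<close>
  define U1 where "U1 = W \<inter> U0 \<inter> (topspace TX - (Z - {x}))"
  have "closedin TX (Z - {x})"
    using HX Zfin Zsub by (intro closedin_Hausdorff_finite) auto
  then have U1: "openin TX U1" "x \<in> U1" unfolding U1_def using W U0 x by auto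
  \<comment> \<open>Pulling back along the whole stabilizer makes the set invariant, so that its
    fibres contain full orbits of the stabilizer.\<close>
  define U where "U = (\<Inter>g\<in>St. {u \<in> topspace TX. act g u \<in> U1})"
  obtain e where e: "e \<in> A" "\<forall>x\<in>topspace TX. act e x = x" using act_one by blast
  have eSt: "e \<in> St" using e x unfolding St_def by blast
  have Uo: "openin TX U"
    unfolding U_def
  proof (rule openin_Inter)
    show "finite ((\<lambda>g. {u \<in> topspace TX. act g u \<in> U1}) ` St)" using fin unfolding St_def by simp
    show "(\<lambda>g. {u \<in> topspace TX. act g u \<in> U1}) ` St \<noteq> {}" using eSt by blast
    show "openin TX W'" if "W' \<in> (\<lambda>g. {u \<in> topspace TX. act g u \<in> U1}) ` St" for W'
      using that openin_act_vimage[OF _ U1(1)] unfolding St_def by blast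
  qed
  have xU: "x \<in> U" unfolding U_def St_def using U1 x by auto
  have UU1: "U \<subseteq> U1"
  proof
    fix u assume "u \<in> U"
    then have "u \<in> topspace TX" "act e u \<in> U1" using eSt unfolding U_def by auto
    then show "u \<in> U1" using e(2) by simp
  qed
  have UX: "U \<subseteq> topspace TX" using Uo by (rule openin_subset)
  have fibU: "{u' \<in> U. pr u' = pr u} = (\<lambda>g. act g u) ` St" if u: "u \<in> U" for u
  proof (intro equalityI subsetI)
    fix u' assume u': "u' \<in> {u' \<in> U. pr u' = pr u}"
    then obtain g where g: "g \<in> A" "act g u = u'" using fibre[of u u'] u UX by auto
    then have "act g x = x" using sep[of g u] u u' UU1 unfolding U1_def by blast
    then show "u' \<in> (\<lambda>g. act g u) ` St" using g unfolding St_def by blast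
  next
    fix u' assume "u' \<in> (\<lambda>g. act g u) ` St"
    then obtain g where g: "g \<in> St" "u' = act g u" by blast
    have uX: "u \<in> topspace TX" using u UX by blast
    have gA: "g \<in> A" using g unfolding St_def by blast
    have "act h (act g u) \<in> U1" if h: "h \<in> St" for h
    proof -
      obtain k where k: "k \<in> A" "\<forall>x\<in>topspace TX. act k x = act h (act g x)"
        using act_mult[of h g] h gA unfolding St_def by blast
      then have "k \<in> St" using g h x unfolding St_def by auto
      then have "act k u \<in> U1" using u unfolding U_def by blast
      then show ?thesis using k uX by simp
    qed
    then show "u' \<in> {u' \<in> U. pr u' = pr u}"
      using act_in[OF gA uX] pr_act[OF gA uX] g(2) by (simp add: U_def)
  qed
  show "\<exists>U. openin TX U \<and> x \<in> U \<and> U \<subseteq> W \<and> openin TY (pr ` U) \<and> {u \<in> U. pr u = pr x} = {x} \<and>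
          (\<forall>y\<in>pr ` U - {pr x}. card {u \<in> U. pr u = y} = card {g \<in> A. act g x = x})"
  proof (intro exI[of _ U] conjI ballI)
    show "openin TY (pr ` U)" using open_map_pr Uo by (auto simp: open_map_def)
    show "U \<subseteq> W" using UU1 unfolding U1_def by blast
    show "{u \<in> U. pr u = pr x} = {x}"
    proof -
      have "(\<lambda>g. act g x) ` St = {x}" using eSt unfolding St_def by auto
      then show ?thesis using fibU[OF xU] by simp
    qed
    fix y assume "y \<in> pr ` U - {pr x}"
    then obtain u where u: "u \<in> U" "y = pr u" "u \<noteq> x" by blast
    then have "u \<notin> Z" using UU1 unfolding U1_def by blast
    then have "inj_on (\<lambda>g. act g u) A" using free[of u] u UX by blast
    then have "inj_on (\<lambda>g. act g u) St" by (rule inj_on_subset) (auto simp: St_def)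
    then show "card {u \<in> U. pr u = y} = card {g \<in> A. act g x = x}"
      using fibU[OF u(1)] u(2) card_image[of "\<lambda>g. act g u" St] by (simp add: St_def)
  qed (use Uo xU in auto)
qed

end

section \<open>Radial projection of a bipyramid and geometric realisations\<close>

lemma continuous_map_real_min:
  "continuous_map T euclideanreal f \<Longrightarrow> continuous_map T euclideanreal g \<Longrightarrow>
    continuous_map T euclideanreal (\<lambda>x. min (f x) (g x))"
  by (simp add: continuous_map_atin tendsto_min)

lemma continuous_map_real_max:
  "continuous_map T euclideanreal f \<Longrightarrow> continuous_map T euclideanreal g \<Longrightarrow>
    continuous_map T euclideanreal (\<lambda>x. max (f x) (g x))"
  by (simp add: continuous_map_atin tendsto_max)

text \<open>The double of the triangle with barycentric coordinates u, v, 1 - u - v: the sign of the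
  height h tells the two sheets apart.\<close>

definition bipyramid :: "real \<Rightarrow> real \<Rightarrow> real \<Rightarrow> bool" where
  "bipyramid u v h \<longleftrightarrow> u \<ge> 0 \<and> v \<ge> 0 \<and> u + v \<le> 1 \<and> \<bar>h\<bar> = min u (min v (1 - u - v))"

text \<open>Distance to the centre of projection (1/3, 1/3, 0), which lies midway between the
  sheets: over u = v = 1/3 they have heights 1/3 and -1/3.\<close>

definition radial :: "real \<Rightarrow> real \<Rightarrow> real \<Rightarrow> real" where
  "radial u v h = sqrt ((u - 1/3)\<^sup>2 + (v - 1/3)\<^sup>2 + h\<^sup>2)"

definition sphere_pt :: "real \<Rightarrow> real \<Rightarrow> real \<Rightarrow> nat \<Rightarrow> real" where
  "sphere_pt u v h = (\<lambda>i. if i = 0 then (u - 1/3) / radial u v h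
     else if i = 1 then (v - 1/3) / radial u v h
     else if i = 2 then h / radial u v h else 0)"

lemma radial_pos:
  assumes "bipyramid u v h" shows "radial u v h > 0"
proof -
  have "u \<noteq> 1/3 \<or> v \<noteq> 1/3 \<or> h \<noteq> 0"
  proof (rule ccontr)
    assume "\<not> ?thesis"
    then have "u = 1/3" "v = 1/3" "h = 0" by auto
    then show False using assms by (simp add: bipyramid_def)
  qed
  then have "(u - 1/3)\<^sup>2 + (v - 1/3)\<^sup>2 + h\<^sup>2 > 0"
    by (auto simp: add_pos_nonneg add_nonneg_pos)
  then show ?thesis by (simp add: radial_def)
qed

lemma topspace_nsphere_2:
  "z \<in> topspace (nsphere 2) \<longleftrightarrow> (z 0)\<^sup>2 + (z 1)\<^sup>2 + (z 2)\<^sup>2 = 1 \<and> (\<forall>i>2. z i = 0)"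
  by (simp add: nsphere numeral_2_eq_2 add.assoc)

lemma sphere_pt_in: "bipyramid u v h \<Longrightarrow> sphere_pt u v h \<in> topspace (nsphere 2)"
proof -
  assume "bipyramid u v h"
  then have r: "radial u v h > 0" by (rule radial_pos)
  have "(radial u v h)\<^sup>2 = (u - 1/3)\<^sup>2 + (v - 1/3)\<^sup>2 + h\<^sup>2"
    by (simp add: radial_def)
  then have "((u - 1/3)\<^sup>2 + (v - 1/3)\<^sup>2 + h\<^sup>2) / (radial u v h)\<^sup>2 = 1"
    using r by (metis div_self less_irrefl power_not_zero)
  then show ?thesis
    unfolding topspace_nsphere_2 by (simp add: sphere_pt_def power_divide add_divide_distrib)
qed

text \<open>The bipyramid is star-shaped about its barycentre, so radial projection is injective.\<close>

lemma bipyramid_ray: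
  assumes d: "bipyramid u v h" "bipyramid u' v' h'" and r: "r \<ge> 1"
    and e: "u - 1/3 = r * (u' - 1/3)" "v - 1/3 = r * (v' - 1/3)" "h = r * h'"
  shows "r = 1"
proof (rule ccontr)
  assume "r \<noteq> 1"
  with r have r1: "r > 1" by simp
  \<comment> \<open>Dilation by r from the centre multiplies the height by r but turns a barycentric
    coordinate w into \<open>r * w - (r - 1) / 3\<close>. The coordinate attaining the minimum
    therefore drops below the height.\<close>
  have a: "\<bar>h\<bar> = r * \<bar>h'\<bar>" using e(3) r by (simp add: abs_mult)
  have uvw: "u = r * u' - (r - 1) / 3" "v = r * v' - (r - 1) / 3"
    "1 - u - v = r * (1 - u' - v') - (r - 1) / 3"
    using e by (simp_all add: field_simps)
  have hle: "\<bar>h\<bar> \<le> u" "\<bar>h\<bar> \<le> v" "\<bar>h\<bar> \<le> 1 - u - v"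
    using d(1) by (auto simp: bipyramid_def)
  have "\<bar>h'\<bar> = u' \<or> \<bar>h'\<bar> = v' \<or> \<bar>h'\<bar> = 1 - u' - v'"
    using d(2) unfolding bipyramid_def min_def by (auto split: if_splits)
  then have "r * \<bar>h'\<bar> = u + (r - 1) / 3 \<or> r * \<bar>h'\<bar> = v + (r - 1) / 3 \<or>
      r * \<bar>h'\<bar> = 1 - u - v + (r - 1) / 3"
    using uvw by auto
  moreover have "(r - 1) / 3 > 0" using r1 by simp
  ultimately have "\<bar>h\<bar> < r * \<bar>h'\<bar>" using hle by linarith
  then show False using a by simp
qed

lemma sphere_pt_inj:
  assumes d: "bipyramid u v h" "bipyramid u' v' h'" and eq: "sphere_pt u v h = sphere_pt u' v' h'"
  shows "u = u' \<and> v = v' \<and> h = h'"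
proof -
  \<comment> \<open>The point of larger radius is taken first, so that the ratio of the radii is at
    least 1.\<close>
  have main: "u = u' \<and> v = v' \<and> h = h'"
    if d: "bipyramid u v h" "bipyramid u' v' h'" and eq: "sphere_pt u v h = sphere_pt u' v' h'"
      and le: "radial u' v' h' \<le> radial u v h" for u v h u' v' h'
  proof -
    let ?r = "radial u v h / radial u' v' h'"
    have p: "radial u v h > 0" "radial u' v' h' > 0" using radial_pos d by auto
    have "sphere_pt u v h 0 = sphere_pt u' v' h' 0" "sphere_pt u v h 1 = sphere_pt u' v' h' 1"
      "sphere_pt u v h 2 = sphere_pt u' v' h' 2" using eq by simp_all
    then have e: "u - 1/3 = ?r * (u' - 1/3)" "v - 1/3 = ?r * (v' - 1/3)" "h = ?r * h'"
      using p by (simp_all add: sphere_pt_def divide_simps mult.commute)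
    have "?r \<ge> 1" using p le by simp
    then have "?r = 1" using bipyramid_ray[OF d _ e] by blast
    then show ?thesis using e by simp
  qed
  show ?thesis
  proof (cases "radial u' v' h' \<le> radial u v h")
    case True
    then show ?thesis using main[OF d eq] by blast
  next
    case False
    then show ?thesis using main[OF d(2,1) eq[symmetric]] by auto
  qed
qed

lemma sphere_pt_surj:
  assumes z: "z \<in> topspace (nsphere 2)"
  obtains u v h where "bipyramid u v h" "sphere_pt u v h = z"
proof -
  have n: "(z 0)\<^sup>2 + (z 1)\<^sup>2 + (z 2)\<^sup>2 = 1" and z0: "\<And>i. i > 2 \<Longrightarrow> z i = 0"
    using z unfolding topspace_nsphere_2 by auto
  \<comment> \<open>On the ray from the centre in direction z the barycentric coordinates are 1/3 +
    k w, with w one of \<open>z 0\<close>, \<open>z 1\<close>, \<open>- z 0 - z 1\<close>; m is the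
    least w, and m \<le> 0 because the three sum to 0. The scale k solves
    \<open>k * \<bar>z 2\<bar> = 1/3 + k * m\<close>, the equation of the bipyramid.\<close>
  define m where "m = min (z 0) (min (z 1) (- z 0 - z 1))"
  define k where "k = 1 / (3 * (\<bar>z 2\<bar> - m))"
  have m: "m \<le> 0" unfolding m_def by (auto simp: min_def)
  have pos: "\<bar>z 2\<bar> - m > 0"
  proof (rule ccontr)
    assume "\<not> ?thesis"
    then have "z 2 = 0" "m = 0" using m by auto
    then have "z 0 = 0" "z 1 = 0" "z 2 = 0"
      unfolding m_def by (auto simp: min_def split: if_splits)
    then show False using n by simp
  qed
  then have k: "k > 0" unfolding k_def by simp
  have km: "k * \<bar>z 2\<bar> = 1/3 + k * m"
    using pos unfolding k_def by (simp add: field_simps)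
  have ge: "m \<le> z 0" "m \<le> z 1" "m \<le> - z 0 - z 1" unfolding m_def by auto
  have kge: "k * m \<le> k * z 0" "k * m \<le> k * z 1" "k * m \<le> k * (- z 0 - z 1)"
    using ge k by (auto intro: mult_left_mono)
  have h0: "0 \<le> k * \<bar>z 2\<bar>" using k by simp
  let ?u = "1/3 + k * z 0" and ?v = "1/3 + k * z 1" and ?h = "k * z 2"
  have w: "1 - ?u - ?v = 1/3 + k * (- z 0 - z 1)" by (simp add: algebra_simps)
  have "m = z 0 \<or> m = z 1 \<or> m = - z 0 - z 1" unfolding m_def by (auto simp: min_def)
  then have "min ?u (min ?v (1 - ?u - ?v)) = 1/3 + k * m"
    unfolding w using kge by fastforce
  then have d: "bipyramid ?u ?v ?h"
    unfolding bipyramid_def using km h0 kge w k by (auto simp: abs_mult)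
  have "radial ?u ?v ?h = sqrt (k\<^sup>2 * ((z 0)\<^sup>2 + (z 1)\<^sup>2 + (z 2)\<^sup>2))"
    unfolding radial_def by (simp add: power_mult_distrib algebra_simps)
  then have "radial ?u ?v ?h = k" using n k by (simp add: real_sqrt_mult)
  then have "sphere_pt ?u ?v ?h = z"
    unfolding sphere_pt_def using k z0 by (auto simp: fun_eq_iff)
  with d show thesis by (rule that)
qed

lemma continuous_map_sphere_pt:
  assumes c: "continuous_map T euclideanreal U" "continuous_map T euclideanreal V"
      "continuous_map T euclideanreal H"
    and d: "\<And>p. p \<in> topspace T \<Longrightarrow> bipyramid (U p) (V p) (H p)"
  shows "continuous_map T (nsphere 2) (\<lambda>p. sphere_pt (U p) (V p) (H p))"
proof -
  let ?r = "\<lambda>p. radial (U p) (V p) (H p)"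
  have r: "continuous_map T euclideanreal ?r"
    unfolding radial_def
    by (intro continuous_map_sqrt continuous_map_add continuous_map_real_pow
        continuous_map_diff c continuous_map_canonical_const)
  have nz: "?r p \<noteq> 0" if "p \<in> topspace T" for p using radial_pos d that by force
  have "continuous_map T euclideanreal (\<lambda>p. sphere_pt (U p) (V p) (H p) i)" for i
  proof -
    consider "i = 0" | "i = 1" | "i = 2" | "i > 2" by linarith
    then show ?thesis
      by cases (simp_all add: sphere_pt_def continuous_map_real_divide
          continuous_map_diff c r nz)
  qed
  moreover have "(\<lambda>p. sphere_pt (U p) (V p) (H p)) ` topspace T \<subseteq> topspace (nsphere 2)"
    using sphere_pt_in d by blast
  ultimately show ?thesis
    unfolding nsphere continuous_map_in_subtopology continuous_map_componentwise_UNIV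
    by (simp add: nsphere image_subset_iff_funcset)
qed

lemma Hausdorff_nsphere: "Hausdorff_space (nsphere n)"
  unfolding nsphere by (intro Hausdorff_space_subtopology) (simp add: Hausdorff_space_product_topology)

section \<open>Barycentric coordinates and compactness of the realisation\<close>

definition bary :: "'v tri \<Rightarrow> real \<Rightarrow> real \<Rightarrow> real \<Rightarrow> 'v \<Rightarrow> real" where
  "bary t \<alpha> \<beta> \<gamma> = (\<lambda>w. \<alpha> * vpt (fst t) w + \<beta> * vpt (fst (snd t)) w + \<gamma> * vpt (snd (snd t)) w)"

lemma tri_simplex_bary:
  "tri_simplex t = {bary t \<alpha> \<beta> \<gamma> | \<alpha> \<beta> \<gamma>. \<alpha> \<ge> 0 \<and> \<beta> \<ge> 0 \<and> \<gamma> \<ge> 0 \<and> \<alpha> + \<beta> + \<gamma> = 1}"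
  by (cases t) (simp add: tri_simplex_def bary_def)

lemma in_realize:
  "p \<in> realize T \<longleftrightarrow> (\<exists>t\<in>T. \<exists>\<alpha> \<beta> \<gamma>. p = bary t \<alpha> \<beta> \<gamma> \<and> \<alpha> \<ge> 0 \<and> \<beta> \<ge> 0 \<and> \<gamma> \<ge> 0 \<and> \<alpha> + \<beta> + \<gamma> = 1)"
  unfolding realize_def tri_simplex_bary by blast

lemma topspace_geo [simp]: "topspace (geo T) = realize T"
  by (simp add: geo_def)

lemma Hausdorff_geo: "Hausdorff_space (geo T)"
  unfolding geo_def by (intro Hausdorff_space_subtopology) (simp add: Hausdorff_space_product_topology)

lemma continuous_map_geo_coord: "continuous_map (geo T) euclideanreal (\<lambda>p. p v)"
  unfolding geo_def by (blast intro: continuous_map_from_subtopology continuous_map_product_projection)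

lemma compact_geo:
  assumes "finite T" shows "compact_space (geo T)"
proof -
  \<comment> \<open>The standard simplex of barycentric coordinates; each triangle of the
    realisation is a continuous image of it.\<close>
  let ?D = "{x :: real \<times> real \<times> real. fst x \<ge> 0 \<and> fst (snd x) \<ge> 0 \<and> snd (snd x) \<ge> 0 \<and>
      fst x + fst (snd x) + snd (snd x) = 1}"
  have "compact ?D"
  proof (unfold compact_eq_bounded_closed, rule conjI)
    have "?D = {x. 0 \<le> fst x} \<inter> {x. 0 \<le> fst (snd x)} \<inter> {x. 0 \<le> snd (snd x)} \<inter>
        {x. fst x + fst (snd x) + snd (snd x) = 1}" by auto
    also have "closed \<dots>"
      by (intro closed_Int closed_Collect_le closed_Collect_eq continuous_intros)
    finally show "closed ?D" .
    have "?D \<subseteq> cbox (0, 0, 0) (1, 1, 1)" by (auto simp: cbox_Pair_eq)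
    then show "bounded ?D" using bounded_cbox bounded_subset by blast
  qed
  then have cD: "compactin euclidean ?D" by simp
  have "compactin (powertop_real UNIV) (tri_simplex t)" for t :: "'a tri"
  proof -
    let ?f = "\<lambda>x :: real \<times> real \<times> real. bary t (fst x) (fst (snd x)) (snd (snd x))"
    have "continuous_map euclidean (powertop_real UNIV) ?f"
      unfolding continuous_map_componentwise_UNIV bary_def
      by (simp add: continuous_map_iff_continuous2, intro allI continuous_intros)
    from image_compactin[OF cD this] have "compactin (powertop_real UNIV) (?f ` ?D)" .
    moreover have "?f ` ?D = tri_simplex t"
    proof (intro equalityI subsetI)
      fix p assume "p \<in> tri_simplex t"
      then obtain \<alpha> \<beta> \<gamma> where "p = ?f (\<alpha>, \<beta>, \<gamma>)" "(\<alpha>, \<beta>, \<gamma>) \<in> ?D"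
        unfolding tri_simplex_bary by auto
      then show "p \<in> ?f ` ?D" by blast
    qed (unfold tri_simplex_bary, blast)
    ultimately show ?thesis by simp
  qed
  then have "compactin (powertop_real UNIV) (realize T)"
    unfolding realize_def using assms by (intro compactin_Union) auto
  then show ?thesis
    unfolding geo_def by (simp add: compact_space_subtopology)
qed

text \<open>The corners u = 1, v = 1 and 1 - u - v = 1 of the equatorial triangle; they become the
  three branch points.\<close>

definition pole1 :: "nat \<Rightarrow> real" where "pole1 = sphere_pt 1 0 0"
definition pole2 :: "nat \<Rightarrow> real" where "pole2 = sphere_pt 0 1 0"
definition pole3 :: "nat \<Rightarrow> real" where "pole3 = sphere_pt 0 0 0"

lemma poles_distinct: "card {pole1, pole2, pole3} = 3"
proof -
  have d: "bipyramid 1 0 0" "bipyramid 0 1 0" "bipyramid 0 0 0" by (simp_all add: bipyramid_def)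
  have "pole1 \<noteq> pole2" "pole1 \<noteq> pole3" "pole2 \<noteq> pole3"
    unfolding pole1_def pole2_def pole3_def
    using sphere_pt_inj[OF d(1,2)] sphere_pt_inj[OF d(1,3)] sphere_pt_inj[OF d(2,3)] by auto
  then show ?thesis by simp
qed

lemma vpt_bary:
  "vpt a = bary (a, b, c) 1 0 0" "vpt b = bary (a, b, c) 0 1 0" "vpt c = bary (a, b, c) 0 0 1"
  by (auto simp: bary_def fun_eq_iff)

lemma midpt_bary: "midpt a b = bary (a, b, c) (1/2) (1/2) 0"
  by (auto simp: bary_def midpt_def fun_eq_iff)

lemma vpt_eq [simp]: "vpt u = vpt v \<longleftrightarrow> u = v"
  by (auto simp: vpt_def fun_eq_iff)

section \<open>Triangulated surfaces\<close>

lemma tri_vs_tmap: "tri_vs (tmap \<sigma> t) = \<sigma> ` tri_vs t"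
  by (cases t) (auto simp: tri_vs_def tmap_def)

text \<open>Triples are oriented triangles with the type 2 vertex last. The neighbours across ab, ac
  and bc are written \<open>(b, a, c')\<close>, \<open>(b', a, c)\<close> and
  \<open>(b, a', c)\<close>: each traverses the common edge in the opposite direction, so coherence
  of the orientation is built into the order. By the \<open>uniq\<close> clauses a directed edge
  lies in one triangle only, \<open>oriented\<close> excludes a triangle together with its mirror
  image, and \<open>conn\<close> is connectedness through edges in the form of an induction
  rule.\<close>

locale tri_surface =
  fixes S :: "'v tri set"
  assumes finS: "finite S"
    and edge_distinct: "(a, b, c) \<in> S \<Longrightarrow> a \<noteq> b"
    and typed: "(a, b, c) \<in> S \<Longrightarrow> (a', b', c') \<in> S \<Longrightarrow> c \<noteq> a' \<and> c \<noteq> b'"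
    and nb0: "(a, b, c) \<in> S \<Longrightarrow> \<exists>c'. (b, a, c') \<in> S"
    and nb1: "(a, b, c) \<in> S \<Longrightarrow> \<exists>b'. (b', a, c) \<in> S"
    and nb2: "(a, b, c) \<in> S \<Longrightarrow> \<exists>a'. (b, a', c) \<in> S"
    and uniq3: "(a, b, c) \<in> S \<Longrightarrow> (a, b, c') \<in> S \<Longrightarrow> c = c'"
    and uniq2: "(a, b, c) \<in> S \<Longrightarrow> (a, b', c) \<in> S \<Longrightarrow> b = b'"
    and uniq1: "(a, b, c) \<in> S \<Longrightarrow> (a', b, c) \<in> S \<Longrightarrow> a = a'"
    and oriented: "(a, b, c) \<in> S \<Longrightarrow> (b, a, c) \<notin> S"
    and conn: "\<lbrakk>t \<in> S; t \<in> R;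
        \<And>a b c c'. (a, b, c) \<in> S \<Longrightarrow> (a, b, c) \<in> R \<Longrightarrow> (b, a, c') \<in> S \<Longrightarrow> (b, a, c') \<in> R;
        \<And>a b c b'. (a, b, c) \<in> S \<Longrightarrow> (a, b, c) \<in> R \<Longrightarrow> (b', a, c) \<in> S \<Longrightarrow> (b', a, c) \<in> R;
        \<And>a b c a'. (a, b, c) \<in> S \<Longrightarrow> (a, b, c) \<in> R \<Longrightarrow> (b, a', c) \<in> S \<Longrightarrow> (b, a', c) \<in> R\<rbrakk>
      \<Longrightarrow> S \<subseteq> R"
begin

definition tri_auts :: "('v \<Rightarrow> 'v) set" where
  "tri_auts = {\<sigma>. \<sigma> \<in> extensional (verts S) \<and> bij_betw \<sigma> (verts S) (verts S) \<and> tmap \<sigma> ` S = S}"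

lemma finite_verts: "finite (verts S)"
  using finS by (auto simp: verts_def tri_vs_def)

lemma in_verts: "(a, b, c) \<in> S \<Longrightarrow> a \<in> verts S \<and> b \<in> verts S \<and> c \<in> verts S"
  by (force simp: verts_def tri_vs_def)

lemma not_centre: "(a, b, c) \<in> S \<Longrightarrow> (c, y, z) \<notin> S" "(a, b, c) \<in> S \<Longrightarrow> (y, c, z) \<notin> S"
  using typed by blast+

lemma edge_midpoints_iff: "m \<in> edge_midpoints S \<longleftrightarrow> (\<exists>a b c. (a, b, c) \<in> S \<and> m = midpt a b)"
  unfolding edge_midpoints_def by force

lemma first_verts: "v \<in> fst ` S \<longleftrightarrow> (\<exists>b c. (v, b, c) \<in> S)"
  by force

lemma verts_cases:
  assumes "v \<in> verts S"
  obtains (one) b c where "(v, b, c) \<in> S" | (two) a b where "(a, b, v) \<in> S"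
proof -
  obtain a b c where t: "(a, b, c) \<in> S" "v \<in> {a, b, c}"
    using assms by (auto simp: verts_def tri_vs_def)
  then consider "v = a" | "v = b" | "v = c" by blast
  then show thesis
  proof cases
    case 2
    then show thesis using nb0[OF t(1)] one by blast
  qed (use t one two in blast)+
qed

lemma tri_auts_tri: "\<sigma> \<in> tri_auts \<Longrightarrow> (a, b, c) \<in> S \<Longrightarrow> (\<sigma> a, \<sigma> b, \<sigma> c) \<in> S"
  unfolding tri_auts_def tmap_def by force

text \<open>Unique continuation: a directed edge lies in a single triangle, so the image of a
  triangle fixes the images of its neighbours, and connectedness spreads the agreement.\<close>

lemma tri_auts_eq:
  assumes st: "\<sigma> \<in> tri_auts" "\<tau> \<in> tri_auts" and t: "(a, b, c) \<in> S"
    and eq: "\<sigma> a = \<tau> a" "\<sigma> b = \<tau> b" "\<sigma> c = \<tau> c"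
  shows "\<sigma> = \<tau>"
proof -
  let ?R = "{(a, b, c). \<sigma> a = \<tau> a \<and> \<sigma> b = \<tau> b \<and> \<sigma> c = \<tau> c}"
  have "S \<subseteq> ?R"
  proof (rule conn[OF t])
    show "(a, b, c) \<in> ?R" using eq by simp
  next
    fix a b c c' assume *: "(a, b, c) \<in> ?R" "(b, a, c') \<in> S"
    show "(b, a, c') \<in> ?R"
      using *(1) tri_auts_tri[OF st(1) *(2)] tri_auts_tri[OF st(2) *(2)]
        uniq3[of "\<tau> b" "\<tau> a" "\<sigma> c'" "\<tau> c'"] by simp
  next
    fix a b c b' assume *: "(a, b, c) \<in> ?R" "(b', a, c) \<in> S"
    show "(b', a, c) \<in> ?R"
      using *(1) tri_auts_tri[OF st(1) *(2)] tri_auts_tri[OF st(2) *(2)]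
        uniq1[of "\<sigma> b'" "\<tau> a" "\<tau> c" "\<tau> b'"] by simp
  next
    fix a b c a' assume *: "(a, b, c) \<in> ?R" "(b, a', c) \<in> S"
    show "(b, a', c) \<in> ?R"
      using *(1) tri_auts_tri[OF st(1) *(2)] tri_auts_tri[OF st(2) *(2)]
        uniq2[of "\<tau> b" "\<sigma> a'" "\<tau> c" "\<tau> a'"] by simp
  qed
  then have "\<sigma> v = \<tau> v" if "v \<in> verts S" for v
    using that by (auto simp: verts_def tri_vs_def)
  then show ?thesis
    using st unfolding tri_auts_def by (auto intro: extensionalityI)
qed

lemma inj_on_tri_auts: "t \<in> S \<Longrightarrow> inj_on (\<lambda>\<sigma>. tmap \<sigma> t) tri_auts"
  by (cases t) (auto simp: tmap_def intro!: inj_onI tri_auts_eq)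

text \<open>Evaluation at one triangle embeds the automorphisms into the set of triangles.\<close>

lemma finite_tri_auts: "finite tri_auts" and card_tri_auts_le: "card tri_auts \<le> card S"
  if "S \<noteq> {}"
proof -
  obtain t where t: "t \<in> S" using \<open>S \<noteq> {}\<close> by blast
  have sub: "(\<lambda>\<sigma>. tmap \<sigma> t) ` tri_auts \<subseteq> S" using t by (auto simp: tri_auts_def)
  show "finite tri_auts" using inj_on_finite[OF inj_on_tri_auts[OF t] sub finS] .
  show "card tri_auts \<le> card S" using card_inj_on_le[OF inj_on_tri_auts[OF t] sub finS] .
qed

text \<open>An edge between type 1 vertices is traversed once in each direction, by the two
  triangles at its sides.\<close>

lemma card_edges: "card S = 2 * card (cell_edges S)"
proof -
  let ?f = "\<lambda>t :: 'v tri. {fst t, fst (snd t)}"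
  have e: "cell_edges S = ?f ` S" unfolding cell_edges_def by blast
  have "card {t \<in> S. ?f t = e} = 2" if e: "e \<in> ?f ` S" for e
  proof -
    obtain a b c where t: "(a, b, c) \<in> S" "e = {a, b}" using e by auto
    obtain c' where t': "(b, a, c') \<in> S" using nb0 t(1) by blast
    have "{t \<in> S. ?f t = e} = {(a, b, c), (b, a, c')}"
    proof (intro equalityI subsetI)
      fix s assume "s \<in> {t \<in> S. ?f t = e}"
      then obtain d where "(a, b, d) \<in> S \<and> s = (a, b, d) \<or> (b, a, d) \<in> S \<and> s = (b, a, d)"
        unfolding t(2) by (cases s) (auto simp: doubleton_eq_iff)
      then show "s \<in> {(a, b, c), (b, a, c')}" using uniq3[OF t(1)] uniq3[OF t'] by blast
    qed (use t t' in auto)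
    then show ?thesis using edge_distinct[OF t(1)] by simp
  qed
  then have "card S = (\<Sum>e\<in>?f ` S. 2)"
    using sum.image_gen[OF finS, of "\<lambda>_. 1 :: nat" ?f] by simp
  then show ?thesis unfolding e by simp
qed

lemma valency_eq:
  assumes "(a, b, c) \<in> S"
  shows "valency S a = card {t \<in> S. fst t = a}"
proof -
  let ?P = "{t \<in> S. fst t = a}" and ?Q = "{t \<in> S. fst (snd t) = a}"
  have "{t \<in> S. a \<in> tri_vs t} = ?P \<union> ?Q"
    using assms by (auto simp: tri_vs_def dest: not_centre)
  moreover have "?P \<inter> ?Q = {}" by (auto dest: edge_distinct)
  \<comment> \<open>Crossing the edge between the type 1 vertices is an involution that exchanges
    the triangles with a in first and in second place.\<close>
  moreover have "card ?P = card ?Q"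
  proof (rule bij_betw_same_card[of "\<lambda>t. (fst (snd t), fst t, THE c'. (fst (snd t), fst t, c') \<in> S)"])
    have the: "(THE c'. (b, a, c') \<in> S) = c1" if "(b, a, c1) \<in> S" for b a c1
      using that uniq3 by blast
    show "bij_betw (\<lambda>t. (fst (snd t), fst t, THE c'. (fst (snd t), fst t, c') \<in> S)) ?P ?Q"
    proof (rule bij_betwI[where g = "\<lambda>t. (fst (snd t), fst t, THE c'. (fst (snd t), fst t, c') \<in> S)"])
    qed (use nb0 the in fastforce)+
  qed
  ultimately have "card {t \<in> S. a \<in> tri_vs t} = 2 * card ?P"
    using finS by (simp add: card_Un_disjoint)
  then show ?thesis by (simp add: valency_def)
qed

lemma centre_tris:
  assumes "(a, b, c) \<in> S"
  shows "{t \<in> S. c \<in> tri_vs t} = {t \<in> S. snd (snd t) = c}"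
  using not_centre[OF assms] by (auto simp: tri_vs_def)

lemma bary_at:
  assumes "(a, b, c) \<in> S"
  shows "bary (a, b, c) \<alpha> \<beta> \<gamma> w = (if w = a then \<alpha> else if w = b then \<beta> else if w = c then \<gamma> else 0)"
  using edge_distinct[OF assms] typed[OF assms assms] by (auto simp: bary_def vpt_def)

text \<open>Allowing any g with g 0 = 0 covers the coordinates and their squares, the two kinds of
  sums over vertices that enter the invariant functions.\<close>

lemma sum_bary:
  assumes t: "(a, b, c) \<in> S" and g: "g 0 = (0 :: real)" and F: "finite F"
  shows "(\<Sum>w\<in>F. g (bary (a, b, c) \<alpha> \<beta> \<gamma> w)) =
    (if a \<in> F then g \<alpha> else 0) + (if b \<in> F then g \<beta> else 0) + (if c \<in> F then g \<gamma> else 0)"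
proof -
  have "(\<Sum>w\<in>F. g (bary (a, b, c) \<alpha> \<beta> \<gamma> w)) =
      (\<Sum>w\<in>F. (if w = a then g \<alpha> else 0) + (if w = b then g \<beta> else 0) + (if w = c then g \<gamma> else 0))"
    using edge_distinct[OF t] typed[OF t t] g by (intro sum.cong) (auto simp: bary_at[OF t])
  then show ?thesis using F by (simp add: sum.distrib)
qed

text \<open>A point of the realisation is interior to at most one triangle.\<close>

lemma sum_tri_bary:
  fixes f :: "'v tri \<Rightarrow> real \<Rightarrow> real \<Rightarrow> real \<Rightarrow> real" and \<alpha> \<beta> \<gamma> :: real and a b c :: 'v
  assumes t: "(a, b, c) \<in> S"
    and f: "\<And>t x y z. x = 0 \<or> y = 0 \<or> z = 0 \<Longrightarrow> f t x y z = 0"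
  defines "p \<equiv> bary (a, b, c) \<alpha> \<beta> \<gamma>"
  shows "(\<Sum>s\<in>S. f s (p (fst s)) (p (fst (snd s))) (p (snd (snd s)))) = f (a, b, c) \<alpha> \<beta> \<gamma>"
proof -
  let ?g = "\<lambda>s. f s (p (fst s)) (p (fst (snd s))) (p (snd (snd s)))"
  \<comment> \<open>A nonzero term needs all vertices of s in the support of p, so s has the
    vertices of (a, b, c), and the mirror image is excluded by orientation.\<close>
  have zero: "?g s = 0" if s: "s \<in> S" "s \<noteq> (a, b, c)" for s
  proof (rule ccontr)
    assume "?g s \<noteq> 0"
    then have nz: "p (fst s) \<noteq> 0" "p (fst (snd s)) \<noteq> 0" "p (snd (snd s)) \<noteq> 0" using f by metis+
    obtain a' b' c' where s': "s = (a', b', c')" by (cases s)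
    have S': "(a', b', c') \<in> S" using s s' by simp
    have "c' = c" "a' = a \<or> a' = b" "b' = a \<or> b' = b"
      using nz typed[OF S' t] typed[OF t S'] unfolding p_def s' by (auto simp: bary_at[OF t] split: if_splits)
    then show False
      using S' s(2) s' oriented[OF t] edge_distinct[OF S'] by auto
  qed
  have "sum ?g S = sum ?g {(a, b, c)}"
    using zero t finS by (intro sum.mono_neutral_right) auto
  also have "\<dots> = f (a, b, c) \<alpha> \<beta> \<gamma>"
    using edge_distinct[OF t] typed[OF t t] unfolding p_def by (simp add: bary_at[OF t])
  finally show ?thesis .
qed

text \<open>A point determines the vertices that carry weight, with one ambiguity: equal weights on
  a and b do not tell which of them comes first. This ambiguity is the source of the branching at
  midpoints of edges.\<close>

lemma bary_eq_cases:
  assumes t: "(a, b, c) \<in> S" "(a', b', c') \<in> S"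
    and eq: "bary (a, b, c) \<alpha> \<beta> \<gamma> = bary (a', b', c') \<alpha> \<beta> \<gamma>"
    and pos: "\<alpha> \<ge> 0" "\<beta> \<ge> 0" "\<gamma> \<ge> 0"
  shows "(\<gamma> \<noteq> 0 \<longrightarrow> c = c') \<and>
    ((\<alpha> \<noteq> 0 \<longrightarrow> a = a') \<and> (\<beta> \<noteq> 0 \<longrightarrow> b = b') \<or> \<alpha> = \<beta> \<and> a = b' \<and> b = a')"
proof -
  have e: "bary (a, b, c) \<alpha> \<beta> \<gamma> w = bary (a', b', c') \<alpha> \<beta> \<gamma> w" for w using eq by simp
  have ne: "c \<noteq> a" "c \<noteq> b" "c' \<noteq> a" "c' \<noteq> b" "c \<noteq> a'" "c \<noteq> b'" "a \<noteq> b" "a' \<noteq> b'"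
    using typed t edge_distinct by blast+
  have "\<gamma> \<noteq> 0 \<longrightarrow> c = c'"
    using e[of c] ne by (auto simp: bary_at[OF t(1)] bary_at[OF t(2)] split: if_splits)
  moreover have "(\<alpha> \<noteq> 0 \<longrightarrow> a = a') \<and> (\<beta> \<noteq> 0 \<longrightarrow> b = b') \<or> \<alpha> = \<beta> \<and> a = b' \<and> b = a'"
    using e[of a] e[of b] e[of a'] e[of b'] ne
    by (auto simp: bary_at[OF t(1)] bary_at[OF t(2)] split: if_splits)
  ultimately show ?thesis by blast
qed

lemma vpush_bary:
  assumes t: "(a, b, c) \<in> S"
  shows "vpush \<sigma> (bary (a, b, c) \<alpha> \<beta> \<gamma>) = bary (\<sigma> a, \<sigma> b, \<sigma> c) \<alpha> \<beta> \<gamma>"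
proof
  fix w
  let ?p = "bary (a, b, c) \<alpha> \<beta> \<gamma>"
  have ne: "a \<noteq> b" "c \<noteq> a" "c \<noteq> b" using typed t edge_distinct by blast+
  have "vpush \<sigma> ?p w = (\<Sum>u\<in>{u \<in> {a, b, c}. \<sigma> u = w}. ?p u)"
    unfolding vpush_def by (rule sum.mono_neutral_left) (auto simp: bary_at[OF t])
  also have "\<dots> = (\<Sum>u\<in>{a, b, c}. if \<sigma> u = w then ?p u else 0)"
    by (rule sum.inter_filter) simp
  also have "\<dots> = bary (\<sigma> a, \<sigma> b, \<sigma> c) \<alpha> \<beta> \<gamma> w"
    using ne by (auto simp: bary_at[OF t]) (auto simp: bary_def vpt_def)
  finally show "vpush \<sigma> ?p w = bary (\<sigma> a, \<sigma> b, \<sigma> c) \<alpha> \<beta> \<gamma> w" .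
qed

lemma realizeE:
  assumes "p \<in> realize S"
  obtains a b c \<alpha> \<beta> \<gamma> where "(a, b, c) \<in> S" "p = bary (a, b, c) \<alpha> \<beta> \<gamma>"
    "\<alpha> \<ge> 0" "\<beta> \<ge> 0" "\<gamma> \<ge> 0" "\<alpha> + \<beta> + \<gamma> = 1"
  using assms unfolding in_realize by (metis prod_cases3)

lemma realizeI:
  "(a, b, c) \<in> S \<Longrightarrow> \<alpha> \<ge> 0 \<Longrightarrow> \<beta> \<ge> 0 \<Longrightarrow> \<gamma> \<ge> 0 \<Longrightarrow> \<alpha> + \<beta> + \<gamma> = 1 \<Longrightarrow> bary (a, b, c) \<alpha> \<beta> \<gamma> \<in> realize S"
  unfolding in_realize by blast

lemma vpush_continuous:
  assumes "\<sigma> \<in> tri_auts"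
  shows "continuous_map (geo S) (geo S) (vpush \<sigma>)"
proof -
  have im: "vpush \<sigma> p \<in> realize S" if "p \<in> realize S" for p
    using that
  proof (rule realizeE)
    fix a b c \<alpha> \<beta> \<gamma> assume *: "(a, b, c) \<in> S" "p = bary (a, b, c) \<alpha> \<beta> \<gamma>"
      "\<alpha> \<ge> 0" "\<beta> \<ge> 0" "\<gamma> \<ge> 0" "\<alpha> + \<beta> + \<gamma> = 1"
    then show ?thesis using tri_auts_tri[OF assms] by (simp add: vpush_bary realizeI)
  qed
  have supp: "p u = 0" if "p \<in> realize S" "u \<notin> verts S" for p u
    using that(1)
    by (rule realizeE) (use that(2) in_verts in \<open>auto simp: bary_at\<close>)
  have "continuous_map (geo S) euclideanreal (\<lambda>p. vpush \<sigma> p w)" for w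
  proof (rule continuous_map_eq)
    \<comment> \<open>The defining sum runs over the support of p, which varies; extended by zeros
      to a fixed finite set of vertices it is a sum of coordinates.\<close>
    show "continuous_map (geo S) euclideanreal (\<lambda>p. \<Sum>u\<in>{u \<in> verts S. \<sigma> u = w}. p u)"
      using finite_verts by (intro continuous_map_sum continuous_map_geo_coord) auto
    show "(\<Sum>u\<in>{u \<in> verts S. \<sigma> u = w}. p u) = vpush \<sigma> p w" if "p \<in> topspace (geo S)" for p
      unfolding vpush_def using supp that finite_verts
      by (intro sum.mono_neutral_right) auto
  qed
  then show ?thesis
    unfolding geo_def continuous_map_in_subtopology continuous_map_componentwise_UNIV
    using im by (auto simp: geo_def[symmetric])
qed

text \<open>Seen from the neighbouring triangle, a boundary point has the coordinates of a and b
  exchanged. In this way points on different sheets are identified where the height vanishes; the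
  clause \<open>a1 = b \<or> b1 = a\<close> keeps track of the orbit of the new triangle.\<close>

lemma bary_flip:
  assumes t: "(a, b, c) \<in> S" and z: "\<alpha> = 0 \<or> \<beta> = 0 \<or> \<gamma> = 0"
  obtains a1 b1 c1 where "(a1, b1, c1) \<in> S" "a1 = b \<or> b1 = a"
    "bary (a, b, c) \<alpha> \<beta> \<gamma> = bary (a1, b1, c1) \<beta> \<alpha> \<gamma>"
  using z
proof (elim disjE)
  assume "\<alpha> = 0"
  obtain a' where "(b, a', c) \<in> S" using nb2 t by blast
  then show thesis using that[of b a' c] \<open>\<alpha> = 0\<close> by (simp add: bary_def)
next
  assume "\<beta> = 0"
  obtain b' where "(b', a, c) \<in> S" using nb1 t by blast
  then show thesis using that[of b' a c] \<open>\<beta> = 0\<close> by (simp add: bary_def)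
next
  assume "\<gamma> = 0"
  obtain c' where "(b, a, c') \<in> S" using nb0 t by blast
  then show thesis using that[of b a c'] \<open>\<gamma> = 0\<close> by (simp add: bary_def add.commute)
qed

end

section \<open>Actions transitive on the triangles around a vertex\<close>

text \<open>\<open>star_trans\<close> is the only transitivity required, and only for the first
  vertex of a triangle: for the second vertex it follows by crossing an edge, and centres are
  handled by composing two such rotations.\<close>

locale surface_action = tri_surface S for S :: "'v tri set" +
  fixes A :: "('v \<Rightarrow> 'v) set" and x y :: 'v and c0 c1 :: 'v
  assumes A_auts: "A \<subseteq> tri_auts"
    and A_one: "(\<lambda>v\<in>verts S. v) \<in> A"
    and A_comp: "\<sigma> \<in> A \<Longrightarrow> \<tau> \<in> A \<Longrightarrow> compose (verts S) \<sigma> \<tau> \<in> A"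
    and A_inv: "\<sigma> \<in> A \<Longrightarrow> \<exists>\<tau>\<in>A. \<forall>v\<in>verts S. \<tau> (\<sigma> v) = v"
    and star_trans: "(a, b, c) \<in> S \<Longrightarrow> (a, b', c') \<in> S \<Longrightarrow> \<exists>\<sigma>\<in>A. \<sigma> a = a \<and> \<sigma> b = b' \<and> \<sigma> c = c'"
    and base: "(x, y, c0) \<in> S" "(y, x, c1) \<in> S"
begin

definition moves :: "'v tri \<Rightarrow> 'v tri \<Rightarrow> bool" where
  "moves s t \<longleftrightarrow> (\<exists>\<sigma>\<in>A. tmap \<sigma> s = t)"

definition orb :: "'v \<Rightarrow> 'v set" where
  "orb v = {\<sigma> v | \<sigma>. \<sigma> \<in> A}"

lemma moves_iff: "moves (a, b, c) (a', b', c') \<longleftrightarrow> (\<exists>\<sigma>\<in>A. \<sigma> a = a' \<and> \<sigma> b = b' \<and> \<sigma> c = c')"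
  by (auto simp: moves_def tmap_def)

lemma A_tri: "\<sigma> \<in> A \<Longrightarrow> (a, b, c) \<in> S \<Longrightarrow> (\<sigma> a, \<sigma> b, \<sigma> c) \<in> S"
  using A_auts tri_auts_tri by blast

lemma A_verts: "\<sigma> \<in> A \<Longrightarrow> v \<in> verts S \<Longrightarrow> \<sigma> v \<in> verts S"
  using A_auts by (auto simp: tri_auts_def bij_betw_def)

lemma finite_A: "finite A"
proof -
  have "S \<noteq> {}" using base by blast
  then show ?thesis using finite_tri_auts A_auts finite_subset by blast
qed

lemma A_eq:
  "\<sigma> \<in> A \<Longrightarrow> \<tau> \<in> A \<Longrightarrow> (a, b, c) \<in> S \<Longrightarrow> \<sigma> a = \<tau> a \<Longrightarrow> \<sigma> b = \<tau> b \<Longrightarrow> \<sigma> c = \<tau> c \<Longrightarrow> \<sigma> = \<tau>"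
  using tri_auts_eq A_auts by blast

lemma moves_refl: "(a, b, c) \<in> S \<Longrightarrow> moves (a, b, c) (a, b, c)"
  using A_one in_verts[of a b c] unfolding moves_iff by (intro bexI[OF _ A_one]) simp

lemma moves_sym:
  assumes "moves (a, b, c) (a', b', c')" "(a, b, c) \<in> S"
  shows "moves (a', b', c') (a, b, c)"
proof -
  obtain \<sigma> where s: "\<sigma> \<in> A" "\<sigma> a = a'" "\<sigma> b = b'" "\<sigma> c = c'" using assms(1) moves_iff by blast
  obtain \<tau> where t: "\<tau> \<in> A" "\<forall>v\<in>verts S. \<tau> (\<sigma> v) = v" using A_inv s(1) by blast
  show ?thesis
    unfolding moves_iff using t s in_verts[OF assms(2)] by (intro bexI[OF _ t(1)]) auto
qed

lemma moves_trans:
  assumes "moves (a, b, c) (a', b', c')" "moves (a', b', c') (a'', b'', c'')" "(a, b, c) \<in> S"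
  shows "moves (a, b, c) (a'', b'', c'')"
proof -
  obtain \<sigma> where s: "\<sigma> \<in> A" "\<sigma> a = a'" "\<sigma> b = b'" "\<sigma> c = c'" using assms(1) moves_iff by blast
  obtain \<tau> where t: "\<tau> \<in> A" "\<tau> a' = a''" "\<tau> b' = b''" "\<tau> c' = c''" using assms(2) moves_iff by blast
  show ?thesis
    unfolding moves_iff using t s in_verts[OF assms(3)]
    by (intro bexI[OF _ A_comp[OF t(1) s(1)]]) (auto simp: compose_def)
qed

text \<open>Automorphisms commute with crossing an edge, because the triangle on the other side is
  unique.\<close>

lemma moves_nb0:
  assumes "moves (a, b, c) (a', b', c')" "(a, b, c) \<in> S" "(b, a, d) \<in> S" "(b', a', d') \<in> S"
  shows "moves (b, a, d) (b', a', d')"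
proof -
  obtain \<sigma> where s: "\<sigma> \<in> A" "\<sigma> a = a'" "\<sigma> b = b'" "\<sigma> c = c'" using assms(1) moves_iff by blast
  then have "(b', a', \<sigma> d) \<in> S" using A_tri[OF s(1) assms(3)] by simp
  then have "\<sigma> d = d'" using uniq3 assms(4) by blast
  then show ?thesis using s unfolding moves_iff by blast
qed

lemma moves_star: "(a, b, c) \<in> S \<Longrightarrow> (a, b', c') \<in> S \<Longrightarrow> moves (a, b, c) (a, b', c')"
  using star_trans moves_iff by metis

lemma moves_star':
  assumes "(a, b, c) \<in> S" "(a', b, c') \<in> S"
  shows "moves (a, b, c) (a', b, c')"
proof -
  obtain d d' where "(b, a, d) \<in> S" "(b, a', d') \<in> S" using nb0 assms by metis
  then show ?thesis using moves_nb0[OF moves_star] assms by blast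
qed

lemma subgroup_A: "subgroup (A) (BijGroup (verts S))"
proof -
  interpret B: group "BijGroup (verts S)" by (rule group_BijGroup)
  have sub: "A \<subseteq> Bij (verts S)" using A_auts by (auto simp: Bij_def tri_auts_def)
  have car: "carrier (BijGroup (verts S)) = Bij (verts S)" by (simp add: BijGroup_def)
  have mult: "\<sigma> \<otimes>\<^bsub>BijGroup (verts S)\<^esub> \<tau> = compose (verts S) \<sigma> \<tau>"
    if "\<sigma> \<in> A" "\<tau> \<in> A" for \<sigma> \<tau>
    using that sub by (simp add: BijGroup_def subset_iff)
  show ?thesis
  proof (rule B.subgroupI)
    show "A \<subseteq> carrier (BijGroup (verts S))" using sub car by simp
    show "A \<noteq> {}" using A_one by blast
  next
    fix \<sigma> assume s: "\<sigma> \<in> A"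
    obtain \<tau> where t: "\<tau> \<in> A" "\<forall>v\<in>verts S. \<tau> (\<sigma> v) = v" using A_inv[OF s] by blast
    have "compose (verts S) \<tau> \<sigma> = (\<lambda>v\<in>verts S. v)" using t(2) by (auto simp: compose_def fun_eq_iff)
    then have "\<tau> \<otimes>\<^bsub>BijGroup (verts S)\<^esub> \<sigma> = \<one>\<^bsub>BijGroup (verts S)\<^esub>"
      using mult[OF t(1) s] by (simp add: BijGroup_def)
    then have "inv\<^bsub>BijGroup (verts S)\<^esub> \<sigma> = \<tau>"
      using B.inv_equality s t(1) sub car by blast
    then show "inv\<^bsub>BijGroup (verts S)\<^esub> \<sigma> \<in> A" using t(1) by simp
  next
    fix \<sigma> \<tau> assume "\<sigma> \<in> A" "\<tau> \<in> A"
    then show "\<sigma> \<otimes>\<^bsub>BijGroup (verts S)\<^esub> \<tau> \<in> A" using mult A_comp by simp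
  qed
qed

text \<open>Crossing ab exchanges the two candidate orbits. Crossing ac or bc is crossing ab
  followed by a rotation about a type 1 vertex, and rotations stay in an orbit; so the union of the
  two is closed under all crossings.\<close>

lemma moves_total:
  assumes "(a, b, c) \<in> S"
  shows "moves (x, y, c0) (a, b, c) \<or> moves (y, x, c1) (a, b, c)"
proof -
  let ?R = "{t. moves (x, y, c0) t \<or> moves (y, x, c1) t}"
  have flip: "(b, a, d) \<in> ?R" if "(a, b, c) \<in> S" "(a, b, c) \<in> ?R" "(b, a, d) \<in> S" for a b c d
    using that moves_nb0 base by blast
  have "S \<subseteq> ?R"
  proof (rule conn[OF base(1)])
    show "(x, y, c0) \<in> ?R" using moves_refl base by blast
  next
    fix a b c c' assume "(a, b, c) \<in> S" "(a, b, c) \<in> ?R" "(b, a, c') \<in> S"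
    then show "(b, a, c') \<in> ?R" using flip by blast
  next
    fix a b c b' assume t: "(a, b, c) \<in> S" "(a, b, c) \<in> ?R" "(b', a, c) \<in> S"
    obtain d where d: "(b, a, d) \<in> S" using nb0 t(1) by blast
    have "moves (b, a, d) (b', a, c)" using moves_star'[OF d t(3)] .
    then show "(b', a, c) \<in> ?R" using flip[OF t(1,2) d] moves_trans base by blast
  next
    fix a b c a' assume t: "(a, b, c) \<in> S" "(a, b, c) \<in> ?R" "(b, a', c) \<in> S"
    obtain d where d: "(b, a, d) \<in> S" using nb0 t(1) by blast
    have "moves (b, a, d) (b, a', c)" using moves_star[OF d t(3)] .
    then show "(b, a', c) \<in> ?R" using flip[OF t(1,2) d] moves_trans base by blast
  qed
  then show ?thesis using assms by blast
qed

text \<open>The action on triangles is free, so group elements correspond to the triangles in the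
  orbit of a fixed one, and a condition P on the images of its vertices becomes a condition on
  triangles. The orders of the group and of its stabilizers are all counted in this way.\<close>

lemma card_stab:
  assumes "(a, b, c) \<in> S"
  shows "card {\<sigma> \<in> A. P (\<sigma> a) (\<sigma> b) (\<sigma> c)} =
    card {t \<in> S. moves (a, b, c) t \<and> P (fst t) (fst (snd t)) (snd (snd t))}"
proof (rule bij_betw_same_card)
  show "bij_betw (\<lambda>\<sigma>. (\<sigma> a, \<sigma> b, \<sigma> c)) {\<sigma> \<in> A. P (\<sigma> a) (\<sigma> b) (\<sigma> c)}
      {t \<in> S. moves (a, b, c) t \<and> P (fst t) (fst (snd t)) (snd (snd t))}"
    unfolding bij_betw_def
  proof (intro conjI equalityI subsetI)
    show "inj_on (\<lambda>\<sigma>. (\<sigma> a, \<sigma> b, \<sigma> c)) {\<sigma> \<in> A. P (\<sigma> a) (\<sigma> b) (\<sigma> c)}"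
      by (rule inj_onI) (use A_eq assms in auto)
  next
    fix t assume "t \<in> (\<lambda>\<sigma>. (\<sigma> a, \<sigma> b, \<sigma> c)) ` {\<sigma> \<in> A. P (\<sigma> a) (\<sigma> b) (\<sigma> c)}"
    then obtain \<sigma> where s: "\<sigma> \<in> A" "P (\<sigma> a) (\<sigma> b) (\<sigma> c)" "t = (\<sigma> a, \<sigma> b, \<sigma> c)" by blast
    then show "t \<in> {t \<in> S. moves (a, b, c) t \<and> P (fst t) (fst (snd t)) (snd (snd t))}"
      using A_tri[OF s(1) assms] by (auto simp: moves_iff)
  next
    fix t assume t: "t \<in> {t \<in> S. moves (a, b, c) t \<and> P (fst t) (fst (snd t)) (snd (snd t))}"
    obtain a' b' c' where "t = (a', b', c')" by (cases t)
    then show "t \<in> (\<lambda>\<sigma>. (\<sigma> a, \<sigma> b, \<sigma> c)) ` {\<sigma> \<in> A. P (\<sigma> a) (\<sigma> b) (\<sigma> c)}"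
      using t by (auto simp: moves_iff)
  qed
qed

lemma card_stab_vertex:
  assumes "(a, b, c) \<in> S"
  shows "card {\<sigma> \<in> A. \<sigma> a = a} = valency S a"
proof -
  have "{t \<in> S. moves (a, b, c) t \<and> fst t = a} = {t \<in> S. fst t = a}"
    using moves_star[OF assms] by auto
  then show ?thesis
    using card_stab[OF assms, of "\<lambda>u v w. u = a"] valency_eq[OF assms] by simp
qed

lemma rotation_vertex:
  assumes "(a, b, c) \<in> S"
  obtains \<sigma> where "\<sigma> \<in> A" "\<sigma> a = a" "\<sigma> b \<noteq> b"
proof -
  obtain b' where b': "(b', a, c) \<in> S" using nb1 assms by blast
  then obtain d where d: "(a, b', d) \<in> S" using nb0 by blast
  have "b' \<noteq> b" using oriented[OF assms] b' by blast
  then show thesis using star_trans[OF assms d] that by metis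
qed

text \<open>One step round a centre may change the orbit, two steps do not: they are a rotation
  about a followed by one about the next vertex b'. Orientation ensures that two steps do not lead
  back to a.\<close>

lemma rotation_centre:
  assumes "(a, b, c) \<in> S"
  obtains \<sigma> where "\<sigma> \<in> A" "\<sigma> c = c" "\<sigma> a \<noteq> a"
proof -
  obtain b' where b': "(b', a, c) \<in> S" using nb1 assms by blast
  obtain b'' where b'': "(b'', b', c) \<in> S" using nb1 b' by blast
  obtain d d' where d: "(a, b', d) \<in> S" and d': "(b', b'', d') \<in> S" using nb0 b' b'' by metis
  have "moves (a, b, c) (a, b', d)" using moves_star assms d by blast
  moreover have "moves (a, b', d) (b'', b', c)" using moves_star'[OF d b''] .
  ultimately have "moves (a, b, c) (b'', b', c)" using moves_trans assms by blast
  moreover have "b'' \<noteq> a" using b'' b' oriented by blast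
  ultimately show thesis using that by (metis moves_iff)
qed

lemma vpush_vpt:
  assumes "v \<in> verts S" shows "vpush \<sigma> (vpt v) = vpt (\<sigma> v)"
  using assms
proof (cases rule: verts_cases)
  case (one b c)
  then show ?thesis using vpush_bary[OF one, of \<sigma> 1 0 0] by (simp flip: vpt_bary(1))
next
  case (two a b)
  then show ?thesis using vpush_bary[OF two, of \<sigma> 0 0 1] by (simp flip: vpt_bary(3))
qed

lemma vpt_realize:
  assumes "v \<in> verts S" shows "vpt v \<in> realize S"
  using assms
proof (cases rule: verts_cases)
  case (one b c)
  then show ?thesis using realizeI[OF one, of 1 0 0] by (simp flip: vpt_bary(1))
next
  case (two a b)
  then show ?thesis using realizeI[OF two, of 0 0 1] by (simp flip: vpt_bary(3))
qed

lemma no_free_vertex: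
  assumes "v \<in> verts S"
  shows "\<not> inj_on (\<lambda>\<sigma>. vpush \<sigma> (vpt v)) A"
proof -
  have *: "\<exists>\<sigma>\<in>A. \<sigma> v = v \<and> (\<exists>u\<in>verts S. \<sigma> u \<noteq> u)"
    using assms
  proof (cases rule: verts_cases)
    case (one b c)
    then show ?thesis using rotation_vertex in_verts by metis
  next
    case (two a b)
    then show ?thesis using rotation_centre in_verts by metis
  qed
  then obtain \<sigma> u where s: "\<sigma> \<in> A" "\<sigma> v = v" "u \<in> verts S" "\<sigma> u \<noteq> u" by blast
  then have "\<sigma> \<noteq> (\<lambda>v\<in>verts S. v)" by auto
  moreover have "vpush \<sigma> (vpt v) = vpush (\<lambda>v\<in>verts S. v) (vpt v)"
    using s(2) assms by (simp add: vpush_vpt)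
  ultimately show ?thesis
    using s(1) A_one unfolding inj_on_def by blast
qed

text \<open>Off the vertices at least two coordinates are positive. Automorphisms that agree on two
  vertices of a triangle, place by place, agree on it and hence everywhere; what remains is an
  exchange of a and b, and with positive weight at c this would reverse the orientation.\<close>

lemma collision:
  assumes t: "(a, b, c) \<in> S" and st: "\<sigma> \<in> A" "\<tau> \<in> A" "\<sigma> \<noteq> \<tau>"
    and p: "\<alpha> \<ge> 0" "\<beta> \<ge> 0" "\<gamma> \<ge> 0" "\<alpha> + \<beta> + \<gamma> = 1"
    and eq: "vpush \<sigma> (bary (a, b, c) \<alpha> \<beta> \<gamma>) = vpush \<tau> (bary (a, b, c) \<alpha> \<beta> \<gamma>)"
    and nv: "\<alpha> \<noteq> 1" "\<beta> \<noteq> 1" "\<gamma> \<noteq> 1"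
  shows "\<alpha> = 1/2 \<and> \<beta> = 1/2 \<and> \<gamma> = 0 \<and> \<sigma> a = \<tau> b \<and> \<sigma> b = \<tau> a"
proof -
  note ts = A_tri[OF st(1) t] and tt = A_tri[OF st(2) t]
  have ne: "\<not> (\<sigma> a = \<tau> a \<and> \<sigma> b = \<tau> b \<and> \<sigma> c = \<tau> c)" using A_eq[OF st(1,2) t] st(3) by blast
  have two: "\<not> (\<sigma> a = \<tau> a \<and> \<sigma> b = \<tau> b)" "\<not> (\<sigma> a = \<tau> a \<and> \<sigma> c = \<tau> c)"
    "\<not> (\<sigma> b = \<tau> b \<and> \<sigma> c = \<tau> c)"
    using ne ts tt uniq1 uniq2 uniq3 by metis+
  have c: "\<gamma> \<noteq> 0 \<longrightarrow> \<sigma> c = \<tau> c"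
    and ab: "(\<alpha> \<noteq> 0 \<longrightarrow> \<sigma> a = \<tau> a) \<and> (\<beta> \<noteq> 0 \<longrightarrow> \<sigma> b = \<tau> b) \<or> \<alpha> = \<beta> \<and> \<sigma> a = \<tau> b \<and> \<sigma> b = \<tau> a"
    using bary_eq_cases[OF ts tt _ p(1-3)] eq by (simp_all add: vpush_bary[OF t])
  show ?thesis
  proof (cases "\<alpha> = \<beta> \<and> \<sigma> a = \<tau> b \<and> \<sigma> b = \<tau> a")
    case True
    have "\<gamma> = 0"
    proof (rule ccontr)
      assume "\<gamma> \<noteq> 0"
      then have "(\<tau> b, \<tau> a, \<tau> c) \<in> S" using True c ts by simp
      then show False using oriented[OF tt] by blast
    qed
    then show ?thesis using True p(4) by simp
  next
    case False
    then have "\<alpha> = 0 \<or> \<beta> = 0" "\<alpha> = 0 \<or> \<gamma> = 0" "\<beta> = 0 \<or> \<gamma> = 0" using ab c two by blast+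
    then show ?thesis using p(4) nv by auto
  qed
qed

lemma orb_refl:
  assumes "v \<in> verts S" shows "v \<in> orb v"
proof -
  have "v = (\<lambda>v\<in>verts S. v) v" using assms by simp
  then show ?thesis unfolding orb_def using A_one by blast
qed

lemma orb_A: "\<sigma> \<in> A \<Longrightarrow> v \<in> verts S \<Longrightarrow> orb (\<sigma> v) = orb v"
proof -
  assume s: "\<sigma> \<in> A" and v: "v \<in> verts S"
  have sub: "orb (\<sigma> v) \<subseteq> orb v" if "\<sigma> \<in> A" "v \<in> verts S" for \<sigma> v
  proof
    fix w assume "w \<in> orb (\<sigma> v)"
    then obtain \<tau> where t: "\<tau> \<in> A" "w = \<tau> (\<sigma> v)" unfolding orb_def by blast
    then have "w = compose (verts S) \<tau> \<sigma> v" using that(2) by (simp add: compose_def)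
    then show "w \<in> orb v" using A_comp[OF t(1) that(1)] unfolding orb_def by blast
  qed
  obtain \<tau> where "\<tau> \<in> A" "\<forall>v\<in>verts S. \<tau> (\<sigma> v) = v" using A_inv s by blast
  then have "orb v \<subseteq> orb (\<sigma> v)" using sub[of \<tau> "\<sigma> v"] A_verts s v by simp
  then show ?thesis using sub[OF s v] by blast
qed

lemma orb_total:
  assumes "v \<in> fst ` S"
  shows "orb v = orb x \<or> orb v = orb y"
proof -
  obtain b c where t: "(v, b, c) \<in> S" using assms first_verts by blast
  have "x \<in> verts S" "y \<in> verts S" using in_verts base by blast+
  then show ?thesis using moves_total[OF t] orb_A unfolding moves_iff by metis
qed

text \<open>If a symmetry takes x to y, it takes the base triangle to one that starts at y, and a
  rotation about y moves this onto (y, x, c1). Thus type 1 vertices and triangles have equally many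
  orbits.\<close>

lemma same_orb_swap:
  assumes "orb x = orb y"
  shows "moves (x, y, c0) (y, x, c1)"
proof -
  have "y \<in> orb x" using assms orb_refl in_verts base by blast
  then obtain \<sigma> where s: "\<sigma> \<in> A" "\<sigma> x = y" unfolding orb_def by blast
  have "(y, \<sigma> y, \<sigma> c0) \<in> S" using A_tri[OF s(1) base(1)] s(2) by simp
  then have "moves (y, \<sigma> y, \<sigma> c0) (y, x, c1)" using moves_star base(2) by blast
  moreover have "moves (x, y, c0) (y, \<sigma> y, \<sigma> c0)" using s moves_iff by blast
  ultimately show ?thesis using moves_trans base(1) by blast
qed

lemma orbits_fst: "orb ` (fst ` S) = {orb x, orb y}"
  using orb_total base by force

lemma card_orbits_swap:
  "moves (x, y, c0) (y, x, c1) \<Longrightarrow> card (orb ` (fst ` S)) = 1"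
  "\<not> moves (x, y, c0) (y, x, c1) \<Longrightarrow> card (orb ` (fst ` S)) = 2"
proof -
  have v: "x \<in> verts S" "y \<in> verts S" using in_verts base by blast+
  show "card (orb ` (fst ` S)) = 1" if sw: "moves (x, y, c0) (y, x, c1)"
  proof -
    obtain \<sigma> where "\<sigma> \<in> A" "\<sigma> x = y" using sw moves_iff by metis
    then have "orb y = orb x" using orb_A v by blast
    then show ?thesis unfolding orbits_fst by simp
  qed
  show "card (orb ` (fst ` S)) = 2" if "\<not> moves (x, y, c0) (y, x, c1)"
  proof -
    have "orb x \<noteq> orb y" using same_orb_swap that by blast
    then show ?thesis unfolding orbits_fst by simp
  qed
qed

text \<open>Radial projection maps the bipyramid bijectively to the sphere, so it suffices to find
  three real functions that are continuous and invariant, separate orbits and fill the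
  bipyramid.\<close>

lemma finite_quotient_geo:
  assumes c: "continuous_map (geo S) euclideanreal U" "continuous_map (geo S) euclideanreal V"
      "continuous_map (geo S) euclideanreal H"
    and D: "\<And>p. p \<in> realize S \<Longrightarrow> bipyramid (U p) (V p) (H p)"
    and inv: "\<And>\<sigma> p. \<sigma> \<in> A \<Longrightarrow> p \<in> realize S \<Longrightarrow>
      U (vpush \<sigma> p) = U p \<and> V (vpush \<sigma> p) = V p \<and> H (vpush \<sigma> p) = H p"
    and sep: "\<And>p p'. p \<in> realize S \<Longrightarrow> p' \<in> realize S \<Longrightarrow>
      U p = U p' \<Longrightarrow> V p = V p' \<Longrightarrow> H p = H p' \<Longrightarrow> \<exists>\<sigma>\<in>A. vpush \<sigma> p = p'"
    and surj: "\<And>u v h. bipyramid u v h \<Longrightarrow> \<exists>p\<in>realize S. U p = u \<and> V p = v \<and> H p = h"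
    and Z: "finite Z" "Z \<subseteq> realize S"
      "\<And>p. p \<in> realize S \<Longrightarrow> inj_on (\<lambda>\<sigma>. vpush \<sigma> p) A \<longleftrightarrow> p \<notin> Z"
  shows "finite_quotient (geo S) (nsphere 2) (\<lambda>p. sphere_pt (U p) (V p) (H p)) A vpush Z"
proof
  let ?pr = "\<lambda>p. sphere_pt (U p) (V p) (H p)"
  show "continuous_map (geo S) (nsphere 2) ?pr" using continuous_map_sphere_pt[OF c] D by simp
  have "z \<in> ?pr ` realize S" if "z \<in> topspace (nsphere 2)" for z
    using that by (rule sphere_pt_surj) (use surj in blast)
  then show "?pr ` topspace (geo S) = topspace (nsphere 2)" using sphere_pt_in[OF D] by auto
  show "?pr p = ?pr p' \<longleftrightarrow> (\<exists>\<sigma>\<in>A. vpush \<sigma> p = p')"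
    if "p \<in> topspace (geo S)" "p' \<in> topspace (geo S)" for p p'
  proof
    assume "?pr p = ?pr p'"
    then have "U p = U p' \<and> V p = V p' \<and> H p = H p'" using sphere_pt_inj[OF D D] that by simp
    then show "\<exists>\<sigma>\<in>A. vpush \<sigma> p = p'" using sep that by simp
  next
    assume "\<exists>\<sigma>\<in>A. vpush \<sigma> p = p'"
    then obtain \<sigma> where "\<sigma> \<in> A" "p' = vpush \<sigma> p" by blast
    then show "?pr p = ?pr p'" using inv[of \<sigma> p] that by simp
  qed
  show "compact_space (geo S)" using compact_geo finS .
  show "continuous_map (geo S) (geo S) (vpush \<sigma>)" if "\<sigma> \<in> A" for \<sigma>
    using vpush_continuous A_auts that by blast
  show "\<exists>e\<in>A. \<forall>p\<in>topspace (geo S). vpush e p = p"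
  proof (intro bexI[OF _ A_one] ballI)
    fix p assume "p \<in> topspace (geo S)"
    then have "p \<in> realize S" by simp
    then show "vpush (\<lambda>v\<in>verts S. v) p = p"
      by (rule realizeE) (use in_verts in \<open>simp add: vpush_bary\<close>)
  qed
  show "\<exists>\<tau>\<in>A. \<forall>p\<in>topspace (geo S). vpush \<tau> (vpush \<sigma> p) = p" if s: "\<sigma> \<in> A" for \<sigma>
  proof -
    obtain \<tau> where t: "\<tau> \<in> A" "\<forall>v\<in>verts S. \<tau> (\<sigma> v) = v" using A_inv s by blast
    have "vpush \<tau> (vpush \<sigma> p) = p" if "p \<in> realize S" for p
      using that by (rule realizeE) (use in_verts t A_tri[OF s] in \<open>simp add: vpush_bary\<close>)
    then show ?thesis using t(1) by auto
  qed
  show "\<exists>\<rho>\<in>A. \<forall>p\<in>topspace (geo S). vpush \<rho> p = vpush \<sigma> (vpush \<tau> p)"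
    if st: "\<sigma> \<in> A" "\<tau> \<in> A" for \<sigma> \<tau>
  proof -
    have "vpush (compose (verts S) \<sigma> \<tau>) p = vpush \<sigma> (vpush \<tau> p)" if "p \<in> realize S" for p
      using that
      by (rule realizeE) (use in_verts A_tri[OF st(2)] in \<open>simp add: vpush_bary compose_def\<close>)
    then show ?thesis using A_comp[OF st] by auto
  qed
qed (use Z finite_A Hausdorff_geo Hausdorff_nsphere in auto)

lemma coords_ne_one:
  assumes "(a, b, c) \<in> S" "\<alpha> \<ge> 0" "\<beta> \<ge> 0" "\<gamma> \<ge> 0" "\<alpha> + \<beta> + \<gamma> = 1"
    and "bary (a, b, c) \<alpha> \<beta> \<gamma> \<notin> vpt ` verts S"
  shows "\<alpha> \<noteq> 1" "\<beta> \<noteq> 1" "\<gamma> \<noteq> 1"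
proof -
  have v: "vpt a \<in> vpt ` verts S" "vpt b \<in> vpt ` verts S" "vpt c \<in> vpt ` verts S"
    using in_verts[OF assms(1)] by auto
  show "\<alpha> \<noteq> 1"
  proof
    assume "\<alpha> = 1"
    then have "\<beta> = 0" "\<gamma> = 0" using assms(2-5) by auto
    then show False using v(1) assms(6) \<open>\<alpha> = 1\<close> by (simp add: vpt_bary(1)[of a b c])
  qed
  show "\<beta> \<noteq> 1"
  proof
    assume "\<beta> = 1"
    then have "\<alpha> = 0" "\<gamma> = 0" using assms(2-5) by auto
    then show False using v(2) assms(6) \<open>\<beta> = 1\<close> by (simp add: vpt_bary(2)[of b a c])
  qed
  show "\<gamma> \<noteq> 1"
  proof
    assume "\<gamma> = 1"
    then have "\<alpha> = 0" "\<beta> = 0" using assms(2-5) by auto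
    then show False using v(3) assms(6) \<open>\<gamma> = 1\<close> by (simp add: vpt_bary(3)[of c a b])
  qed
qed

lemma centre_mass:
  assumes "(a, b, c) \<in> S"
  shows "(\<Sum>v\<in>(snd \<circ> snd) ` S. bary (a, b, c) \<alpha> \<beta> \<gamma> v) = \<gamma>"
proof -
  have "a \<notin> (snd \<circ> snd) ` S" "b \<notin> (snd \<circ> snd) ` S" using assms by (auto dest: not_centre)
  moreover have "c \<in> (snd \<circ> snd) ` S" using assms by force
  ultimately show ?thesis
    using sum_bary[OF assms, of "\<lambda>x. x" "(snd \<circ> snd) ` S"] finS by simp
qed

section \<open>The quotient in the case of one orbit\<close>

lemma moves_all:
  assumes "moves (x, y, c0) (y, x, c1)" "(a, b, c) \<in> S" "(a', b', c') \<in> S"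
  shows "moves (a, b, c) (a', b', c')"
proof -
  have *: "moves (x, y, c0) (u, w, d)" if "(u, w, d) \<in> S" for u w d
    using moves_total[OF that] moves_trans[OF assms(1) _ base(1)] by blast
  show ?thesis
    by (rule moves_trans[OF moves_sym[OF *[OF assms(2)] base(1)] *[OF assms(3)] assms(2)])
qed

lemma one_orbit:
  assumes sw: "moves (x, y, c0) (y, x, c1)"
  shows "\<exists>pr. finite_quotient (geo S) (nsphere 2) pr A vpush (vpt ` verts S \<union> edge_midpoints S) \<and>
    (\<forall>v\<in>fst ` S. pr (vpt v) = pole1) \<and> (\<forall>m\<in>edge_midpoints S. pr m = pole2) \<and>
    (\<forall>v\<in>(snd \<circ> snd) ` S. pr (vpt v) = pole3)"
proof -
  \<comment> \<open>On each triangle, U, V, W are the barycentric coordinates with respect to the half triangle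
    spanned by a type 1 vertex, the midpoint of the edge and the centre, and the sign of H is that
    of \<open>\<alpha> - \<beta>\<close>. They are written as global expressions to make continuity evident.\<close>
  define W where "W = (\<lambda>p :: 'v \<Rightarrow> real. \<Sum>v\<in>(snd \<circ> snd) ` S. p v)"
  \<comment> \<open>The value \<bar>\<alpha> - \<beta>\<bar> has to be written symmetrically in a
    and b: (\<alpha> - \<beta>)^2 = 2 (\<alpha>^2 + \<beta>^2) - (\<alpha> + \<beta>)^2, and
    \<alpha> + \<beta> = 1 - W.\<close>
  define U where "U = (\<lambda>p :: 'v \<Rightarrow> real. sqrt (2 * (\<Sum>v\<in>fst ` S. (p v)\<^sup>2) - (1 - W p)\<^sup>2))"
  define m where "m = (\<lambda>\<alpha> \<beta> \<gamma> :: real. min (2 * min \<alpha> \<beta>) \<gamma>)"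
  \<comment> \<open>The difference \<alpha> - \<beta> clipped to [-m, m], where m is the smaller of
    the other two coordinates V = 2 min(\<alpha>, \<beta>) and W = \<gamma>. Its absolute value is
    then the minimum required by \<open>bipyramid\<close>.\<close>
  define f where "f = (\<lambda>\<alpha> \<beta> \<gamma> :: real. max (- m \<alpha> \<beta> \<gamma>) (min (m \<alpha> \<beta> \<gamma>) (\<alpha> - \<beta>)))"
  \<comment> \<open>Absolute values make the expression vanish with any one argument for arbitrary
    reals, as \<open>sum_tri_bary\<close> demands.\<close>
  let ?f' = "\<lambda>\<alpha> \<beta> \<gamma>. f (abs \<alpha>) (abs \<beta>) (abs \<gamma>)"
  define H where "H = (\<lambda>p :: 'v \<Rightarrow> real. \<Sum>s\<in>S. ?f' (p (fst s)) (p (fst (snd s))) (p (snd (snd s))))"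
  define V where "V = (\<lambda>p. 1 - U p - W p)"
  let ?pr = "\<lambda>p. sphere_pt (U p) (V p) (H p)"
  have val: "U p = \<bar>\<alpha> - \<beta>\<bar>" "W p = \<gamma>" "H p = f \<alpha> \<beta> \<gamma>"
    if t: "(a, b, c) \<in> S" and p: "p = bary (a, b, c) \<alpha> \<beta> \<gamma>"
      and ps: "\<alpha> \<ge> 0" "\<beta> \<ge> 0" "\<gamma> \<ge> 0" "\<alpha> + \<beta> + \<gamma> = 1" for a b c \<alpha> \<beta> \<gamma> p
  proof -
    show w: "W p = \<gamma>" unfolding W_def p by (rule centre_mass[OF t])
    have "a \<in> fst ` S" "b \<in> fst ` S" "c \<notin> fst ` S"
      using t nb0[OF t] not_centre[OF t] unfolding first_verts by blast+
    then have "(\<Sum>v\<in>fst ` S. (p v)\<^sup>2) = \<alpha>\<^sup>2 + \<beta>\<^sup>2"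
      unfolding p using sum_bary[OF t, of "\<lambda>x. x\<^sup>2" "fst ` S"] finS by simp
    moreover have "1 - \<gamma> = \<alpha> + \<beta>" using ps by simp
    ultimately have "2 * (\<Sum>v\<in>fst ` S. (p v)\<^sup>2) - (1 - W p)\<^sup>2 = 2 * (\<alpha>\<^sup>2 + \<beta>\<^sup>2) - (\<alpha> + \<beta>)\<^sup>2"
      unfolding w by simp
    also have "\<dots> = (\<alpha> - \<beta>)\<^sup>2" by (simp add: power2_eq_square algebra_simps)
    finally show "U p = \<bar>\<alpha> - \<beta>\<bar>" unfolding U_def by simp
    have f0: "?f' x y z = 0" if "x = 0 \<or> y = 0 \<or> z = 0" for x y z
    proof -
      have "m (abs x) (abs y) (abs z) = 0" using that unfolding m_def by (auto simp: min_def)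
      then show ?thesis by (simp add: f_def min_def)
    qed
    have "H p = ?f' \<alpha> \<beta> \<gamma>"
      unfolding H_def p by (rule sum_tri_bary[OF t, of "\<lambda>_. ?f'"]) (rule f0)
    then show "H p = f \<alpha> \<beta> \<gamma>" using ps by simp
  qed
  have absf: "\<bar>f \<alpha> \<beta> \<gamma>\<bar> = min \<bar>\<alpha> - \<beta>\<bar> (m \<alpha> \<beta> \<gamma>)" if "\<alpha> \<ge> 0" "\<beta> \<ge> 0" "\<gamma> \<ge> 0" for \<alpha> \<beta> \<gamma>
    using that unfolding f_def m_def by (auto simp: min_def max_def abs_if)
  have anti: "f \<beta> \<alpha> \<gamma> = - f \<alpha> \<beta> \<gamma>" if "\<alpha> \<ge> 0" "\<beta> \<ge> 0" "\<gamma> \<ge> 0" for \<alpha> \<beta> \<gamma>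
  proof -
    have "m \<beta> \<alpha> \<gamma> = m \<alpha> \<beta> \<gamma>" "m \<alpha> \<beta> \<gamma> \<ge> 0"
      using that unfolding m_def by (simp_all add: min.commute)
    then show ?thesis unfolding f_def by (auto simp: min_def max_def)
  qed
  have tw: "\<alpha> + \<beta> - \<bar>\<alpha> - \<beta>\<bar> = 2 * min \<alpha> \<beta>" for \<alpha> \<beta> :: real by (simp add: min_def abs_if)
  have D: "bipyramid (U p) (V p) (H p)" if p: "p \<in> realize S" for p
  proof (rule realizeE[OF p])
    fix a b c \<alpha> \<beta> \<gamma> assume t: "(a, b, c) \<in> S" "p = bary (a, b, c) \<alpha> \<beta> \<gamma>"
      and ps: "\<alpha> \<ge> 0" "\<beta> \<ge> 0" "\<gamma> \<ge> 0" "\<alpha> + \<beta> + \<gamma> = 1"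
    have v: "1 - \<bar>\<alpha> - \<beta>\<bar> - \<gamma> = 2 * min \<alpha> \<beta>" using tw[of \<alpha> \<beta>] ps by simp
    have w: "1 - \<bar>\<alpha> - \<beta>\<bar> - 2 * min \<alpha> \<beta> = \<gamma>" using tw[of \<alpha> \<beta>] ps by simp
    have "min \<alpha> \<beta> \<ge> 0" "\<bar>\<alpha> - \<beta>\<bar> + 2 * min \<alpha> \<beta> \<le> 1" using ps w by auto
    then show ?thesis
      unfolding V_def val[OF t ps] bipyramid_def absf[OF ps(1-3)] v w m_def by simp
  qed
  have inv: "U (vpush \<sigma> p) = U p \<and> V (vpush \<sigma> p) = V p \<and> H (vpush \<sigma> p) = H p" if s: "\<sigma> \<in> A" and p: "p \<in> realize S" for \<sigma> p
  proof (rule realizeE[OF p])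
    fix a b c \<alpha> \<beta> \<gamma> assume t: "(a, b, c) \<in> S" "p = bary (a, b, c) \<alpha> \<beta> \<gamma>"
      and ps: "\<alpha> \<ge> 0" "\<beta> \<ge> 0" "\<gamma> \<ge> 0" "\<alpha> + \<beta> + \<gamma> = 1"
    have vp: "vpush \<sigma> p = bary (\<sigma> a, \<sigma> b, \<sigma> c) \<alpha> \<beta> \<gamma>" using vpush_bary[OF t(1)] t(2) by simp
    show ?thesis
      unfolding V_def val[OF t ps] val[OF A_tri[OF s t(1)] vp ps] by simp
  qed
  have sep: "\<exists>\<sigma>\<in>A. vpush \<sigma> p = p'"
    if p: "p \<in> realize S" and p': "p' \<in> realize S"
      and eq: "U p = U p'" "V p = V p'" "H p = H p'" for p p'
  proof (rule realizeE[OF p], rule realizeE[OF p'])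
    fix a b c \<alpha> \<beta> \<gamma> a' b' c' \<alpha>' \<beta>' \<gamma>'
    assume t: "(a, b, c) \<in> S" "p = bary (a, b, c) \<alpha> \<beta> \<gamma>"
      and ps: "\<alpha> \<ge> 0" "\<beta> \<ge> 0" "\<gamma> \<ge> 0" "\<alpha> + \<beta> + \<gamma> = 1"
      and t': "(a', b', c') \<in> S" "p' = bary (a', b', c') \<alpha>' \<beta>' \<gamma>'"
      and ps': "\<alpha>' \<ge> 0" "\<beta>' \<ge> 0" "\<gamma>' \<ge> 0" "\<alpha>' + \<beta>' + \<gamma>' = 1"
    have push: "\<exists>\<sigma>\<in>A. vpush \<sigma> p = p'"
      if "(a1, b1, c1) \<in> S" "p = bary (a1, b1, c1) \<alpha>' \<beta>' \<gamma>'" for a1 b1 c1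
      using moves_all[OF sw that(1) t'(1)] that t'(2) vpush_bary[OF that(1)]
      unfolding moves_iff by metis
    have e: "\<bar>\<alpha> - \<beta>\<bar> = \<bar>\<alpha>' - \<beta>'\<bar>" "\<gamma> = \<gamma>'" "f \<alpha> \<beta> \<gamma> = f \<alpha>' \<beta>' \<gamma>'"
      using eq unfolding V_def val[OF t ps] val[OF t' ps'] by auto
    show ?thesis
    \<comment> \<open>Equal U and W determine \<alpha> and \<beta> up to exchange. If they are
      different and exchanged, antisymmetry makes the height zero, so the point lies on the boundary
      and the neighbouring triangle accounts for the exchange.\<close>
    proof (cases "\<alpha> = \<alpha>'")
      case True
      then have "\<beta> = \<beta>'" using e ps ps' by simp
      then show ?thesis using push t True e by simp
    next
      case False
      then have e': "\<alpha>' = \<beta>" "\<beta>' = \<alpha>" "\<alpha> \<noteq> \<beta>" using e ps ps' by (auto simp: abs_if split: if_splits)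
      then have "f \<alpha> \<beta> \<gamma> = 0" using e anti[OF ps(1-3)] by simp
      then have "\<alpha> = 0 \<or> \<beta> = 0 \<or> \<gamma> = 0"
        using absf[OF ps(1-3)] e'(3) unfolding m_def by (auto simp: min_def split: if_splits)
      then obtain a1 b1 c1 where "(a1, b1, c1) \<in> S" "a1 = b \<or> b1 = a"
          "bary (a, b, c) \<alpha> \<beta> \<gamma> = bary (a1, b1, c1) \<beta> \<alpha> \<gamma>"
        by (rule bary_flip[OF t(1)])
      then show ?thesis using push e' e(2) t(2) by simp
    qed
  qed
  have surj: "\<exists>p\<in>realize S. U p = u \<and> V p = v \<and> H p = h" if d: "bipyramid u v h" for u v h
  proof -
    \<comment> \<open>Solves u = \<bar>\<alpha> - \<beta>\<bar> and v = 2 min(\<alpha>, \<beta>);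
      the sign of h decides which coordinate is the larger one.\<close>
    define \<alpha> where "\<alpha> = (if h \<ge> 0 then u + v/2 else v/2)"
    define \<beta> where "\<beta> = (if h \<ge> 0 then v/2 else u + v/2)"
    have ps: "\<alpha> \<ge> 0" "\<beta> \<ge> 0" "1 - u - v \<ge> 0" "\<alpha> + \<beta> + (1 - u - v) = 1"
      using d unfolding \<alpha>_def \<beta>_def bipyramid_def by auto
    have M: "m \<alpha> \<beta> (1 - u - v) = min v (1 - u - v)" and ab: "\<bar>\<alpha> - \<beta>\<bar> = u"
      and df: "\<alpha> - \<beta> = (if h \<ge> 0 then u else - u)"
      using d unfolding \<alpha>_def \<beta>_def m_def bipyramid_def by (auto simp: min_def)
    have "f \<alpha> \<beta> (1 - u - v) = h"
    proof (cases "h \<ge> 0")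
      case True
      then have "h = min u (min v (1 - u - v))" using d by (simp add: bipyramid_def)
      then show ?thesis unfolding f_def M df using True ps d by (simp add: bipyramid_def min_def max_def)
    next
      case False
      then have "h = - min u (min v (1 - u - v))" using d by (simp add: bipyramid_def)
      then show ?thesis unfolding f_def M df using False ps d by (simp add: bipyramid_def min_def max_def)
    qed
    then show ?thesis
      using val[OF base(1) refl ps] ab realizeI[OF base(1) ps] unfolding V_def
      by (intro bexI[of _ "bary (x, y, c0) \<alpha> \<beta> (1 - u - v)"]) auto
  qed
  let ?Z = "vpt ` verts S \<union> edge_midpoints S"
  have mid: "midpt a b \<in> realize S" if "(a, b, c) \<in> S" for a b c
    using realizeI[OF that, of "1/2" "1/2" 0] by (simp flip: midpt_bary)
  have fq: "finite_quotient (geo S) (nsphere 2) ?pr A vpush ?Z"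
  proof (rule finite_quotient_geo[OF _ _ _ D inv sep surj])
    note coord = continuous_map_geo_coord[of S]
    have W: "continuous_map (geo S) euclideanreal W"
      unfolding W_def using finS by (intro continuous_map_sum coord) auto
    show U: "continuous_map (geo S) euclideanreal U"
      unfolding U_def using finS
      by (intro continuous_map_sqrt continuous_map_diff continuous_map_real_mult_left
          continuous_map_real_pow continuous_map_sum coord W continuous_map_canonical_const) auto
    show "continuous_map (geo S) euclideanreal V"
      unfolding V_def by (intro continuous_map_diff U W continuous_map_canonical_const)
    show "continuous_map (geo S) euclideanreal H"
      unfolding H_def f_def m_def using finS
      by (intro continuous_map_sum continuous_map_real_max continuous_map_real_min
          continuous_map_minus continuous_map_diff continuous_map_real_mult_left
          continuous_map_real_abs coord) auto
    have "edge_midpoints S = (\<lambda>t. midpt (fst t) (fst (snd t))) ` S"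
      unfolding edge_midpoints_def by blast
    then show "finite ?Z" using finite_verts finS by simp
    show "?Z \<subseteq> realize S" using vpt_realize mid by (auto simp: edge_midpoints_iff)
    show "inj_on (\<lambda>\<sigma>. vpush \<sigma> p) A \<longleftrightarrow> p \<notin> ?Z" if p: "p \<in> realize S" for p
    proof
      assume inj: "inj_on (\<lambda>\<sigma>. vpush \<sigma> p) A"
      have "p \<notin> edge_midpoints S"
      proof
        assume "p \<in> edge_midpoints S"
        then obtain a b c where t: "(a, b, c) \<in> S" "p = midpt a b" using edge_midpoints_iff by blast
        obtain d where d: "(b, a, d) \<in> S" using nb0 t by blast
        \<comment> \<open>With a single orbit the neighbour across the edge is an image of the
          triangle itself, so some symmetry reverses the edge and fixes its midpoint.\<close>
        obtain \<sigma> where s: "\<sigma> \<in> A" "\<sigma> a = b" "\<sigma> b = a"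
          using moves_all[OF sw t(1) d] unfolding moves_iff by blast
        have "vpush \<sigma> p = p"
          using vpush_bary[OF t(1), of \<sigma> "1/2" "1/2" 0] s t(2)
          by (simp flip: midpt_bary) (simp add: midpt_def add.commute)
        moreover have "vpush (\<lambda>v\<in>verts S. v) p = p"
          using vpush_bary[OF t(1), of "\<lambda>v\<in>verts S. v" "1/2" "1/2" 0] t(2) in_verts[OF t(1)]
          by (simp flip: midpt_bary)
        ultimately have "\<sigma> = (\<lambda>v\<in>verts S. v)" using inj_onD[OF inj _ s(1) A_one] by simp
        then have "\<sigma> a = a" using in_verts[OF t(1)] by simp
        then show False using s edge_distinct[OF t(1)] by simp
      qed
      then show "p \<notin> ?Z" using no_free_vertex inj by blast
    next
      assume nz: "p \<notin> ?Z"
      show "inj_on (\<lambda>\<sigma>. vpush \<sigma> p) A"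
      proof (rule inj_onI, rule ccontr, rule realizeE[OF p])
        fix \<sigma> \<tau> a b c \<alpha> \<beta> \<gamma> assume st: "\<sigma> \<in> A" "\<tau> \<in> A" "vpush \<sigma> p = vpush \<tau> p" "\<sigma> \<noteq> \<tau>"
          and t: "(a, b, c) \<in> S" "p = bary (a, b, c) \<alpha> \<beta> \<gamma>"
          and ps: "\<alpha> \<ge> 0" "\<beta> \<ge> 0" "\<gamma> \<ge> 0" "\<alpha> + \<beta> + \<gamma> = 1"
        have "\<alpha> \<noteq> 1" "\<beta> \<noteq> 1" "\<gamma> \<noteq> 1" using coords_ne_one[OF t(1) ps] nz t(2) by auto
        then have mid: "\<alpha> = 1/2" "\<beta> = 1/2" "\<gamma> = 0"
          using collision[OF t(1) st(1,2,4) ps] st(3) t(2) by simp_all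
        have "p = midpt a b" unfolding t(2) midpt_bary[of a b c] mid ..
        then show False using nz t(1) edge_midpoints_iff by blast
      qed
    qed
  qed
  have "?pr (vpt v) = pole1" if v: "v \<in> fst ` S" for v
  proof -
    obtain b c where t: "(v, b, c) \<in> S" using v first_verts by blast
    show ?thesis
      using val[OF t vpt_bary(1)[of v b c]] unfolding V_def pole1_def by (simp add: f_def m_def)
  qed
  moreover have "?pr (vpt v) = pole3" if v: "v \<in> (snd \<circ> snd) ` S" for v
  proof -
    obtain a b where t: "(a, b, v) \<in> S" using v by force
    show ?thesis
      using val[OF t vpt_bary(3)[of v a b]] unfolding V_def pole3_def by (simp add: f_def m_def)
  qed
  moreover have "?pr m = pole2" if m: "m \<in> edge_midpoints S" for m
  proof -
    obtain a b c where t: "(a, b, c) \<in> S" "m = midpt a b" using m edge_midpoints_iff by blast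
    show ?thesis
      using val[OF t(1) t(2)[unfolded midpt_bary[of a b c]]]
      unfolding V_def pole2_def by (simp add: f_def m_def)
  qed
  ultimately show ?thesis using fq by blast
qed

section \<open>Colouring by vertex orbits and the quotient in the case of two orbits\<close>

lemma in_orb_iff:
  assumes "v \<in> verts S" "w \<in> verts S"
  shows "w \<in> orb v \<longleftrightarrow> orb w = orb v"
proof
  assume "w \<in> orb v"
  then obtain \<sigma> where "\<sigma> \<in> A" "w = \<sigma> v" unfolding orb_def by blast
  then show "orb w = orb v" using orb_A assms(1) by simp
qed (use orb_refl assms(2) in blast)

text \<open>Every triangle is an image of (x, y, c0) or (y, x, c1), so the two orbits colour the
  type 1 vertices and an edge joins different colours.\<close>

lemma orb_colour:
  assumes "orb x \<noteq> orb y" "(a, b, c) \<in> S"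
  shows "a \<in> orb x \<longleftrightarrow> b \<notin> orb x"
proof -
  have v: "x \<in> verts S" "y \<in> verts S" using in_verts base by blast+
  have "orb a = orb x \<and> orb b = orb y \<or> orb a = orb y \<and> orb b = orb x"
    using moves_total[OF assms(2)] unfolding moves_iff by (auto simp: orb_A v)
  then show ?thesis
    using in_orb_iff[OF v(1), of a] in_orb_iff[OF v(1), of b] in_verts[OF assms(2)] assms(1) by auto
qed

lemma orb_closed: "\<sigma> \<in> A \<Longrightarrow> v \<in> verts S \<Longrightarrow> \<sigma> v \<in> orb x \<longleftrightarrow> v \<in> orb x"
proof -
  assume s: "\<sigma> \<in> A" and v: "v \<in> verts S"
  have x: "x \<in> verts S" using in_verts base by blast
  show ?thesis
    using in_orb_iff[OF x v] in_orb_iff[OF x A_verts[OF s v]] orb_A[OF s v] by simp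
qed

text \<open>The two base triangles begin with different colours, and symmetries preserve
  colour.\<close>

lemma moves_colour:
  assumes "orb x \<noteq> orb y" "(a, b, c) \<in> S" "(a', b', c') \<in> S"
  shows "moves (a, b, c) (a', b', c') \<longleftrightarrow> (a \<in> orb x \<longleftrightarrow> a' \<in> orb x)"
proof
  assume "moves (a, b, c) (a', b', c')"
  then show "a \<in> orb x \<longleftrightarrow> a' \<in> orb x"
    using orb_closed in_verts[OF assms(2)] unfolding moves_iff by metis
next
  assume e: "a \<in> orb x \<longleftrightarrow> a' \<in> orb x"
  have v: "x \<in> verts S" "y \<in> verts S" using in_verts base by blast+
  have xy: "x \<in> orb x" "y \<notin> orb x" using orb_refl[OF v(1)] orb_colour[OF assms(1) base(1)] by auto
  have c: "moves (x, y, c0) (u, w, d) \<and> u \<in> orb x \<or> moves (y, x, c1) (u, w, d) \<and> u \<notin> orb x"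
    if "(u, w, d) \<in> S" for u w d
    using moves_total[OF that] orb_closed[OF _ v(1)] orb_closed[OF _ v(2)] xy unfolding moves_iff by blast
  show "moves (a, b, c) (a', b', c')"
    using c[OF assms(2)] c[OF assms(3)] e moves_sym moves_trans base assms(2) by metis
qed

lemma orb_not_centre: "(a, b, c) \<in> S \<Longrightarrow> c \<notin> orb x"
proof
  assume t: "(a, b, c) \<in> S" and "c \<in> orb x"
  then obtain \<sigma> where "\<sigma> \<in> A" "c = \<sigma> x" unfolding orb_def by blast
  then show False using A_tri[OF _ base(1), of \<sigma>] not_centre[OF t] by metis
qed

text \<open>No symmetry exchanges the ends of an edge, so the barycentric coordinates themselves are
  invariant once sorted by colour: U is the weight on the orbit of x, V that on the orbit of y, W
  that at the centre. The sign of the height tells the two orbits of triangles apart.\<close>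

lemma two_orbits:
  assumes ne: "orb x \<noteq> orb y"
  shows "\<exists>pr. finite_quotient (geo S) (nsphere 2) pr A vpush (vpt ` verts S) \<and>
    (\<forall>v\<in>fst ` S. pr (vpt v) = (if v \<in> orb x then pole1 else pole2)) \<and>
    (\<forall>v\<in>(snd \<circ> snd) ` S. pr (vpt v) = pole3)"
proof -
  have finorb: "finite (orb x)" using finite_A unfolding orb_def by simp
  define W where "W = (\<lambda>p :: 'v \<Rightarrow> real. \<Sum>v\<in>(snd \<circ> snd) ` S. p v)"
  define U where "U = (\<lambda>p :: 'v \<Rightarrow> real. \<Sum>v\<in>orb x. p v)"
  define f where "f = (\<lambda>\<alpha> \<beta> \<gamma> :: real. min \<bar>\<alpha>\<bar> (min \<bar>\<beta>\<bar> \<bar>\<gamma>\<bar>))"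
  define g where "g = (\<lambda>s :: 'v tri. \<lambda>\<alpha> \<beta> \<gamma>. (if fst s \<in> orb x then 1 else -1) * f \<alpha> \<beta> \<gamma>)"
  define H where "H = (\<lambda>p :: 'v \<Rightarrow> real. \<Sum>s\<in>S. g s (p (fst s)) (p (fst (snd s))) (p (snd (snd s))))"
  define V where "V = (\<lambda>p. 1 - U p - W p)"
  let ?pr = "\<lambda>p. sphere_pt (U p) (V p) (H p)"
  have val: "U p = (if a \<in> orb x then \<alpha> else \<beta>)" "W p = \<gamma>"
      "H p = (if a \<in> orb x then 1 else -1) * min \<alpha> (min \<beta> \<gamma>)"
    if t: "(a, b, c) \<in> S" and p: "p = bary (a, b, c) \<alpha> \<beta> \<gamma>"
      and ps: "\<alpha> \<ge> 0" "\<beta> \<ge> 0" "\<gamma> \<ge> 0" "\<alpha> + \<beta> + \<gamma> = 1" for a b c \<alpha> \<beta> \<gamma> p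
  proof -
    show w: "W p = \<gamma>" unfolding W_def p by (rule centre_mass[OF t])
    show "U p = (if a \<in> orb x then \<alpha> else \<beta>)"
      unfolding U_def p
      using sum_bary[OF t, of "\<lambda>x. x" "orb x"] finorb orb_not_centre[OF t] orb_colour[OF ne t] by simp
    have g0: "g s x y z = 0" if "x = 0 \<or> y = 0 \<or> z = 0" for s x y z
      using that unfolding g_def f_def by auto
    have "H p = g (a, b, c) \<alpha> \<beta> \<gamma>"
      unfolding H_def p by (rule sum_tri_bary[OF t]) (rule g0)
    then show "H p = (if a \<in> orb x then 1 else -1) * min \<alpha> (min \<beta> \<gamma>)"
      using ps unfolding g_def f_def by simp
  qed
  have D: "bipyramid (U p) (V p) (H p)" if p: "p \<in> realize S" for p
  proof (rule realizeE[OF p])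
    fix a b c \<alpha> \<beta> \<gamma> assume t: "(a, b, c) \<in> S" "p = bary (a, b, c) \<alpha> \<beta> \<gamma>"
      and ps: "\<alpha> \<ge> 0" "\<beta> \<ge> 0" "\<gamma> \<ge> 0" "\<alpha> + \<beta> + \<gamma> = 1"
    have g: "\<gamma> = 1 - \<alpha> - \<beta>" using ps by simp
    show ?thesis
      unfolding V_def val[OF t ps] bipyramid_def using ps unfolding g by (auto simp: abs_if min_def)
  qed
  have inv: "U (vpush \<sigma> p) = U p \<and> V (vpush \<sigma> p) = V p \<and> H (vpush \<sigma> p) = H p" if s: "\<sigma> \<in> A" and p: "p \<in> realize S" for \<sigma> p
  proof (rule realizeE[OF p])
    fix a b c \<alpha> \<beta> \<gamma> assume t: "(a, b, c) \<in> S" "p = bary (a, b, c) \<alpha> \<beta> \<gamma>"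
      and ps: "\<alpha> \<ge> 0" "\<beta> \<ge> 0" "\<gamma> \<ge> 0" "\<alpha> + \<beta> + \<gamma> = 1"
    have vp: "vpush \<sigma> p = bary (\<sigma> a, \<sigma> b, \<sigma> c) \<alpha> \<beta> \<gamma>" using vpush_bary[OF t(1)] t(2) by simp
    have "\<sigma> a \<in> orb x \<longleftrightarrow> a \<in> orb x" using orb_closed[OF s] in_verts[OF t(1)] by blast
    then show ?thesis
      unfolding V_def val[OF t ps] val[OF A_tri[OF s t(1)] vp ps] by simp
  qed
  have sep: "\<exists>\<sigma>\<in>A. vpush \<sigma> p = p'"
    if p: "p \<in> realize S" and p': "p' \<in> realize S"
      and eq: "U p = U p'" "V p = V p'" "H p = H p'" for p p'
  proof (rule realizeE[OF p], rule realizeE[OF p'])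
    fix a b c \<alpha> \<beta> \<gamma> a' b' c' \<alpha>' \<beta>' \<gamma>'
    assume t: "(a, b, c) \<in> S" "p = bary (a, b, c) \<alpha> \<beta> \<gamma>"
      and ps: "\<alpha> \<ge> 0" "\<beta> \<ge> 0" "\<gamma> \<ge> 0" "\<alpha> + \<beta> + \<gamma> = 1"
      and t': "(a', b', c') \<in> S" "p' = bary (a', b', c') \<alpha>' \<beta>' \<gamma>'"
      and ps': "\<alpha>' \<ge> 0" "\<beta>' \<ge> 0" "\<gamma>' \<ge> 0" "\<alpha>' + \<beta>' + \<gamma>' = 1"
    have push: "\<exists>\<sigma>\<in>A. vpush \<sigma> p = p'"
      if "(a1, b1, c1) \<in> S" "p = bary (a1, b1, c1) \<alpha>' \<beta>' \<gamma>'" "a1 \<in> orb x \<longleftrightarrow> a' \<in> orb x"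
      for a1 b1 c1
      using moves_colour[OF ne that(1) t'(1)] that t'(2) vpush_bary[OF that(1)]
      unfolding moves_iff by metis
    have e: "U p = U p'" "\<gamma> = \<gamma>'" "H p = H p'"
      using eq val(2)[OF t ps] val(2)[OF t' ps'] unfolding V_def by auto
    have u: "(if a \<in> orb x then \<alpha> else \<beta>) = (if a' \<in> orb x then \<alpha>' else \<beta>')"
      using e(1) val(1)[OF t ps] val(1)[OF t' ps'] by simp
    show ?thesis
    proof (cases "a \<in> orb x \<longleftrightarrow> a' \<in> orb x")
      case True
      have "\<alpha> = \<alpha>'" "\<beta> = \<beta>'"
        using u True e(2) ps(4) ps'(4) by (cases "a \<in> orb x"; simp)+
      then show ?thesis using push t True e by simp
    next
      \<comment> \<open>The two triangles have opposite signs, so equal heights vanish and the point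
        is on the boundary. There a neighbouring triangle of the other colour represents the same
        point.\<close>
      case False
      have e': "\<alpha>' = \<beta>" "\<beta>' = \<alpha>"
        using u False e(2) ps(4) ps'(4) by (cases "a \<in> orb x"; simp)+
      have "(if a \<in> orb x then 1 else -1) * min \<alpha> (min \<beta> \<gamma>) =
          (if a' \<in> orb x then 1 else -1) * min \<beta> (min \<alpha> \<gamma>)"
        using e(3) val(3)[OF t ps] val(3)[OF t' ps'] e' e(2) by simp
      then have "min \<alpha> (min \<beta> \<gamma>) = - min \<beta> (min \<alpha> \<gamma>)"
        using False by (cases "a \<in> orb x") simp_all
      moreover have "min \<alpha> (min \<beta> \<gamma>) \<ge> 0" "min \<beta> (min \<alpha> \<gamma>) \<ge> 0" using ps by simp_all
      ultimately have "min \<alpha> (min \<beta> \<gamma>) = 0" by linarith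
      then have "\<alpha> = 0 \<or> \<beta> = 0 \<or> \<gamma> = 0" by (simp add: min_def split: if_splits)
      then obtain a1 b1 c1 where 1: "(a1, b1, c1) \<in> S" "a1 = b \<or> b1 = a"
          "bary (a, b, c) \<alpha> \<beta> \<gamma> = bary (a1, b1, c1) \<beta> \<alpha> \<gamma>"
        by (rule bary_flip[OF t(1)])
      have "a1 \<in> orb x \<longleftrightarrow> a' \<in> orb x"
        using 1(2) orb_colour[OF ne t(1)] orb_colour[OF ne 1(1)] False by blast
      then show ?thesis using push 1 e' e(2) t(2) by simp
    qed
  qed
  have v: "x \<in> verts S" "y \<in> verts S" using in_verts base by blast+
  have xy: "x \<in> orb x" "y \<notin> orb x" using orb_refl[OF v(1)] orb_colour[OF ne base(1)] by auto
  have surj: "\<exists>p\<in>realize S. U p = u \<and> V p = v \<and> H p = h" if d: "bipyramid u v h" for u v h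
  proof -
    have ps: "u \<ge> 0" "v \<ge> 0" "1 - u - v \<ge> 0" "u + v + (1 - u - v) = 1" "v + u + (1 - u - v) = 1"
      using d unfolding bipyramid_def by auto
    show ?thesis
    proof (cases "h \<ge> 0")
      case True
      then show ?thesis
        using d xy val[OF base(1) refl ps(1-4)] realizeI[OF base(1) ps(1-4)] unfolding V_def
        by (intro bexI[of _ "bary (x, y, c0) u v (1 - u - v)"]) (auto simp: bipyramid_def)
    next
      case False
      then have "h = - min v (min u (1 - u - v))" using d by (simp add: bipyramid_def min.left_commute)
      then show ?thesis
        using xy val[OF base(2) refl ps(2,1,3,5)] realizeI[OF base(2) ps(2,1,3,5)] unfolding V_def
        by (intro bexI[of _ "bary (y, x, c1) v u (1 - u - v)"]) auto
    qed
  qed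
  have fq: "finite_quotient (geo S) (nsphere 2) ?pr A vpush (vpt ` verts S)"
  proof (rule finite_quotient_geo[OF _ _ _ D inv sep surj])
    note coord = continuous_map_geo_coord[of S]
    have W: "continuous_map (geo S) euclideanreal W"
      unfolding W_def using finS by (intro continuous_map_sum coord) auto
    show U: "continuous_map (geo S) euclideanreal U"
      unfolding U_def using finorb by (intro continuous_map_sum coord) auto
    show "continuous_map (geo S) euclideanreal V"
      unfolding V_def by (intro continuous_map_diff U W continuous_map_canonical_const)
    show "continuous_map (geo S) euclideanreal H"
      unfolding H_def g_def f_def using finS
      by (intro continuous_map_sum continuous_map_real_min continuous_map_real_mult_left
          continuous_map_real_abs coord) auto
    show "finite (vpt ` verts S)" using finite_verts by simp
    show "vpt ` verts S \<subseteq> realize S" using vpt_realize by blast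
    show "inj_on (\<lambda>\<sigma>. vpush \<sigma> p) A \<longleftrightarrow> p \<notin> vpt ` verts S" if p: "p \<in> realize S" for p
    proof
      assume "inj_on (\<lambda>\<sigma>. vpush \<sigma> p) A"
      then show "p \<notin> vpt ` verts S" using no_free_vertex by blast
    next
      assume nz: "p \<notin> vpt ` verts S"
      show "inj_on (\<lambda>\<sigma>. vpush \<sigma> p) A"
      proof (rule inj_onI, rule ccontr, rule realizeE[OF p])
        fix \<sigma> \<tau> a b c \<alpha> \<beta> \<gamma> assume st: "\<sigma> \<in> A" "\<tau> \<in> A" "vpush \<sigma> p = vpush \<tau> p" "\<sigma> \<noteq> \<tau>"
          and t: "(a, b, c) \<in> S" "p = bary (a, b, c) \<alpha> \<beta> \<gamma>"
          and ps: "\<alpha> \<ge> 0" "\<beta> \<ge> 0" "\<gamma> \<ge> 0" "\<alpha> + \<beta> + \<gamma> = 1"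
        have "\<alpha> \<noteq> 1" "\<beta> \<noteq> 1" "\<gamma> \<noteq> 1" using coords_ne_one[OF t(1) ps] nz t(2) by auto
        \<comment> \<open>A collision off the vertices would take a and b to a common vertex,
          although symmetries keep their different colours.\<close>
        then have "\<sigma> a = \<tau> b \<and> \<sigma> b = \<tau> a"
          using collision[OF t(1) st(1,2,4) ps] st(3) t(2) by simp
        then have "\<sigma> a \<in> orb x \<longleftrightarrow> \<tau> b \<in> orb x" by simp
        then show False
          using orb_closed[OF st(1)] orb_closed[OF st(2)] in_verts[OF t(1)] orb_colour[OF ne t(1)]
          by blast
      qed
    qed
  qed
  have "?pr (vpt v) = (if v \<in> orb x then pole1 else pole2)" if v: "v \<in> fst ` S" for v
  proof -
    obtain b c where t: "(v, b, c) \<in> S" using v first_verts by blast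
    show ?thesis
      using val[OF t vpt_bary(1)[of v b c]] unfolding V_def pole1_def pole2_def by simp
  qed
  moreover have "?pr (vpt v) = pole3" if v: "v \<in> (snd \<circ> snd) ` S" for v
  proof -
    obtain a b where t: "(a, b, v) \<in> S" using v by force
    show ?thesis
      using val[OF t vpt_bary(3)[of v a b]] unfolding V_def pole3_def by simp
  qed
  ultimately show ?thesis using fq by blast
qed

section \<open>Orders, stabilizers and the full automorphism group\<close>

lemma card_A_one_orbit:
  assumes "moves (x, y, c0) (y, x, c1)"
  shows "card A = card S"
proof -
  have "{t \<in> S. moves (x, y, c0) t} = S"
    using moves_all[OF assms base(1)] by (auto simp: Ball_def)
  then show ?thesis using card_stab[OF base(1), of "\<lambda>_ _ _. True"] by simp
qed

text \<open>The orbits of the two base triangles are disjoint, exhaust S and, by freeness, both have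
  the size of the group.\<close>

lemma card_A_two_orbits:
  assumes "\<not> moves (x, y, c0) (y, x, c1)"
  shows "card S = 2 * card A"
proof -
  let ?P = "{t \<in> S. moves (x, y, c0) t}" and ?Q = "{t \<in> S. moves (y, x, c1) t}"
  have "S = ?P \<union> ?Q"
  proof (intro equalityI subsetI)
    fix t assume "t \<in> S"
    then show "t \<in> ?P \<union> ?Q" using moves_total by (cases t) auto
  qed auto
  moreover have "?P \<inter> ?Q = {}"
  proof (rule ccontr)
    assume "?P \<inter> ?Q \<noteq> {}"
    then obtain a b c where t: "(a, b, c) \<in> S" "moves (x, y, c0) (a, b, c)" "moves (y, x, c1) (a, b, c)"
      by auto
    show False
      using moves_trans[OF t(2) moves_sym[OF t(3) base(2)] base(1)] assms by blast
  qed
  moreover have "card ?P = card A" "card ?Q = card A"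
    using card_stab[OF base(1), of "\<lambda>_ _ _. True"] card_stab[OF base(2), of "\<lambda>_ _ _. True"]
    by simp_all
  moreover have "finite ?P" "finite ?Q" using finS by simp_all
  ultimately have "card S = card A + card A" by (metis (no_types, lifting) card_Un_disjoint)
  then show ?thesis by simp
qed

text \<open>The image of the base triangle determines an automorphism, so it suffices that some
  element of \<open>A\<close> achieves this image.\<close>

lemma tri_auts_in_A:
  assumes s: "\<sigma> \<in> tri_auts" and m: "moves (x, y, c0) (\<sigma> x, \<sigma> y, \<sigma> c0)"
  shows "\<sigma> \<in> A"
proof -
  obtain \<tau> where t: "\<tau> \<in> A" "\<tau> x = \<sigma> x" "\<tau> y = \<sigma> y" "\<tau> c0 = \<sigma> c0" using m moves_iff by blast
  then have "\<tau> = \<sigma>" using tri_auts_eq[OF _ s base(1), of \<tau>] A_auts by blast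
  then show ?thesis using t by simp
qed

lemma valency_invariant:
  assumes s: "\<sigma> \<in> tri_auts" and t: "(a, b, c) \<in> S"
  shows "valency S (\<sigma> a) = valency S a"
proof -
  have inj: "inj_on \<sigma> (verts S)" and im: "tmap \<sigma> ` S = S"
    using s by (auto simp: tri_auts_def bij_betw_def)
  have "bij_betw (tmap \<sigma>) {t \<in> S. fst t = a} {t \<in> S. fst t = \<sigma> a}"
    unfolding bij_betw_def
  proof (intro conjI equalityI subsetI)
    show "inj_on (tmap \<sigma>) {t \<in> S. fst t = a}"
      using in_verts by (auto simp: inj_on_def tmap_def intro!: inj_onD[OF inj])
  next
    fix t assume "t \<in> tmap \<sigma> ` {t \<in> S. fst t = a}"
    then show "t \<in> {t \<in> S. fst t = \<sigma> a}" using tri_auts_tri[OF s] by (auto simp: tmap_def)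
  next
    fix t assume "t \<in> {t \<in> S. fst t = \<sigma> a}"
    then have "t \<in> tmap \<sigma> ` S" "fst t = \<sigma> a" using im by auto
    then obtain a' b' c' where t': "(a', b', c') \<in> S" "t = tmap \<sigma> (a', b', c')" "\<sigma> a' = \<sigma> a"
      by (auto simp: tmap_def)
    then have "a' = a" using inj_onD[OF inj t'(3)] in_verts[OF t'(1)] in_verts[OF t] by blast
    then show "t \<in> tmap \<sigma> ` {t \<in> S. fst t = a}" using t' by auto
  qed
  then show ?thesis
    using valency_eq[OF t] valency_eq[OF tri_auts_tri[OF s t]] bij_betw_same_card by fastforce
qed

text \<open>The colours of first vertices alternate round a centre, since consecutive triangles
  start at the two ends of an edge. So an orbit contains half of the triangles around c, which is
  the origin of the ramification index n/2.\<close>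

lemma card_half_centre:
  assumes ne: "orb x \<noteq> orb y" and t: "(a, b, c) \<in> S"
  shows "card {t \<in> S. moves (a, b, c) t \<and> snd (snd t) = c} = card {t \<in> S. snd (snd t) = c} div 2"
proof -
  let ?P = "{t \<in> S. snd (snd t) = c \<and> fst t \<in> orb x}"
    and ?Q = "{t \<in> S. snd (snd t) = c \<and> fst t \<notin> orb x}"
  \<comment> \<open>The adjacent triangle round c whose second vertex is the first vertex of t. It
    maps each colour class injectively into the other, which is enough for equal
    cardinalities.\<close>
  have "\<forall>t. \<exists>s. t \<in> S \<and> snd (snd t) = c \<longrightarrow> s \<in> S \<and> fst (snd s) = fst t \<and> snd (snd s) = c"
  proof
    fix t :: "'v tri"
    show "\<exists>s. t \<in> S \<and> snd (snd t) = c \<longrightarrow> s \<in> S \<and> fst (snd s) = fst t \<and> snd (snd s) = c"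
    proof (cases "t \<in> S \<and> snd (snd t) = c")
      case True
      then have "(fst t, fst (snd t), c) \<in> S" by auto
      then obtain b' where "(b', fst t, c) \<in> S" using nb1 by blast
      then show ?thesis by (intro exI[of _ "(b', fst t, c)"]) simp
    qed blast
  qed
  then obtain f where "\<forall>t. t \<in> S \<and> snd (snd t) = c \<longrightarrow>
      f t \<in> S \<and> fst (snd (f t)) = fst t \<and> snd (snd (f t)) = c"
    by (rule choice[THEN exE])
  then have f: "f t \<in> S \<and> fst (snd (f t)) = fst t \<and> snd (snd (f t)) = c"
    if "t \<in> S" "snd (snd t) = c" for t
    using that by blast
  have "card ?P = card ?Q"
  proof (rule card_bij_eq)
    have inj: "s = t" if "s \<in> S" "t \<in> S" "snd (snd s) = c" "snd (snd t) = c" "f s = f t" for s t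
    proof -
      have "fst s = fst t" using f[OF that(1,3)] f[OF that(2,4)] that(5) by simp
      moreover have "(fst s, fst (snd s), c) \<in> S" "(fst t, fst (snd t), c) \<in> S"
        using that by (metis prod.collapse)+
      ultimately show ?thesis
        using uniq2[of "fst s" "fst (snd s)" c "fst (snd t)"] that(3,4) by (simp add: prod_eq_iff)
    qed
    have col: "fst (f t) \<in> orb x \<longleftrightarrow> fst t \<notin> orb x" if "t \<in> S" "snd (snd t) = c" for t
    proof -
      have "(fst (f t), fst t, c) \<in> S" using f[OF that] by (metis prod.collapse)
      then show ?thesis using orb_colour[OF ne] by blast
    qed
    show "inj_on f ?P" "inj_on f ?Q" using inj by (auto intro!: inj_onI)
    show "f ` ?P \<subseteq> ?Q" "f ` ?Q \<subseteq> ?P" using f col by auto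
    show "finite ?P" "finite ?Q" using finS by auto
  qed
  moreover have "{t \<in> S. snd (snd t) = c} = ?P \<union> ?Q" "?P \<inter> ?Q = {}" by auto
  ultimately have *: "card {t \<in> S. snd (snd t) = c} = 2 * card ?P" "card ?P = card ?Q"
    using finS by (simp_all add: card_Un_disjoint)
  have m: "moves (a, b, c) s \<longleftrightarrow> (a \<in> orb x \<longleftrightarrow> fst s \<in> orb x)" if "s \<in> S" for s
    using that moves_colour[OF ne t] by (cases s) auto
  have "{s \<in> S. moves (a, b, c) s \<and> snd (snd s) = c} = (if a \<in> orb x then ?P else ?Q)"
    using m by auto
  then show ?thesis using * by simp
qed

lemma stab_vpt: "v \<in> verts S \<Longrightarrow> {\<sigma> \<in> A. vpush \<sigma> (vpt v) = vpt v} = {\<sigma> \<in> A. \<sigma> v = v}"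
  by (auto simp: vpush_vpt)

text \<open>Only the identity and the reversal of the edge fix its midpoint; the reversal exists
  because both adjacent triangles are in one orbit.\<close>

lemma card_stab_midpt:
  assumes sw: "moves (x, y, c0) (y, x, c1)" and t: "(a, b, c) \<in> S"
  shows "card {\<sigma> \<in> A. vpush \<sigma> (midpt a b) = midpt a b} = 2"
proof -
  obtain d where d: "(b, a, d) \<in> S" using nb0 t by blast
  have ab: "a \<noteq> b" using edge_distinct t by blast
  have mid: "midpt u v = midpt a b \<longleftrightarrow> u = a \<and> v = b \<or> u = b \<and> v = a" if uv: "u \<noteq> v" for u v
  proof
    assume "midpt u v = midpt a b"
    then have "midpt u v w = midpt a b w" for w by simp
    from this[of u] this[of v] show "u = a \<and> v = b \<or> u = b \<and> v = a"
      using uv ab by (auto simp: midpt_def vpt_def split: if_splits)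
  qed (auto simp: midpt_def add.commute)
  have "vpush \<sigma> (midpt a b) = midpt (\<sigma> a) (\<sigma> b)" for \<sigma>
    using vpush_bary[OF t, of \<sigma> "1/2" "1/2" 0] by (simp flip: midpt_bary)
  moreover have "\<sigma> a \<noteq> \<sigma> b" if "\<sigma> \<in> A" for \<sigma> using edge_distinct A_tri[OF that t] by blast
  ultimately have "{\<sigma> \<in> A. vpush \<sigma> (midpt a b) = midpt a b} =
      {\<sigma> \<in> A. \<sigma> a = a \<and> \<sigma> b = b \<or> \<sigma> a = b \<and> \<sigma> b = a}"
    using mid by auto
  moreover have "{s \<in> S. moves (a, b, c) s \<and>
      (fst s = a \<and> fst (snd s) = b \<or> fst s = b \<and> fst (snd s) = a)} = {(a, b, c), (b, a, d)}"
    (is "?L = _")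
  proof (intro equalityI subsetI)
    fix s assume s: "s \<in> ?L"
    obtain u v w where "s = (u, v, w)" by (cases s)
    then show "s \<in> {(a, b, c), (b, a, d)}" using s uniq3[OF t, of w] uniq3[OF d, of w] by auto
  qed (use t d moves_all[OF sw t] in auto)
  ultimately show ?thesis
    using card_stab[OF t, of "\<lambda>u v w. u = a \<and> v = b \<or> u = b \<and> v = a"] ab by simp
qed

text \<open>The number of vertex orbits decides between the two cases exactly as
  \<open>moves (x, y, c0) (y, x, c1)\<close> does. In both, the non-free points fall into three
  classes, each sent to one pole, so the branch set has three elements.\<close>

theorem quotient_sphere:
  assumes n: "\<And>c. c \<in> (snd \<circ> snd) ` S \<Longrightarrow> card {t \<in> S. c \<in> tri_vs t} = n"
  shows "\<exists>pr B. quotient_map (geo S) (nsphere 2) pr \<and>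
     (\<forall>p \<in> realize S. \<forall>p' \<in> realize S. pr p = pr p' \<longleftrightarrow> (\<exists>\<sigma> \<in> A. vpush \<sigma> p = p')) \<and>
     branched_cover (geo S) (nsphere 2) pr (card A) B \<and> card B = 3 \<and>
     (card (orb ` (fst ` S)) = 2 \<longrightarrow>
        (\<exists>c. pr ` vpt ` ((snd \<circ> snd) ` S) = {c} \<and> B = {pr (vpt x), pr (vpt y), c}) \<and>
        ram_index (geo S) (nsphere 2) pr (vpt x) (valency S x) \<and>
        ram_index (geo S) (nsphere 2) pr (vpt y) (valency S y) \<and>
        (\<forall>c \<in> (snd \<circ> snd) ` S. ram_index (geo S) (nsphere 2) pr (vpt c) (n div 2)) \<and>
        subgroup A (BijGroup (verts S)) \<and> A \<subseteq> tri_auts \<and>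
        card tri_auts \<le> 2 * card A \<and> card A = card (cell_edges S) \<and>
        (valency S x \<noteq> valency S y \<longrightarrow> A = tri_auts)) \<and>
     (card (orb ` (fst ` S)) = 1 \<longrightarrow>
        (\<exists>m c. pr ` edge_midpoints S = {m} \<and> pr ` vpt ` ((snd \<circ> snd) ` S) = {c} \<and>
               B = {pr (vpt x), m, c}) \<and>
        ram_index (geo S) (nsphere 2) pr (vpt x) (valency S x) \<and>
        (\<forall>m \<in> edge_midpoints S. ram_index (geo S) (nsphere 2) pr m 2) \<and>
        (\<forall>c \<in> (snd \<circ> snd) ` S. ram_index (geo S) (nsphere 2) pr (vpt c) n) \<and>
        A = tri_auts \<and> card A = 2 * card (cell_edges S))"
proof -
  have v: "x \<in> verts S" "y \<in> verts S" using in_verts base by blast+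
  have V: "verts S = fst ` S \<union> (snd \<circ> snd) ` S"
  proof (intro equalityI subsetI)
    fix v assume "v \<in> verts S"
    then show "v \<in> fst ` S \<union> (snd \<circ> snd) ` S" by (cases rule: verts_cases) force+
  next
    fix v assume "v \<in> fst ` S \<union> (snd \<circ> snd) ` S"
    then show "v \<in> verts S" using in_verts by auto
  qed
  have xy: "x \<in> fst ` S" "y \<in> fst ` S" using base by force+
  have C: "(snd \<circ> snd) ` S \<noteq> {}" using base by auto
  have F: "fst ` S \<noteq> {}" using base by auto
  have E: "edge_midpoints S \<noteq> {}" using base edge_midpoints_iff by blast
  have cent: "\<exists>a b. (a, b, c) \<in> S" if "c \<in> (snd \<circ> snd) ` S" for c using that by force
  have nc: "card {t \<in> S. snd (snd t) = c} = n" if "(a, b, c) \<in> S" for a b c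
  proof -
    have "c \<in> (snd \<circ> snd) ` S" using that by force
    then show ?thesis using n[of c] centre_tris[OF that] by simp
  qed
  have stx: "card {\<sigma> \<in> A. vpush \<sigma> (vpt x) = vpt x} = valency S x"
    and sty: "card {\<sigma> \<in> A. vpush \<sigma> (vpt y) = vpt y} = valency S y"
    using stab_vpt v card_stab_vertex base by simp_all
  show ?thesis
  proof (cases "moves (x, y, c0) (y, x, c1)")
    case True
    obtain pr where fq: "finite_quotient (geo S) (nsphere 2) pr A vpush (vpt ` verts S \<union> edge_midpoints S)"
      and p1: "\<forall>v\<in>fst ` S. pr (vpt v) = pole1" and p2: "\<forall>m\<in>edge_midpoints S. pr m = pole2"
      and p3: "\<forall>v\<in>(snd \<circ> snd) ` S. pr (vpt v) = pole3"
      using one_orbit[OF True] by blast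
    interpret finite_quotient "geo S" "nsphere 2" pr A vpush "vpt ` verts S \<union> edge_midpoints S"
      by (rule fq)
    have im: "pr ` edge_midpoints S = {pole2}" "pr ` vpt ` ((snd \<circ> snd) ` S) = {pole3}"
      "pr ` vpt ` fst ` S = {pole1}"
      using image_singleton[OF E, of pr] image_singleton[OF C, of "\<lambda>c. pr (vpt c)"]
        image_singleton[OF F, of "\<lambda>c. pr (vpt c)"] p1 p2 p3
      by (simp_all add: image_image)
    have B: "pr ` (vpt ` verts S \<union> edge_midpoints S) = {pole1, pole2, pole3}"
      unfolding V image_Un im by blast
    have stc: "card {\<sigma> \<in> A. vpush \<sigma> (vpt c) = vpt c} = n" if cC: "c \<in> (snd \<circ> snd) ` S" for c
    proof -
      obtain a b where t: "(a, b, c) \<in> S" using cent[OF cC] by blast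
      have "{t \<in> S. moves (a, b, c) t \<and> snd (snd t) = c} = {t \<in> S. snd (snd t) = c}"
        using moves_all[OF True t] by auto
      then show ?thesis
        using card_stab[OF t, of "\<lambda>u v w. w = c"] nc[OF t] stab_vpt[of c] in_verts[OF t] by simp
    qed
    have rc: "ram_index (geo S) (nsphere 2) pr (vpt c) n" if "c \<in> (snd \<circ> snd) ` S" for c
    proof -
      have "vpt c \<in> realize S" using vpt_realize that V by blast
      then show ?thesis using ramification[of "vpt c"] stc[OF that] by simp
    qed
    have rm: "ram_index (geo S) (nsphere 2) pr m 2" if m: "m \<in> edge_midpoints S" for m
    proof -
      obtain a b c where t: "(a, b, c) \<in> S" "m = midpt a b" using m edge_midpoints_iff by blast
      have "m \<in> realize S" using Zsub m by auto
      then show ?thesis using ramification[of m] card_stab_midpt[OF True t(1)] t(2) by simp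
    qed
    have rx: "ram_index (geo S) (nsphere 2) pr (vpt x) (valency S x)"
      using ramification[of "vpt x"] stx vpt_realize v by simp
    \<comment> \<open>The image of the base triangle under any automorphism is also its image under
      some element of \<open>A\<close>, and it determines the automorphism.\<close>
    have sub: "A = tri_auts"
      using A_auts tri_auts_in_A moves_all[OF True base(1)] tri_auts_tri base(1) by blast
    show ?thesis
    proof (intro exI[of _ pr] exI[of _ "{pole1, pole2, pole3}"] conjI impI ballI)
      show "quotient_map (geo S) (nsphere 2) pr" by (rule quotient)
      show "pr p = pr p' \<longleftrightarrow> (\<exists>\<sigma>\<in>A. vpush \<sigma> p = p')" if "p \<in> realize S" "p' \<in> realize S" for p p'
        using fibre that by simp
      show "branched_cover (geo S) (nsphere 2) pr (card A) {pole1, pole2, pole3}"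
        using branched unfolding B .
      show "card {pole1, pole2, pole3} = 3" by (rule poles_distinct)
      show "\<exists>m c. pr ` edge_midpoints S = {m} \<and> pr ` vpt ` ((snd \<circ> snd) ` S) = {c} \<and>
          {pole1, pole2, pole3} = {pr (vpt x), m, c}"
        using im p1 xy by auto
      show "ram_index (geo S) (nsphere 2) pr m 2" if "m \<in> edge_midpoints S" for m
        using rm that .
      show "ram_index (geo S) (nsphere 2) pr (vpt c) n" if "c \<in> (snd \<circ> snd) ` S" for c
        using rc that .
      show "card A = 2 * card (cell_edges S)" using card_A_one_orbit[OF True] card_edges by simp
    qed (use card_orbits_swap(1)[OF True] sub rx in simp_all)
  next
    case False
    have ne: "orb x \<noteq> orb y" using same_orb_swap False by blast
    obtain pr where fq: "finite_quotient (geo S) (nsphere 2) pr A vpush (vpt ` verts S)"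
      and p12: "\<forall>v\<in>fst ` S. pr (vpt v) = (if v \<in> orb x then pole1 else pole2)"
      and p3: "\<forall>v\<in>(snd \<circ> snd) ` S. pr (vpt v) = pole3"
      using two_orbits[OF ne] by blast
    interpret finite_quotient "geo S" "nsphere 2" pr A vpush "vpt ` verts S"
      by (rule fq)
    have xo: "x \<in> orb x" "y \<notin> orb x" using orb_refl[OF v(1)] orb_colour[OF ne base(1)] by auto
    have px: "pr (vpt x) = pole1" "pr (vpt y) = pole2" using p12 xy xo by auto
    have im: "pr ` vpt ` ((snd \<circ> snd) ` S) = {pole3}"
      using image_singleton[OF C, of "\<lambda>c. pr (vpt c)"] p3 by (simp add: image_image)
    have im': "pr ` vpt ` fst ` S = {pole1, pole2}"
    proof (intro equalityI subsetI)
      fix z assume "z \<in> pr ` vpt ` fst ` S"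
      then obtain v where "v \<in> fst ` S" "z = pr (vpt v)" by blast
      then show "z \<in> {pole1, pole2}" using p12 by (cases "v \<in> orb x") simp_all
    next
      fix z assume "z \<in> {pole1, pole2}"
      then show "z \<in> pr ` vpt ` fst ` S" using px xy by (metis image_eqI insertE singletonD)
    qed
    have B: "pr ` (vpt ` verts S) = {pole1, pole2, pole3}"
      unfolding V image_Un im im' by blast
    have stc: "card {\<sigma> \<in> A. vpush \<sigma> (vpt c) = vpt c} = n div 2" if cC: "c \<in> (snd \<circ> snd) ` S" for c
    proof -
      obtain a b where t: "(a, b, c) \<in> S" using cent[OF cC] by blast
      show ?thesis
        using card_stab[OF t, of "\<lambda>u v w. w = c"] nc[OF t] card_half_centre[OF ne t]
          stab_vpt[of c] in_verts[OF t] by simp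
    qed
    have rc: "ram_index (geo S) (nsphere 2) pr (vpt c) (n div 2)" if "c \<in> (snd \<circ> snd) ` S" for c
    proof -
      have "vpt c \<in> realize S" using vpt_realize that V by blast
      then show ?thesis using ramification[of "vpt c"] stc[OF that] by simp
    qed
    have cA: "card S = 2 * card A" using card_A_two_orbits[OF False] .
    show ?thesis
    proof (intro exI[of _ pr] exI[of _ "{pole1, pole2, pole3}"] conjI impI ballI)
      show "quotient_map (geo S) (nsphere 2) pr" by (rule quotient)
      show "pr p = pr p' \<longleftrightarrow> (\<exists>\<sigma>\<in>A. vpush \<sigma> p = p')" if "p \<in> realize S" "p' \<in> realize S" for p p'
        using fibre that by simp
      show "branched_cover (geo S) (nsphere 2) pr (card A) {pole1, pole2, pole3}"
        using branched unfolding B .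
      show "card {pole1, pole2, pole3} = 3" by (rule poles_distinct)
      show "\<exists>c. pr ` vpt ` ((snd \<circ> snd) ` S) = {c} \<and> {pole1, pole2, pole3} = {pr (vpt x), pr (vpt y), c}"
        using im px by auto
      show "ram_index (geo S) (nsphere 2) pr (vpt x) (valency S x)"
        using ramification[of "vpt x"] stx vpt_realize v by simp
      show "ram_index (geo S) (nsphere 2) pr (vpt y) (valency S y)"
        using ramification[of "vpt y"] sty vpt_realize v by simp
      show "ram_index (geo S) (nsphere 2) pr (vpt c) (n div 2)" if "c \<in> (snd \<circ> snd) ` S" for c
        using rc that .
      show "card tri_auts \<le> 2 * card A" using card_tri_auts_le base cA by auto
      show "card A = card (cell_edges S)" using card_edges cA by simp
      show "subgroup A (BijGroup (verts S))" by (rule subgroup_A)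
      show "A \<subseteq> tri_auts" by (rule A_auts)
      show "A = tri_auts" if val: "valency S x \<noteq> valency S y"
      proof (intro equalityI subsetI)
        fix \<sigma> assume "\<sigma> \<in> A"
        then show "\<sigma> \<in> tri_auts" using A_auts by blast
      next
        fix \<sigma> assume s: "\<sigma> \<in> tri_auts"
        \<comment> \<open>Sending x into the orbit of y would make the two valencies equal, since
          automorphisms preserve valency.\<close>
        have "\<not> moves (y, x, c1) (\<sigma> x, \<sigma> y, \<sigma> c0)"
        proof
          assume "moves (y, x, c1) (\<sigma> x, \<sigma> y, \<sigma> c0)"
          then obtain \<tau> where t: "\<tau> \<in> A" "\<tau> y = \<sigma> x" unfolding moves_iff by blast
          then have "valency S (\<tau> y) = valency S y"
            using valency_invariant[OF _ base(2)] A_auts by blast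
          then show False using valency_invariant[OF s base(1)] t val by simp
        qed
        then show "\<sigma> \<in> A"
          using moves_total[OF tri_auts_tri[OF s base(1)]] tri_auts_in_A[OF s] by blast
      qed
    qed (use card_orbits_swap(2)[OF False] in simp_all)
  qed
qed

end

section \<open>The complex of noncommuting pairs\<close>

context group
begin

definition noncomm :: "'a \<Rightarrow> 'a \<Rightarrow> bool" where
  "noncomm a b \<longleftrightarrow> a \<in> carrier G \<and> b \<in> carrier G \<and> a \<otimes> b \<noteq> b \<otimes> a"

definition xt :: "'a \<Rightarrow> 'a \<Rightarrow> 'a xvert tri" where
  "xt a b = ((a, 1), (b, 1), (a \<otimes> b, 2))"

text \<open>The lift of (a, 1) depends on b only through the circle of the link. Equality of such
  lifts for different b is what gluing triangles in the resolution means.\<close>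

definition yt1 :: "'a \<Rightarrow> 'a \<Rightarrow> 'a yvert" where "yt1 a b = ylift G (a, 1) (xt a b)"
definition yt2 :: "'a \<Rightarrow> 'a \<Rightarrow> 'a yvert" where "yt2 a b = ylift G (b, 1) (xt a b)"
definition yt3 :: "'a \<Rightarrow> 'a \<Rightarrow> 'a yvert" where "yt3 a b = ylift G (a \<otimes> b, 2) (xt a b)"

definition yt :: "'a \<Rightarrow> 'a \<Rightarrow> 'a yvert tri" where
  "yt a b = (yt1 a b, yt2 a b, yt3 a b)"

lemma Xtri_iff: "t \<in> Xtri G \<longleftrightarrow> (\<exists>a b. noncomm a b \<and> t = xt a b)"
  unfolding Xtri_def noncomm_def xt_def by blast

lemma xt_Xtri: "noncomm a b \<Longrightarrow> xt a b \<in> Xtri G"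
  using Xtri_iff by blast

lemma Ytri_iff: "t \<in> Ytri G \<longleftrightarrow> (\<exists>a b. noncomm a b \<and> t = yt a b)"
proof
  assume "t \<in> Ytri G"
  then obtain s u v w where s: "s \<in> Xtri G" "s = (u, v, w)" "t = (ylift G u s, ylift G v s, ylift G w s)"
    unfolding Ytri_def by blast
  then obtain a b where "noncomm a b" "s = xt a b" using Xtri_iff by blast
  then show "\<exists>a b. noncomm a b \<and> t = yt a b"
    using s unfolding yt_def yt1_def yt2_def yt3_def by (auto simp: xt_def)
next
  assume "\<exists>a b. noncomm a b \<and> t = yt a b"
  then obtain a b where "noncomm a b" "t = yt a b" by blast
  then have "xt a b \<in> Xtri G" "xt a b = ((a, 1), (b, 1), (a \<otimes> b, 2))"
    "t = (ylift G (a, 1) (xt a b), ylift G (b, 1) (xt a b), ylift G (a \<otimes> b, 2) (xt a b))"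
    using xt_Xtri by (simp_all add: xt_def yt_def yt1_def yt2_def yt3_def)
  then show "t \<in> Ytri G" unfolding Ytri_def by blast
qed

lemma fst_ylift [simp]: "fst (ylift G v t) = v"
  by (simp add: ylift_def)

lemma fst_yt [simp]: "fst (yt1 a b) = (a, 1)" "fst (yt2 a b) = (b, 1)" "fst (yt3 a b) = (a \<otimes> b, 2)"
  by (simp_all add: yt1_def yt2_def yt3_def)

lemma yt_inj: "yt a b = yt a' b' \<Longrightarrow> a = a' \<and> b = b'"
  unfolding yt_def by (metis Pair_inject fst_yt(1,2))

lemma tri_vs_xt: "tri_vs (xt a b) = {(a, 1), (b, 1), (a \<otimes> b, 2)}"
  by (simp add: tri_vs_def xt_def)

lemma noncomm_sym: "noncomm a b \<Longrightarrow> noncomm b a"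
  by (auto simp: noncomm_def)

lemma noncomm_ne: "noncomm a b \<Longrightarrow> a \<noteq> b"
  by (auto simp: noncomm_def)

lemma noncomm_carrier: "noncomm a b \<Longrightarrow> a \<in> carrier G \<and> b \<in> carrier G"
  by (auto simp: noncomm_def)

lemma noncomm_left:
  assumes "noncomm a b" shows "noncomm (a \<otimes> b \<otimes> inv a) a"
proof -
  have c: "a \<in> carrier G" "b \<in> carrier G" and n: "a \<otimes> b \<noteq> b \<otimes> a" using assms by (auto simp: noncomm_def)
  have "a \<otimes> b \<otimes> inv a \<otimes> a = a \<otimes> b" using c by (simp add: m_assoc)
  moreover have "a \<otimes> (a \<otimes> b \<otimes> inv a) \<noteq> a \<otimes> b"
  proof
    assume "a \<otimes> (a \<otimes> b \<otimes> inv a) = a \<otimes> b"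
    then have "a \<otimes> b \<otimes> inv a = b" using c by simp
    then have "a \<otimes> b \<otimes> inv a \<otimes> a = b \<otimes> a" by simp
    then show False using n c by (simp add: m_assoc)
  qed
  ultimately show ?thesis using c by (simp add: noncomm_def)
qed

lemma noncomm_right:
  assumes "noncomm a b" shows "noncomm b (inv b \<otimes> a \<otimes> b)"
proof -
  have c: "a \<in> carrier G" "b \<in> carrier G" and n: "a \<otimes> b \<noteq> b \<otimes> a" using assms by (auto simp: noncomm_def)
  have 1: "b \<otimes> (inv b \<otimes> a \<otimes> b) = a \<otimes> b" using c by (simp add: m_assoc[symmetric])
  moreover have "inv b \<otimes> a \<otimes> b \<otimes> b \<noteq> a \<otimes> b"
  proof
    assume "inv b \<otimes> a \<otimes> b \<otimes> b = a \<otimes> b"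
    then have "inv b \<otimes> a \<otimes> b = a" using c by simp
    then show False using n 1 by simp
  qed
  ultimately show ?thesis using c by (auto simp: noncomm_def)
qed

section \<open>Link circles and edge crossings\<close>

lemma link_adj_sym: "sym (link_adj G v)"
  by (auto simp: link_adj_def sym_def)

lemma link_edgeI: "t \<in> Xtri G \<Longrightarrow> v \<in> tri_vs t \<Longrightarrow> tri_vs t - {v} \<in> link_edges G v"
  unfolding link_edges_def by blast

text \<open>Triangles with the edge vw in common have link edges at v that meet in w, hence lie on
  the same circle.\<close>

lemma ylift_eqI:
  assumes t: "t \<in> Xtri G" "t' \<in> Xtri G" "v \<in> tri_vs t" "v \<in> tri_vs t'"
    and w: "w \<in> tri_vs t" "w \<in> tri_vs t'" "w \<noteq> v"
  shows "ylift G v t = ylift G v t'"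
proof -
  let ?e = "tri_vs t - {v}" and ?f = "tri_vs t' - {v}" and ?R = "link_adj G v"
  have "(?e, ?f) \<in> ?R"
    unfolding link_adj_def using link_edgeI t w by blast
  moreover from this have "(?f, ?e) \<in> ?R" by (rule symD[OF link_adj_sym])
  ultimately have ef: "(?e, ?f) \<in> ?R\<^sup>*" "(?f, ?e) \<in> ?R\<^sup>*" by auto
  have "(?e, g) \<in> ?R\<^sup>* \<longleftrightarrow> (?f, g) \<in> ?R\<^sup>*" for g using ef rtrancl_trans by metis
  then show ?thesis unfolding ylift_def link_circle_def by simp
qed

text \<open>Induction along a link circle: equal lifts mean that the two link edges are connected by
  a chain, each step of which crosses an edge vw.\<close>

lemma ylift_path:
  assumes eq: "ylift G v t = ylift G v t'"
    and t: "t \<in> Xtri G" "t' \<in> Xtri G" "v \<in> tri_vs t" "v \<in> tri_vs t'" and P: "P t"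
    and step: "\<And>s s' w. s \<in> Xtri G \<Longrightarrow> s' \<in> Xtri G \<Longrightarrow> v \<in> tri_vs s \<Longrightarrow> v \<in> tri_vs s' \<Longrightarrow>
      w \<in> tri_vs s \<Longrightarrow> w \<in> tri_vs s' \<Longrightarrow> w \<noteq> v \<Longrightarrow> P s \<Longrightarrow> P s'"
  shows "P t'"
proof -
  let ?e = "tri_vs t - {v}" and ?f = "tri_vs t' - {v}" and ?R = "link_adj G v"
  \<comment> \<open>An edge of the link does not name the triangle it comes from, so the invariant
    covers every triangle with this link edge.\<close>
  let ?Q = "\<lambda>g. \<forall>s\<in>Xtri G. v \<in> tri_vs s \<longrightarrow> tri_vs s - {v} = g \<longrightarrow> P s"
  have "?f \<in> link_circle G v ?f" unfolding link_circle_def using link_edgeI t by simp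
  then have "?f \<in> link_circle G v ?e" using eq by (simp add: ylift_def)
  then have "(?e, ?f) \<in> ?R\<^sup>*" by (simp add: link_circle_def)
  then have "?Q ?f"
  proof (induction rule: rtrancl_induct)
    case base
    obtain a b where ab: "noncomm a b" "t = xt a b" using t Xtri_iff by blast
    \<comment> \<open>Triangles with the same link edge share a vertex w besides v, so the base case
      is itself an instance of a crossing.\<close>
    have "(a, 1) \<in> tri_vs t" "(b, 1) \<in> tri_vs t" "(a, 1 :: nat) \<noteq> (b, 1)"
      using noncomm_ne[OF ab(1)] by (simp_all add: ab(2) tri_vs_xt)
    then obtain w where w: "w \<in> tri_vs t" "w \<noteq> v" by metis
    show ?case
    proof (intro ballI impI)
      fix s assume s: "s \<in> Xtri G" "v \<in> tri_vs s" "tri_vs s - {v} = ?e"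
      then show "P s" using step[OF t(1) s(1) t(3) s(2) w(1) _ w(2) P] w by blast
    qed
  next
    case (step g h)
    then obtain w where w: "w \<in> g" "w \<in> h" "g \<in> link_edges G v" unfolding link_adj_def by blast
    then obtain s where s: "s \<in> Xtri G" "v \<in> tri_vs s" "tri_vs s - {v} = g"
      unfolding link_edges_def by blast
    then have Ps: "P s" using step.IH by blast
    show ?case
    proof (intro ballI impI)
      fix s' assume s': "s' \<in> Xtri G" "v \<in> tri_vs s'" "tri_vs s' - {v} = h"
      show "P s'" using assms(7)[OF s(1) s'(1) s(2) s'(2) _ _ _ Ps, of w] w s(3) s'(3) by blast
    qed
  qed
  then show ?thesis using t by blast
qed

text \<open>A common edge either joins the type 1 vertices, giving {c, d} = {a, b}, or contains the
  product, giving c d = a b with a factor in common; cancellation then leaves only conjugates. Link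
  circles can therefore be followed by explicit formulas.\<close>

lemma shared_edge:
  assumes n: "noncomm a b" "noncomm c d"
    and v: "v \<in> tri_vs (xt a b)" "v \<in> tri_vs (xt c d)"
    and w: "w \<in> tri_vs (xt a b)" "w \<in> tri_vs (xt c d)" and "w \<noteq> v"
  shows "(c, d) = (a, b) \<or> (c, d) = (b, a) \<or> (c, d) = (a \<otimes> b \<otimes> inv a, a) \<or>
    (c, d) = (b, inv b \<otimes> a \<otimes> b)"
proof -
  have car: "a \<in> carrier G" "b \<in> carrier G" "c \<in> carrier G" "d \<in> carrier G"
    using n noncomm_carrier by auto
  have "{c, d} = {a, b} \<or> c \<otimes> d = a \<otimes> b \<and> (c = a \<or> c = b \<or> d = a \<or> d = b)"
  proof (cases "snd v = 1 \<and> snd w = 1")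
    case True
    have in12: "fst u \<in> {p, r}" if "u \<in> tri_vs (xt p r)" "snd u = 1" for u p r
      using that unfolding tri_vs_xt by auto
    have "fst v \<noteq> fst w" using True \<open>w \<noteq> v\<close> by (simp add: prod_eq_iff)
    moreover have "fst v \<in> {a, b}" "fst v \<in> {c, d}" "fst w \<in> {a, b}" "fst w \<in> {c, d}"
      using in12 v w True by blast+
    ultimately have "{c, d} = {a, b}" by auto
    then show ?thesis by blast
  next
    case False
    have type: "snd u = 1 \<and> fst u \<in> {p, r} \<or> u = (p \<otimes> r, 2)" if "u \<in> tri_vs (xt p r)" for u p r
      using that unfolding tri_vs_xt by auto
    obtain u where u: "u \<in> {v, w}" "snd u \<noteq> 1" using False by blast
    then have "u = (a \<otimes> b, 2)" "u = (c \<otimes> d, 2)" using type v w by blast+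
    then have 1: "c \<otimes> d = a \<otimes> b" by simp
    obtain u' where u': "u' \<in> {v, w}" "u' \<noteq> u" using \<open>w \<noteq> v\<close> by blast
    then have "u' \<noteq> (a \<otimes> b, 2)" using \<open>u = (a \<otimes> b, 2)\<close> by simp
    moreover have "u' \<in> tri_vs (xt a b)" "u' \<in> tri_vs (xt c d)" using u'(1) v w by blast+
    ultimately have "fst u' \<in> {a, b}" "fst u' \<in> {c, d}"
      using type[of u' a b] type[of u' c d] unfolding 1 by blast+
    then show ?thesis using 1 by auto
  qed
  then consider "{c, d} = {a, b}" | "c \<otimes> d = a \<otimes> b" "c = a" | "c \<otimes> d = a \<otimes> b" "c = b"
    | "c \<otimes> d = a \<otimes> b" "d = a" | "c \<otimes> d = a \<otimes> b" "d = b" by blast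
  then show ?thesis
  proof cases
    case 1
    then show ?thesis by (auto simp: doubleton_eq_iff)
  next
    case 2
    then show ?thesis using car by simp
  next
    case 3
    then have "inv b \<otimes> (b \<otimes> d) = inv b \<otimes> (a \<otimes> b)" by simp
    then show ?thesis using 3 car by (simp add: m_assoc[symmetric])
  next
    case 4
    then have "c \<otimes> a \<otimes> inv a = a \<otimes> b \<otimes> inv a" by simp
    then show ?thesis using 4 car by (simp add: m_assoc)
  next
    case 5
    then show ?thesis using car by simp
  qed
qed

lemma yt_swap:
  assumes "noncomm a b"
  shows "yt2 b a = yt1 a b" "yt1 b a = yt2 a b"
proof -
  have X: "xt a b \<in> Xtri G" "xt b a \<in> Xtri G" using assms noncomm_sym xt_Xtri by auto
  note n = noncomm_ne[OF assms]
  show "yt2 b a = yt1 a b" unfolding yt1_def yt2_def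
    by (rule ylift_eqI[OF X(2,1), of _ "(b, 1)"]) (use n in \<open>auto simp: tri_vs_xt\<close>)
  show "yt1 b a = yt2 a b" unfolding yt1_def yt2_def
    by (rule ylift_eqI[OF X(2,1), of _ "(a, 1)"]) (use n in \<open>auto simp: tri_vs_xt\<close>)
qed

text \<open>Since (a b a^-1) a = a b, this triangle shares the edge from (a, 1) to (a b, 2), whose
  endpoints then have the same lifts in both triangles.\<close>

lemma yt_left:
  assumes "noncomm a b"
  shows "yt2 (a \<otimes> b \<otimes> inv a) a = yt1 a b" "yt3 (a \<otimes> b \<otimes> inv a) a = yt3 a b"
proof -
  let ?b = "a \<otimes> b \<otimes> inv a"
  have X: "xt a b \<in> Xtri G" "xt ?b a \<in> Xtri G" using assms noncomm_left xt_Xtri by auto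
  have e: "?b \<otimes> a = a \<otimes> b" using noncomm_carrier[OF assms] by (simp add: m_assoc)
  show "yt2 ?b a = yt1 a b" unfolding yt1_def yt2_def
    by (rule ylift_eqI[OF X(2,1), of _ "(a \<otimes> b, 2)"]) (auto simp: tri_vs_xt e)
  show "yt3 ?b a = yt3 a b" unfolding yt3_def e
    by (rule ylift_eqI[OF X(2,1), of _ "(a, 1)"]) (auto simp: tri_vs_xt e)
qed

lemma yt_right:
  assumes "noncomm a b"
  shows "yt1 b (inv b \<otimes> a \<otimes> b) = yt2 a b" "yt3 b (inv b \<otimes> a \<otimes> b) = yt3 a b"
proof -
  let ?a = "inv b \<otimes> a \<otimes> b"
  have X: "xt a b \<in> Xtri G" "xt b ?a \<in> Xtri G" using assms noncomm_right xt_Xtri by auto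
  have e: "b \<otimes> ?a = a \<otimes> b" using noncomm_carrier[OF assms] by (simp add: m_assoc[symmetric])
  show "yt1 b ?a = yt2 a b" unfolding yt1_def yt2_def
    by (rule ylift_eqI[OF X(2,1), of _ "(a \<otimes> b, 2)"]) (auto simp: tri_vs_xt e)
  show "yt3 b ?a = yt3 a b" unfolding yt3_def e
    by (rule ylift_eqI[OF X(2,1), of _ "(b, 1)"]) (auto simp: tri_vs_xt e)
qed

section \<open>Equivariance of the resolution\<close>

lemma iso_noncomm:
  assumes "\<phi> \<in> iso G G" "noncomm a b" shows "noncomm (\<phi> a) (\<phi> b)"
proof -
  have h: "\<phi> \<in> hom G G" "inj_on \<phi> (carrier G)" using assms(1) by (auto simp: iso_def bij_betw_def)
  have c: "a \<in> carrier G" "b \<in> carrier G" "a \<otimes> b \<noteq> b \<otimes> a" using assms(2) by (auto simp: noncomm_def)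
  then have "\<phi> (a \<otimes> b) \<noteq> \<phi> (b \<otimes> a)" using inj_onD[OF h(2)] by auto
  then show ?thesis using h(1) c by (simp add: noncomm_def hom_in_carrier hom_mult)
qed

lemma xt_iso: "\<phi> \<in> iso G G \<Longrightarrow> noncomm a b \<Longrightarrow> tmap (xvmap \<phi>) (xt a b) = xt (\<phi> a) (\<phi> b)"
  by (auto simp: tmap_def xvmap_def xt_def noncomm_def iso_def hom_mult)

text \<open>An isomorphism is controlled only on the carrier, so injectivity is claimed only for
  vertices over it.\<close>

lemma xvmap_inj: "\<phi> \<in> iso G G \<Longrightarrow> inj_on (xvmap \<phi>) (carrier G \<times> UNIV)"
  by (auto simp: inj_on_def xvmap_def iso_def bij_betw_def)

lemma tri_vs_carrier: "t \<in> Xtri G \<Longrightarrow> tri_vs t \<subseteq> carrier G \<times> UNIV"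
  by (auto simp: Xtri_iff tri_vs_xt noncomm_def)

lemma Xtri_iso:
  assumes "\<phi> \<in> iso G G" shows "tmap (xvmap \<phi>) ` Xtri G = Xtri G"
proof (intro equalityI subsetI)
  fix t assume "t \<in> tmap (xvmap \<phi>) ` Xtri G"
  then obtain a b where "noncomm a b" "t = tmap (xvmap \<phi>) (xt a b)" by (auto simp: Xtri_iff)
  then show "t \<in> Xtri G" using xt_iso iso_noncomm xt_Xtri assms by simp
next
  fix t assume "t \<in> Xtri G"
  then obtain a b where t: "noncomm a b" "t = xt a b" using Xtri_iff by blast
  have im: "\<phi> ` carrier G = carrier G" and h: "\<phi> \<in> hom G G"
    using assms by (auto simp: iso_def bij_betw_def)
  obtain a' where a': "a' \<in> carrier G" "a = \<phi> a'" using im noncomm_carrier[OF t(1)] by (metis imageE)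
  obtain b' where b': "b' \<in> carrier G" "b = \<phi> b'" using im noncomm_carrier[OF t(1)] by (metis imageE)
  have "a' \<otimes> b' \<noteq> b' \<otimes> a'"
  proof
    assume "a' \<otimes> b' = b' \<otimes> a'"
    then have "a \<otimes> b = b \<otimes> a" using hom_mult[OF h] a' b' by metis
    then show False using t(1) by (simp add: noncomm_def)
  qed
  then have "noncomm a' b'" using a' b' by (simp add: noncomm_def)
  then show "t \<in> tmap (xvmap \<phi>) ` Xtri G" using xt_iso[OF assms, of a' b'] t a' b' xt_Xtri by (metis imageI)
qed

lemma link_edges_iso:
  assumes p: "\<phi> \<in> iso G G" and v: "v \<in> carrier G \<times> UNIV"
  shows "link_edges G (xvmap \<phi> v) = (`) (xvmap \<phi>) ` link_edges G v"
proof -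
  let ?F = "xvmap \<phi>"
  note inj = xvmap_inj[OF p]
  have d: "tri_vs (tmap ?F t) - {?F v} = ?F ` (tri_vs t - {v})" if "t \<in> Xtri G" for t
    unfolding tri_vs_tmap using inj_on_image_set_diff[OF inj, of "tri_vs t" "{v}"] tri_vs_carrier[OF that] v by auto
  have m: "?F v \<in> tri_vs (tmap ?F t) \<longleftrightarrow> v \<in> tri_vs t" if "t \<in> Xtri G" for t
    unfolding tri_vs_tmap using inj_on_image_mem_iff[OF inj v] tri_vs_carrier[OF that] by blast
  have "link_edges G (?F v) = {tri_vs (tmap ?F t) - {?F v} |t. t \<in> Xtri G \<and> ?F v \<in> tri_vs (tmap ?F t)}"
  proof -
    have "link_edges G (?F v) = {tri_vs t - {?F v} |t. t \<in> tmap ?F ` Xtri G \<and> ?F v \<in> tri_vs t}"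
      unfolding link_edges_def Xtri_iso[OF p] ..
    then show ?thesis by blast
  qed
  also have "\<dots> = {?F ` (tri_vs t - {v}) |t. t \<in> Xtri G \<and> v \<in> tri_vs t}"
    using d m by blast
  also have "\<dots> = (`) ?F ` link_edges G v" unfolding link_edges_def by blast
  finally show ?thesis .
qed

lemma link_adj_iso:
  assumes p: "\<phi> \<in> iso G G" and v: "v \<in> carrier G \<times> UNIV"
    and e: "e \<in> link_edges G v" "f \<in> link_edges G v"
  shows "(xvmap \<phi> ` e, xvmap \<phi> ` f) \<in> link_adj G (xvmap \<phi> v) \<longleftrightarrow> (e, f) \<in> link_adj G v"
proof -
  have sub: "e \<subseteq> carrier G \<times> UNIV" "f \<subseteq> carrier G \<times> UNIV"
    using e tri_vs_carrier unfolding link_edges_def by blast+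
  have "xvmap \<phi> ` e \<inter> xvmap \<phi> ` f = xvmap \<phi> ` (e \<inter> f)"
    using inj_on_image_Int[OF xvmap_inj[OF p] sub] by simp
  moreover have "xvmap \<phi> ` e \<in> link_edges G (xvmap \<phi> v)" "xvmap \<phi> ` f \<in> link_edges G (xvmap \<phi> v)"
    using e link_edges_iso[OF p v] by auto
  ultimately show ?thesis using e unfolding link_adj_def by auto
qed

text \<open>Paths in a link are transported in both directions; going back uses that every link edge
  at the image vertex is itself an image.\<close>

lemma link_circle_iso:
  assumes p: "\<phi> \<in> iso G G" and v: "v \<in> carrier G \<times> UNIV" and e: "e \<in> link_edges G v"
  shows "link_circle G (xvmap \<phi> v) (xvmap \<phi> ` e) = (`) (xvmap \<phi>) ` link_circle G v e"
proof (intro equalityI subsetI)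
  let ?F = "(`) (xvmap \<phi>)"
  fix h assume "h \<in> link_circle G (xvmap \<phi> v) (?F e)"
  then have "(?F e, h) \<in> (link_adj G (xvmap \<phi> v))\<^sup>*" by (simp add: link_circle_def)
  then have "\<exists>f\<in>link_edges G v. h = ?F f \<and> (e, f) \<in> (link_adj G v)\<^sup>*"
  proof (induction rule: rtrancl_induct)
    case base
    then show ?case using e by blast
  next
    case (step h h')
    then obtain f where f: "f \<in> link_edges G v" "h = ?F f" "(e, f) \<in> (link_adj G v)\<^sup>*" by blast
    have "h' \<in> link_edges G (xvmap \<phi> v)" using step(2) by (simp add: link_adj_def)
    then obtain f' where f': "f' \<in> link_edges G v" "h' = ?F f'" using link_edges_iso[OF p v] by blast
    then have "(f, f') \<in> link_adj G v" using link_adj_iso[OF p v f(1) f'(1)] step(2) f(2) by simp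
    then have "(e, f') \<in> (link_adj G v)\<^sup>*" using f(3) by (rule rtrancl_into_rtrancl[rotated])
    then show ?case using f' by blast
  qed
  then show "h \<in> ?F ` link_circle G v e" by (auto simp: link_circle_def)
next
  let ?F = "(`) (xvmap \<phi>)"
  fix h assume "h \<in> ?F ` link_circle G v e"
  then obtain f where f: "f \<in> link_edges G v" "h = ?F f" "(e, f) \<in> (link_adj G v)\<^sup>*"
    by (auto simp: link_circle_def)
  have "(?F e, ?F f) \<in> (link_adj G (xvmap \<phi> v))\<^sup>*"
    using f(3)
  proof (induction rule: rtrancl_induct)
    case (step g g')
    then have "g \<in> link_edges G v" "g' \<in> link_edges G v" by (auto simp: link_adj_def)
    then have "(?F g, ?F g') \<in> link_adj G (xvmap \<phi> v)" using link_adj_iso[OF p v] step(2) by simp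
    then show ?case using step by (meson rtrancl.rtrancl_into_rtrancl)
  qed simp
  then show "h \<in> link_circle G (xvmap \<phi> v) (?F e)"
    using f link_edges_iso[OF p v] by (auto simp: link_circle_def)
qed

lemma ylift_iso:
  assumes p: "\<phi> \<in> iso G G" and t: "t \<in> Xtri G" "v \<in> tri_vs t"
  shows "yvmap \<phi> (ylift G v t) = ylift G (xvmap \<phi> v) (tmap (xvmap \<phi>) t)"
proof -
  have v: "v \<in> carrier G \<times> UNIV" using tri_vs_carrier t by blast
  have "tri_vs (tmap (xvmap \<phi>) t) - {xvmap \<phi> v} = xvmap \<phi> ` (tri_vs t - {v})"
    unfolding tri_vs_tmap
    using inj_on_image_set_diff[OF xvmap_inj[OF p], of "tri_vs t" "{v}"] tri_vs_carrier[OF t(1)] v by auto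
  then show ?thesis
    using link_circle_iso[OF p v link_edgeI[OF t]] by (simp add: ylift_def yvmap_def)
qed

lemma yt_iso:
  assumes p: "\<phi> \<in> iso G G" and n: "noncomm a b"
  shows "yvmap \<phi> (yt1 a b) = yt1 (\<phi> a) (\<phi> b)" "yvmap \<phi> (yt2 a b) = yt2 (\<phi> a) (\<phi> b)"
    "yvmap \<phi> (yt3 a b) = yt3 (\<phi> a) (\<phi> b)"
proof -
  have m: "\<phi> (a \<otimes> b) = \<phi> a \<otimes> \<phi> b"
    using p noncomm_carrier[OF n] by (auto simp: iso_def hom_mult)
  show "yvmap \<phi> (yt1 a b) = yt1 (\<phi> a) (\<phi> b)" "yvmap \<phi> (yt2 a b) = yt2 (\<phi> a) (\<phi> b)"
    "yvmap \<phi> (yt3 a b) = yt3 (\<phi> a) (\<phi> b)"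
    unfolding yt1_def yt2_def yt3_def
    by (simp_all add: ylift_iso[OF p xt_Xtri[OF n]] tri_vs_xt xt_iso[OF p n]) (simp_all add: xvmap_def m)
qed

lemma tmap_yt: "\<phi> \<in> iso G G \<Longrightarrow> noncomm a b \<Longrightarrow> tmap (yvmap \<phi>) (yt a b) = yt (\<phi> a) (\<phi> b)"
  by (simp add: yt_def tmap_def yt_iso)

lemma conjf_iso:
  assumes g: "g \<in> carrier G" shows "conjf G g \<in> iso G G"
proof -
  have hom: "conjf G h \<in> hom G G" if h: "h \<in> carrier G" for h
  proof (rule homI)
    fix a b assume ab: "a \<in> carrier G" "b \<in> carrier G"
    have "h \<otimes> a \<otimes> inv h \<otimes> (h \<otimes> b \<otimes> inv h) = h \<otimes> a \<otimes> (inv h \<otimes> h) \<otimes> b \<otimes> inv h"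
      using h ab by (simp only: m_assoc m_closed inv_closed)
    then show "conjf G h (a \<otimes> b) = conjf G h a \<otimes> conjf G h b"
      using h ab by (simp add: conjf_def m_assoc)
  qed (use h in \<open>simp add: conjf_def\<close>)
  have inv: "conjf G (inv h) (conjf G h a) = a" if "h \<in> carrier G" "a \<in> carrier G" for h a
  proof -
    have "inv h \<otimes> (h \<otimes> a \<otimes> inv h) \<otimes> inv (inv h) = (inv h \<otimes> h) \<otimes> a \<otimes> (inv h \<otimes> inv (inv h))"
      using that by (simp only: m_assoc m_closed inv_closed)
    then show ?thesis using that by (simp add: conjf_def)
  qed
  have "bij_betw (conjf G g) (carrier G) (carrier G)"
  proof (rule bij_betwI[where g = "conjf G (inv g)"])
    show "conjf G g \<in> carrier G \<rightarrow> carrier G" "conjf G (inv g) \<in> carrier G \<rightarrow> carrier G"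
      using g by (auto simp: conjf_def)
  qed (use inv[of g] inv[of "inv g"] g in auto)
  then show ?thesis using hom[OF g] by (simp add: iso_def)
qed

lemma auto_iso: "\<phi> \<in> auto G \<Longrightarrow> \<phi> \<in> iso G G"
  by (auto simp: auto_def iso_def Bij_def)

text \<open>The fibres of f are left cosets, whereas \<open>rcosets\<close> collects right cosets;
  both numbers are the quotient of the orders, so Lagrange's theorem replaces a bijection.\<close>

lemma card_rcosets_image:
  assumes H: "subgroup H G" and fin: "finite (carrier G)"
    and f: "\<And>g h. g \<in> carrier G \<Longrightarrow> h \<in> carrier G \<Longrightarrow> f g = f h \<longleftrightarrow> inv g \<otimes> h \<in> H"
  shows "card (rcosets H) = card (f ` carrier G)"
proof -
  note Hc = subgroup.mem_carrier[OF H]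
  have "card {h \<in> carrier G. f h = y} = card H" if y: "y \<in> f ` carrier G" for y
  proof -
    obtain g where g: "g \<in> carrier G" "y = f g" using y by blast
    have "{h \<in> carrier G. f h = y} = (\<lambda>h. g \<otimes> h) ` H"
    proof (intro equalityI subsetI)
      fix h assume "h \<in> {h \<in> carrier G. f h = y}"
      then have h: "h \<in> carrier G" "f g = f h" using g by auto
      then have "inv g \<otimes> h \<in> H" using f g by blast
      moreover have "h = g \<otimes> (inv g \<otimes> h)" using g h by (simp add: m_assoc[symmetric])
      ultimately show "h \<in> (\<lambda>h. g \<otimes> h) ` H" by blast
    next
      fix k assume "k \<in> (\<lambda>h. g \<otimes> h) ` H"
      then obtain h where h: "h \<in> H" "k = g \<otimes> h" by blast
      have "inv g \<otimes> k = h" using h g Hc by (simp add: m_assoc[symmetric])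
      then have "f g = f k" using f[of g k] g h Hc by simp
      then show "k \<in> {h \<in> carrier G. f h = y}" using g h Hc by simp
    qed
    moreover have "inj_on (\<lambda>h. g \<otimes> h) H" using g Hc by (auto intro!: inj_onI)
    ultimately show ?thesis by (simp add: card_image)
  qed
  then have "card (carrier G) = card (f ` carrier G) * card H"
    using sum.image_gen[OF fin, of "\<lambda>_. 1 :: nat" f] by simp
  moreover have "card (rcosets H) * card H = card (carrier G)"
    using lagrange[OF H] by (simp add: order_def)
  moreover have "card H > 0"
    using subgroup.one_closed[OF H] subgroup.subset[OF H] fin by (metis card_gt_0_iff empty_iff finite_subset)
  ultimately show ?thesis by simp
qed

text \<open>Orbit counting for the pair (x, y): f separates elements exactly as their effect on the
  pair does, so its values correspond to cosets of the common stabilizer.\<close>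

lemma card_rcosets_pair_stabilizer:
  assumes fin: "finite (carrier G)" and x: "x \<in> E" and y: "y \<in> E"
    and closed: "\<And>g z. g \<in> carrier G \<Longrightarrow> z \<in> E \<Longrightarrow> act g z \<in> E"
    and one: "\<And>z. z \<in> E \<Longrightarrow> act \<one> z = z"
    and mult: "\<And>g h z. g \<in> carrier G \<Longrightarrow> h \<in> carrier G \<Longrightarrow> z \<in> E \<Longrightarrow> act (g \<otimes> h) z = act g (act h z)"
    and H: "H = {g \<in> carrier G. act g x = x \<and> act g y = y}"
    and f: "\<And>g h. g \<in> carrier G \<Longrightarrow> h \<in> carrier G \<Longrightarrow> f g = f h \<longleftrightarrow> act g x = act h x \<and> act g y = act h y"
  shows "card (rcosets H) = card (f ` carrier G)"
proof (rule card_rcosets_image[OF _ fin])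
  have unact: "act (inv g) (act g z) = z" if "g \<in> carrier G" "z \<in> E" for g z
    using mult[of "inv g" g z] one that by simp
  have eq: "act (inv g \<otimes> h) z = z \<longleftrightarrow> act g z = act h z"
    if g: "g \<in> carrier G" and h: "h \<in> carrier G" and z: "z \<in> E" for g h z
  proof
    assume "act (inv g \<otimes> h) z = z"
    then have "act g (act (inv g) (act h z)) = act g z" using mult[of "inv g" h z] g h z by simp
    then show "act g z = act h z" using unact[of "inv g" "act h z"] g h z closed by simp
  next
    assume "act g z = act h z"
    then show "act (inv g \<otimes> h) z = z" using mult[of "inv g" h z] unact[OF g z] g h z by simp
  qed
  show "subgroup H G"
  proof (rule subgroupI)
    show "inv g \<in> H" if "g \<in> H" for g using that unact[of g x] unact[of g y] x y unfolding H by simp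
    show "g \<otimes> h \<in> H" if "g \<in> H" "h \<in> H" for g h
      using that mult[of g h x] mult[of g h y] x y unfolding H by simp
    show "H \<noteq> {}" using one x y unfolding H by blast
  qed (use H in auto)
  show "f g = f h \<longleftrightarrow> inv g \<otimes> h \<in> H" if "g \<in> carrier G" "h \<in> carrier G" for g h
    using f[OF that] eq[OF that x] eq[OF that y] that unfolding H by simp
qed

section \<open>Components and their stabilizers\<close>

lemma component_iff:
  assumes S: "S \<in> Y_components G" and s: "s \<in> S"
  shows "S = {t \<in> Ytri G. (s, t) \<in> (tri_adj (Ytri G))\<^sup>*}" "s \<in> Ytri G"
proof -
  let ?R = "tri_adj (Ytri G)"
  obtain r where r: "r \<in> Ytri G" "S = {t \<in> Ytri G. (r, t) \<in> ?R\<^sup>*}"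
    using S unfolding Y_components_def cx_components_def by blast
  then show "s \<in> Ytri G" using s by blast
  have rs: "(r, s) \<in> ?R\<^sup>*" using s r by blast
  have "sym ?R" by (auto simp: tri_adj_def sym_def)
  then have sr: "(s, r) \<in> ?R\<^sup>*" using symD[OF sym_rtrancl rs] by simp
  have "(r, t) \<in> ?R\<^sup>* \<longleftrightarrow> (s, t) \<in> ?R\<^sup>*" for t
    using rtrancl_trans[OF rs, of t] rtrancl_trans[OF sr, of t] by blast
  then show "S = {t \<in> Ytri G. (s, t) \<in> ?R\<^sup>*}" using r(2) by simp
qed

lemma component_closed:
  assumes S: "S \<in> Y_components G" and s: "s \<in> S" and t: "t \<in> Ytri G" "tri_vs s \<inter> tri_vs t \<noteq> {}"
  shows "t \<in> S"
proof -
  have "(s, t) \<in> tri_adj (Ytri G)" using component_iff(2)[OF S s] t by (simp add: tri_adj_def)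
  then show ?thesis using t(1) by (subst component_iff(1)[OF S s]) auto
qed

lemma component_induct:
  assumes S: "S \<in> Y_components G" and s: "s \<in> S" and t: "t \<in> S" and P: "P s"
    and step: "\<And>s t. s \<in> S \<Longrightarrow> t \<in> S \<Longrightarrow> tri_vs s \<inter> tri_vs t \<noteq> {} \<Longrightarrow> P s \<Longrightarrow> P t"
  shows "P t"
proof -
  have "(s, t) \<in> (tri_adj (Ytri G))\<^sup>*" using t by (subst (asm) component_iff(1)[OF S s]) blast
  then have "t \<in> S \<and> P t"
  proof (induction rule: rtrancl_induct)
    case base
    then show ?case using s P by blast
  next
    case (step u v)
    then have "v \<in> Ytri G" "tri_vs u \<inter> tri_vs v \<noteq> {}" by (auto simp: tri_adj_def)
    then show ?case using step.IH component_closed[OF S] assms(5) by blast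
  qed
  then show ?thesis by blast
qed

lemma finite_Ytri: "finite (carrier G) \<Longrightarrow> finite (Ytri G)"
proof -
  assume fin: "finite (carrier G)"
  have "Ytri G \<subseteq> (\<lambda>(a, b). yt a b) ` (carrier G \<times> carrier G)"
  proof
    fix t assume "t \<in> Ytri G"
    then obtain a b where ab: "noncomm a b" "t = yt a b" using Ytri_iff by blast
    then have "(a, b) \<in> carrier G \<times> carrier G" using noncomm_carrier by blast
    then show "t \<in> (\<lambda>(a, b). yt a b) ` (carrier G \<times> carrier G)"
      unfolding ab(2) by (metis (no_types, lifting) case_prod_conv imageI)
  qed
  then show ?thesis using fin finite_subset by blast
qed

lemma component_yt:
  assumes "S \<in> Y_components G" "t \<in> S"
  obtains a b where "noncomm a b" "t = yt a b"
  using component_iff(2)[OF assms] Ytri_iff by blast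

lemma noncomm_component: "S \<in> Y_components G \<Longrightarrow> yt a b \<in> S \<Longrightarrow> noncomm a b"
  using component_yt yt_inj by metis

lemma tri_vs_yt: "tri_vs (yt a b) = {yt1 a b, yt2 a b, yt3 a b}"
  by (simp add: tri_vs_def yt_def)

lemma component_nb:
  assumes S: "S \<in> Y_components G" and t: "yt a b \<in> S"
  shows "yt b a \<in> S" "yt (a \<otimes> b \<otimes> inv a) a \<in> S" "yt b (inv b \<otimes> a \<otimes> b) \<in> S"
proof -
  have n: "noncomm a b" using noncomm_component S t by blast
  have Y: "yt b a \<in> Ytri G" "yt (a \<otimes> b \<otimes> inv a) a \<in> Ytri G" "yt b (inv b \<otimes> a \<otimes> b) \<in> Ytri G"
    using n noncomm_sym noncomm_left noncomm_right Ytri_iff by blast+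
  show "yt b a \<in> S"
    by (rule component_closed[OF S t Y(1)]) (auto simp: tri_vs_yt yt_swap[OF n])
  show "yt (a \<otimes> b \<otimes> inv a) a \<in> S"
    by (rule component_closed[OF S t Y(2)]) (auto simp: tri_vs_yt yt_left[OF n])
  show "yt b (inv b \<otimes> a \<otimes> b) \<in> S"
    by (rule component_closed[OF S t Y(3)]) (auto simp: tri_vs_yt yt_right[OF n])
qed

lemma yt_vertex:
  assumes "v \<in> tri_vs (yt a b)"
  shows "v = ylift G (fst v) (xt a b)" "fst v \<in> tri_vs (xt a b)"
  using assms by (auto simp: tri_vs_yt tri_vs_xt yt1_def yt2_def yt3_def)

text \<open>Two triangles of the resolution sharing a vertex are joined by a chain in its link circle,
  so a component is swept out by crossing edges.\<close>

lemma component_pair_induct: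
  assumes S: "S \<in> Y_components G" and s: "yt a b \<in> S" and t: "yt c d \<in> S" and P: "P a b"
    and st: "\<And>a b. yt a b \<in> S \<Longrightarrow> P a b \<Longrightarrow> P b a"
      "\<And>a b. yt a b \<in> S \<Longrightarrow> P a b \<Longrightarrow> P (a \<otimes> b \<otimes> inv a) a"
      "\<And>a b. yt a b \<in> S \<Longrightarrow> P a b \<Longrightarrow> P b (inv b \<otimes> a \<otimes> b)"
  shows "P c d"
proof -
  let ?Q = "\<lambda>t. \<forall>a b. t = yt a b \<longrightarrow> P a b"
  have "?Q (yt c d)"
  proof (rule component_induct[OF S s t])
    show "?Q (yt a b)" using P yt_inj by blast
  next
    fix s t assume *: "s \<in> S" "t \<in> S" "tri_vs s \<inter> tri_vs t \<noteq> {}" "?Q s"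
    obtain a b c d where ab: "noncomm a b" "s = yt a b" and cd: "noncomm c d" "t = yt c d"
      using component_yt[OF S] *(1,2) by metis
    obtain v where v: "v \<in> tri_vs (yt a b)" "v \<in> tri_vs (yt c d)" using *(3) ab cd by blast
    have eq: "ylift G (fst v) (xt a b) = ylift G (fst v) (xt c d)"
      using yt_vertex(1)[OF v(1)] yt_vertex(1)[OF v(2)] by simp
    let ?P = "\<lambda>t. \<exists>a b. t = xt a b \<and> yt a b \<in> S \<and> P a b"
    have "?P (xt c d)"
    proof (rule ylift_path[OF eq])
      show "xt a b \<in> Xtri G" "xt c d \<in> Xtri G" using xt_Xtri ab cd by blast+
      show "fst v \<in> tri_vs (xt a b)" "fst v \<in> tri_vs (xt c d)" using yt_vertex(2) v by blast+
      show "?P (xt a b)" using ab *(1,4) by blast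
    next
      fix r r' w assume r: "r' \<in> Xtri G" "fst v \<in> tri_vs r" "fst v \<in> tri_vs r'"
        "w \<in> tri_vs r" "w \<in> tri_vs r'" "w \<noteq> fst v" "?P r"
      obtain a b where ab: "r = xt a b" "yt a b \<in> S" "P a b" using r(7) by blast
      obtain c d where cd: "noncomm c d" "r' = xt c d" using r(1) Xtri_iff by blast
      have "noncomm a b" using noncomm_component S ab(2) by blast
      then have "(c, d) = (a, b) \<or> (c, d) = (b, a) \<or> (c, d) = (a \<otimes> b \<otimes> inv a, a) \<or>
          (c, d) = (b, inv b \<otimes> a \<otimes> b)"
        using shared_edge[OF _ cd(1)] r(2-6) unfolding ab cd by blast
      then have "yt c d \<in> S \<and> P c d" using component_nb[OF S ab(2)] st[OF ab(2,3)] ab(2,3) by auto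
      then show "?P r'" using cd by blast
    qed
    then have "P c d" by (auto simp: xt_def)
    then show "?Q t" using cd yt_inj by blast
  qed
  then show ?thesis by blast
qed

lemma iso_hom: "\<phi> \<in> iso G G \<Longrightarrow> \<phi> \<in> hom G G"
  by (simp add: iso_def)

lemma iso_conj:
  assumes "\<phi> \<in> iso G G" "a \<in> carrier G" "b \<in> carrier G"
  shows "\<phi> (a \<otimes> b \<otimes> inv a) = \<phi> a \<otimes> \<phi> b \<otimes> inv (\<phi> a)"
    "\<phi> (inv b \<otimes> a \<otimes> b) = inv (\<phi> b) \<otimes> \<phi> a \<otimes> \<phi> b"
proof -
  interpret group_hom G G \<phi> using iso_hom[OF assms(1)] by unfold_locales
  show "\<phi> (a \<otimes> b \<otimes> inv a) = \<phi> a \<otimes> \<phi> b \<otimes> inv (\<phi> a)"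
    "\<phi> (inv b \<otimes> a \<otimes> b) = inv (\<phi> b) \<otimes> \<phi> a \<otimes> \<phi> b"
    using assms by simp_all
qed

text \<open>Isomorphisms commute with the three edge crossings, which are words in a and b, so one
  triangle mapped into S drags the whole component along. Finiteness turns the injective map of S
  into itself into a bijection.\<close>

lemma stabI:
  assumes fin: "finite (carrier G)" and S: "S \<in> Y_components G" and p: "\<phi> \<in> iso G G"
    and t: "yt a b \<in> S" "yt (\<phi> a) (\<phi> b) \<in> S"
  shows "tmap (yvmap \<phi>) ` S = S"
proof (rule endo_inj_surj)
  have "S \<subseteq> Ytri G" using component_iff(2)[OF S] by blast
  then show "finite S" using finite_Ytri[OF fin] finite_subset by blast
  show "tmap (yvmap \<phi>) ` S \<subseteq> S"
  proof
    fix u assume "u \<in> tmap (yvmap \<phi>) ` S"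
    then obtain s where s: "s \<in> S" "u = tmap (yvmap \<phi>) s" by blast
    obtain c d where cd: "noncomm c d" "s = yt c d" using component_yt[OF S s(1)] by blast
    have "yt (\<phi> c) (\<phi> d) \<in> S"
    proof (rule component_pair_induct[OF S t(1), where P = "\<lambda>c d. yt (\<phi> c) (\<phi> d) \<in> S"])
      show "yt c d \<in> S" using s cd by simp
    next
      fix a b assume ab: "yt a b \<in> S" "yt (\<phi> a) (\<phi> b) \<in> S"
      have c: "a \<in> carrier G" "b \<in> carrier G"
        using noncomm_component[OF S ab(1)] noncomm_carrier by blast+
      show "yt (\<phi> b) (\<phi> a) \<in> S" "yt (\<phi> (a \<otimes> b \<otimes> inv a)) (\<phi> a) \<in> S"
        "yt (\<phi> b) (\<phi> (inv b \<otimes> a \<otimes> b)) \<in> S"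
        unfolding iso_conj[OF p c] using component_nb[OF S ab(2)] by blast+
    qed (rule t(2))
    then show "u \<in> S" using s cd tmap_yt[OF p cd(1)] by simp
  qed
  show "inj_on (tmap (yvmap \<phi>)) S"
  proof (rule inj_onI)
    fix s t assume st: "s \<in> S" "t \<in> S" "tmap (yvmap \<phi>) s = tmap (yvmap \<phi>) t"
    obtain a b where ab: "noncomm a b" "s = yt a b" using component_yt[OF S st(1)] by blast
    obtain c d where cd: "noncomm c d" "t = yt c d" using component_yt[OF S st(2)] by blast
    have "\<phi> a = \<phi> c \<and> \<phi> b = \<phi> d"
      using st(3) yt_inj unfolding ab cd tmap_yt[OF p ab(1)] tmap_yt[OF p cd(1)] by blast
    moreover have "inj_on \<phi> (carrier G)" using p by (simp add: iso_def bij_betw_def)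
    ultimately have "a = c \<and> b = d"
      using noncomm_carrier[OF ab(1)] noncomm_carrier[OF cd(1)] by (auto dest: inj_onD)
    then show "s = t" using ab cd by simp
  qed
qed

lemma conjf_mult:
  "g \<in> carrier G \<Longrightarrow> h \<in> carrier G \<Longrightarrow> a \<in> carrier G \<Longrightarrow> conjf G g (conjf G h a) = conjf G (g \<otimes> h) a"
  by (simp add: conjf_def inv_mult_group m_assoc)

lemma conjf_one: "a \<in> carrier G \<Longrightarrow> conjf G \<one> a = a"
  by (simp add: conjf_def)

lemma conjf_closed: "g \<in> carrier G \<Longrightarrow> a \<in> carrier G \<Longrightarrow> conjf G g a \<in> carrier G"
  by (simp add: conjf_def)

lemma subgroup_ConjStab:
  assumes fin: "finite (carrier G)" and S: "S \<in> Y_components G" and ne: "S \<noteq> {}"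
  shows "subgroup (ConjStab G S) G"
proof (rule subgroupI)
  obtain a b where t: "yt a b \<in> S" using ne component_yt[OF S] by blast
  have c: "a \<in> carrier G" "b \<in> carrier G" using noncomm_component[OF S t] noncomm_carrier by blast+
  have step: "yt (conjf G g a) (conjf G g b) \<in> S \<and> noncomm a b"
    if "g \<in> ConjStab G S" "yt a b \<in> S" for g a b
  proof -
    have n: "noncomm a b" using noncomm_component S that(2) by blast
    have "tmap (yvmap (conjf G g)) (yt a b) \<in> S" "g \<in> carrier G" using that by (auto simp: ConjStab_def)
    then show ?thesis using tmap_yt[OF conjf_iso n, of g] n by simp
  qed
  show "ConjStab G S \<subseteq> carrier G" by (auto simp: ConjStab_def)
  have "tmap (yvmap (conjf G \<one>)) ` S = S"
    by (rule stabI[OF fin S conjf_iso t]) (use t c conjf_one in auto)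
  then show "ConjStab G S \<noteq> {}" unfolding ConjStab_def by blast
  fix g assume g: "g \<in> ConjStab G S"
  then have gc: "g \<in> carrier G" by (simp add: ConjStab_def)
  show "inv g \<in> ConjStab G S"
  proof -
    have "yt a b \<in> tmap (yvmap (conjf G g)) ` S" using g t by (simp add: ConjStab_def)
    then obtain s where s: "s \<in> S" "yt a b = tmap (yvmap (conjf G g)) s" by blast
    obtain c d where cd: "noncomm c d" "s = yt c d" using component_yt[OF S s(1)] by blast
    have e: "a = conjf G g c" "b = conjf G g d"
      using yt_inj s(2) unfolding cd tmap_yt[OF conjf_iso[OF gc] cd(1)] by blast+
    have "conjf G (inv g) a = c" "conjf G (inv g) b = d"
      using conjf_mult[of "inv g" g] gc noncomm_carrier[OF cd(1)] conjf_one unfolding e by simp_all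
    then have "tmap (yvmap (conjf G (inv g))) ` S = S"
      using s(1) cd gc by (intro stabI[OF fin S conjf_iso t]) auto
    then show ?thesis using gc by (simp add: ConjStab_def)
  qed
  fix h assume h: "h \<in> ConjStab G S"
  then have hc: "h \<in> carrier G" by (simp add: ConjStab_def)
  have "yt (conjf G g (conjf G h a)) (conjf G g (conjf G h b)) \<in> S"
    using step[OF g] step[OF h t] by blast
  then have "yt (conjf G (g \<otimes> h) a) (conjf G (g \<otimes> h) b) \<in> S" using conjf_mult gc hc c by simp
  then have "tmap (yvmap (conjf G (g \<otimes> h))) ` S = S"
    using gc hc by (intro stabI[OF fin S conjf_iso t]) auto
  then show "g \<otimes> h \<in> ConjStab G S" using gc hc by (simp add: ConjStab_def)
qed

text \<open>Conjugation by a turns (a, b) into (a, a b a^-1), which is reached from (a, b) by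
  crossing two edges at (a, 1).\<close>

lemma vertex_in_ConjStab:
  assumes fin: "finite (carrier G)" and S: "S \<in> Y_components G" and t: "yt a b \<in> S"
  shows "a \<in> ConjStab G S"
proof -
  have c: "a \<in> carrier G" "b \<in> carrier G" using noncomm_component[OF S t] noncomm_carrier by blast+
  have "yt a (a \<otimes> b \<otimes> inv a) \<in> S" using component_nb[OF S] t by blast
  moreover have "conjf G a a = a" "conjf G a b = a \<otimes> b \<otimes> inv a" using c by (simp_all add: conjf_def m_assoc)
  ultimately have "tmap (yvmap (conjf G a)) ` S = S"
    using c by (intro stabI[OF fin S conjf_iso t]) auto
  then show ?thesis using c by (simp add: ConjStab_def)
qed

text \<open>The lifted vertices lie over a, b and a b, and any two of these determine the pair by
  cancellation; this gives the \<open>uniq\<close> clauses.\<close>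

lemma component_tri_surface:
  assumes fin: "finite (carrier G)" and S: "S \<in> Y_components G"
  shows "tri_surface S"
proof
  have "S \<subseteq> Ytri G" using component_iff(2)[OF S] by blast
  then show "finite S" using finite_Ytri[OF fin] finite_subset by blast
  have E: "\<exists>p q. noncomm p q \<and> yt p q \<in> S \<and> a = yt1 p q \<and> b = yt2 p q \<and> c = yt3 p q"
    if t: "(a, b, c) \<in> S" for a b c
  proof -
    obtain p q where "noncomm p q" "(a, b, c) = yt p q" using component_yt[OF S t] .
    then show ?thesis using t by (auto simp: yt_def)
  qed
  fix a b c assume "(a, b, c) \<in> S"
  then obtain p q where p: "noncomm p q" "yt p q \<in> S" "a = yt1 p q" "b = yt2 p q" "c = yt3 p q"
    using E by blast
  note pc = noncomm_carrier[OF p(1)]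
  show "a \<noteq> b"
  proof
    assume "a = b"
    then have "fst a = fst b" by simp
    then show False using noncomm_ne[OF p(1)] p by simp
  qed
  show "\<exists>c'. (b, a, c') \<in> S"
    using component_nb(1)[OF S p(2)] unfolding p yt_def yt_swap[OF p(1)] by blast
  show "\<exists>b'. (b', a, c) \<in> S"
    using component_nb(2)[OF S p(2)] unfolding p yt_def yt_left[OF p(1)] by blast
  show "\<exists>a'. (b, a', c) \<in> S"
    using component_nb(3)[OF S p(2)] unfolding p yt_def yt_right[OF p(1)] by blast
  \<comment> \<open>The mirror image has product q p but the same centre, contradicting p q \<noteq>
    q p.\<close>
  show "(b, a, c) \<notin> S"
  proof
    assume "(b, a, c) \<in> S"
    then obtain r s where r: "b = yt1 r s" "a = yt2 r s" "c = yt3 r s" using E by blast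
    then have "fst b = fst (yt1 r s)" "fst a = fst (yt2 r s)" "fst c = fst (yt3 r s)" by simp_all
    then have "p \<otimes> q = q \<otimes> p" using p by simp
    then show False using p(1) by (simp add: noncomm_def)
  qed
  show "c = c'" if u: "(a, b, c') \<in> S" for c'
  proof -
    obtain r s where r: "a = yt1 r s" "b = yt2 r s" "c' = yt3 r s" using E[OF u] by blast
    then have "fst a = fst (yt1 r s)" "fst b = fst (yt2 r s)" by simp_all
    then have "r = p" "s = q" using p by simp_all
    then show ?thesis using r p by simp
  qed
  show "b = b'" if u: "(a, b', c) \<in> S" for b'
  proof -
    obtain r s where r: "noncomm r s" "a = yt1 r s" "b' = yt2 r s" "c = yt3 r s" using E[OF u] by blast
    then have "fst a = fst (yt1 r s)" "fst c = fst (yt3 r s)" by simp_all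
    then have "r = p" "r \<otimes> s = p \<otimes> q" using p by simp_all
    then have "r = p" "s = q" using pc noncomm_carrier[OF r(1)] by auto
    then show ?thesis using r p by simp
  qed
  show "a = a'" if u: "(a', b, c) \<in> S" for a'
  proof -
    obtain r s where r: "noncomm r s" "a' = yt1 r s" "b = yt2 r s" "c = yt3 r s" using E[OF u] by blast
    then have "fst b = fst (yt2 r s)" "fst c = fst (yt3 r s)" by simp_all
    then have "s = q" "r \<otimes> s = p \<otimes> q" using p by simp_all
    then have "r = p" "s = q" using pc noncomm_carrier[OF r(1)] by auto
    then show ?thesis using r p by simp
  qed
  show "c \<noteq> a' \<and> c \<noteq> b'" if u: "(a', b', c') \<in> S" for a' b' c'
  proof -
    obtain r s where r: "a' = yt1 r s" "b' = yt2 r s" using E[OF u] by blast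
    then have "snd (fst a') = 1" "snd (fst b') = 1" "snd (fst c) = 2" using p by simp_all
    then show ?thesis by auto
  qed
next
  fix t R
  assume t: "t \<in> S" "t \<in> R"
    and 0: "\<And>a b c c'. (a, b, c) \<in> S \<Longrightarrow> (a, b, c) \<in> R \<Longrightarrow> (b, a, c') \<in> S \<Longrightarrow> (b, a, c') \<in> R"
    and 1: "\<And>a b c b'. (a, b, c) \<in> S \<Longrightarrow> (a, b, c) \<in> R \<Longrightarrow> (b', a, c) \<in> S \<Longrightarrow> (b', a, c) \<in> R"
    and 2: "\<And>a b c a'. (a, b, c) \<in> S \<Longrightarrow> (a, b, c) \<in> R \<Longrightarrow> (b, a', c) \<in> S \<Longrightarrow> (b, a', c) \<in> R"
  obtain p q where p: "noncomm p q" "t = yt p q" using component_yt[OF S t(1)] .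
  show "S \<subseteq> R"
  proof
    fix u assume u: "u \<in> S"
    obtain r s where r: "noncomm r s" "u = yt r s" using component_yt[OF S u] .
    have "yt r s \<in> R"
    proof (rule component_pair_induct[OF S _ _, where P = "\<lambda>r s. yt r s \<in> R"])
      show "yt p q \<in> S" "yt r s \<in> S" "yt p q \<in> R" using t p u r by simp_all
    next
      fix a b assume ab: "yt a b \<in> S" "yt a b \<in> R"
      have n: "noncomm a b" using noncomm_component[OF S ab(1)] .
      note nb = component_nb[OF S ab(1)]
      show "yt b a \<in> R"
        using 0 ab nb(1) unfolding yt_def yt_swap[OF n] by blast
      show "yt (a \<otimes> b \<otimes> inv a) a \<in> R"
        using 1 ab nb(2) unfolding yt_def yt_left[OF n] by blast
      show "yt b (inv b \<otimes> a \<otimes> b) \<in> R"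
        using 2 ab nb(3) unfolding yt_def yt_right[OF n] by blast
    qed
    then show "u \<in> R" using r by simp
  qed
qed

end

section \<open>Symmetry groups of a component\<close>

context group
begin

lemma stab_comp:
  assumes fin: "finite (carrier G)" and S: "S \<in> Y_components G" "S \<noteq> {}"
    and p: "\<phi> \<in> iso G G" "tmap (yvmap \<phi>) ` S = S" and q: "\<psi> \<in> iso G G" "tmap (yvmap \<psi>) ` S = S"
    and r: "\<theta> \<in> iso G G" "\<And>g. g \<in> carrier G \<Longrightarrow> \<theta> g = \<phi> (\<psi> g)"
  shows "tmap (yvmap \<theta>) ` S = S"
proof -
  obtain a b where t: "yt a b \<in> S" using S component_yt[OF S(1)] by blast
  then have n: "noncomm a b" using noncomm_component S by blast
  have "yt (\<psi> a) (\<psi> b) \<in> S" using tmap_yt[OF q(1) n] q(2) t by (metis imageI)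
  then have "yt (\<phi> (\<psi> a)) (\<phi> (\<psi> b)) \<in> S"
    using tmap_yt[OF p(1) iso_noncomm[OF q(1) n]] p(2) by (metis imageI)
  then have "yt (\<theta> a) (\<theta> b) \<in> S" using r(2) noncomm_carrier[OF n] by simp
  then show ?thesis by (rule stabI[OF fin S(1) r(1) t])
qed

lemma stab_inv:
  assumes fin: "finite (carrier G)" and S: "S \<in> Y_components G" "S \<noteq> {}"
    and p: "\<phi> \<in> iso G G" "tmap (yvmap \<phi>) ` S = S"
    and q: "\<psi> \<in> iso G G" "\<And>g. g \<in> carrier G \<Longrightarrow> \<psi> (\<phi> g) = g"
  shows "tmap (yvmap \<psi>) ` S = S"
proof -
  obtain c d where t: "yt c d \<in> S" using S component_yt[OF S(1)] by blast
  then have n: "noncomm c d" using noncomm_component S by blast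
  have "yt (\<phi> c) (\<phi> d) \<in> S" using tmap_yt[OF p(1) n] p(2) t by (metis imageI)
  moreover have "yt (\<psi> (\<phi> c)) (\<psi> (\<phi> d)) \<in> S" using q(2) noncomm_carrier[OF n] t by simp
  ultimately show ?thesis by (rule stabI[OF fin S(1) q(1)])
qed

lemma auto_mult:
  "\<phi> \<in> auto G \<Longrightarrow> \<psi> \<in> auto G \<Longrightarrow> \<phi> \<otimes>\<^bsub>AutoGroup G\<^esub> \<psi> = compose (carrier G) \<phi> \<psi>"
  by (simp add: AutoGroup_def BijGroup_def auto_def)

lemma auto_one: "\<one>\<^bsub>AutoGroup G\<^esub> = (\<lambda>g\<in>carrier G. g)"
  by (simp add: AutoGroup_def BijGroup_def)

lemma carrier_AutoGroup: "carrier (AutoGroup G) = auto G"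
  by (simp add: AutoGroup_def)

lemma finite_auto: "finite (carrier G) \<Longrightarrow> finite (auto G)"
proof -
  assume fin: "finite (carrier G)"
  have "auto G \<subseteq> carrier G \<rightarrow>\<^sub>E carrier G"
    by (auto simp: auto_def Bij_def bij_betw_def PiE_def)
  then show ?thesis using finite_PiE[of "carrier G" "\<lambda>_. carrier G"] fin finite_subset by blast
qed

lemma auto_inv:
  assumes "\<phi> \<in> auto G"
  shows "inv\<^bsub>AutoGroup G\<^esub> \<phi> \<in> auto G" "g \<in> carrier G \<Longrightarrow> (inv\<^bsub>AutoGroup G\<^esub> \<phi>) (\<phi> g) = g"
proof -
  interpret AG: group "AutoGroup G" by (rule AutoGroup)
  have p: "\<phi> \<in> carrier (AutoGroup G)" using assms carrier_AutoGroup by simp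
  show i: "inv\<^bsub>AutoGroup G\<^esub> \<phi> \<in> auto G" using AG.inv_closed[OF p] carrier_AutoGroup by simp
  have "compose (carrier G) (inv\<^bsub>AutoGroup G\<^esub> \<phi>) \<phi> = (\<lambda>g\<in>carrier G. g)"
    using AG.l_inv[OF p] auto_mult[OF i assms] auto_one by simp
  then show "(inv\<^bsub>AutoGroup G\<^esub> \<phi>) (\<phi> g) = g" if "g \<in> carrier G"
    using that by (metis compose_eq restrict_apply')
qed

lemma subgroup_AutStab:
  assumes fin: "finite (carrier G)" and S: "S \<in> Y_components G" "S \<noteq> {}"
  shows "subgroup (AutStab G S) (AutoGroup G)"
proof (rule group.subgroupI[OF AutoGroup])
  show "AutStab G S \<subseteq> carrier (AutoGroup G)" by (auto simp: carrier_AutoGroup AutStab_def)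
  obtain a b where t: "yt a b \<in> S" using S component_yt[OF S(1)] by blast
  have "tmap (yvmap (\<lambda>g\<in>carrier G. g)) ` S = S"
    using noncomm_carrier[OF noncomm_component[OF S(1) t]] t
    by (intro stabI[OF fin S(1) auto_iso[OF id_in_auto] t]) simp
  then have "(\<lambda>g\<in>carrier G. g) \<in> AutStab G S" using id_in_auto by (simp add: AutStab_def)
  then show "AutStab G S \<noteq> {}" by blast
next
  fix \<phi> assume p: "\<phi> \<in> AutStab G S"
  then have a: "\<phi> \<in> auto G" "tmap (yvmap \<phi>) ` S = S" by (simp_all add: AutStab_def)
  show "inv\<^bsub>AutoGroup G\<^esub> \<phi> \<in> AutStab G S"
    using stab_inv[OF fin S auto_iso[OF a(1)] a(2) auto_iso[OF auto_inv(1)[OF a(1)]] auto_inv(2)[OF a(1)]]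
      auto_inv(1)[OF a(1)] by (simp add: AutStab_def)
  fix \<psi> assume "\<psi> \<in> AutStab G S"
  then have b: "\<psi> \<in> auto G" "tmap (yvmap \<psi>) ` S = S" by (simp_all add: AutStab_def)
  have c: "\<phi> \<otimes>\<^bsub>AutoGroup G\<^esub> \<psi> \<in> auto G"
    using monoid.m_closed[OF group.is_monoid[OF AutoGroup]] a b carrier_AutoGroup by simp
  have "tmap (yvmap (\<phi> \<otimes>\<^bsub>AutoGroup G\<^esub> \<psi>)) ` S = S"
    by (rule stab_comp[OF fin S auto_iso[OF a(1)] a(2) auto_iso[OF b(1)] b(2) auto_iso[OF c]])
      (simp add: auto_mult[OF a(1) b(1)] compose_def)
  then show "\<phi> \<otimes>\<^bsub>AutoGroup G\<^esub> \<psi> \<in> AutStab G S" using c by (simp add: AutStab_def)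
qed

end

text \<open>\<open>F_conj\<close> supplies the rotations about type 1 vertices; it is stated up to
  agreement on the carrier, since a conjugation has to be restricted to become an element of
  \<open>auto\<close>.\<close>

locale symmetry_family = group G for G (structure) +
  fixes S :: "'a yvert tri set" and Fm :: "('a \<Rightarrow> 'a) set" and x y :: 'a
  assumes fin: "finite (carrier G)" and comp: "S \<in> Y_components G" and xy: "yt x y \<in> S"
    and F_iso: "\<phi> \<in> Fm \<Longrightarrow> \<phi> \<in> iso G G"
    and F_stab: "\<phi> \<in> Fm \<Longrightarrow> tmap (yvmap \<phi>) ` S = S"
    and F_one: "\<exists>\<iota>\<in>Fm. \<forall>g\<in>carrier G. \<iota> g = g"
    and F_comp: "\<phi> \<in> Fm \<Longrightarrow> \<psi> \<in> Fm \<Longrightarrow> \<exists>\<theta>\<in>Fm. \<forall>g\<in>carrier G. \<theta> g = \<phi> (\<psi> g)"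
    and F_inv: "\<phi> \<in> Fm \<Longrightarrow> \<exists>\<psi>\<in>Fm. \<forall>g\<in>carrier G. \<psi> (\<phi> g) = g"
    and F_conj: "g \<in> ConjStab G S \<Longrightarrow> \<exists>\<phi>\<in>Fm. \<forall>h\<in>carrier G. \<phi> h = conjf G g h"
begin

sublocale tri_surface S by (rule component_tri_surface[OF fin comp])

definition vmap :: "('a \<Rightarrow> 'a) \<Rightarrow> 'a yvert \<Rightarrow> 'a yvert" where
  "vmap \<phi> = restrict (yvmap \<phi>) (verts S)"

lemma yt_verts: "yt a b \<in> S \<Longrightarrow> yt1 a b \<in> verts S \<and> yt2 a b \<in> verts S \<and> yt3 a b \<in> verts S"
  using in_verts by (simp add: yt_def)

lemma vmap_yt:
  assumes "\<phi> \<in> Fm" "yt a b \<in> S"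
  shows "vmap \<phi> (yt1 a b) = yt1 (\<phi> a) (\<phi> b)" "vmap \<phi> (yt2 a b) = yt2 (\<phi> a) (\<phi> b)"
    "vmap \<phi> (yt3 a b) = yt3 (\<phi> a) (\<phi> b)"
  using yt_iso[OF F_iso[OF assms(1)] noncomm_component[OF comp assms(2)]] yt_verts[OF assms(2)]
  by (simp_all add: vmap_def)

lemma F_yt:
  assumes "\<phi> \<in> Fm" "yt a b \<in> S" shows "yt (\<phi> a) (\<phi> b) \<in> S"
  using tmap_yt[OF F_iso[OF assms(1)] noncomm_component[OF comp assms(2)]] F_stab[OF assms(1)] assms(2)
  by (metis imageI)

lemma verts_yt:
  assumes "v \<in> verts S"
  obtains a b where "yt a b \<in> S" "a \<in> carrier G" "b \<in> carrier G" "v = yt1 a b \<or> v = yt2 a b \<or> v = yt3 a b"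
proof -
  obtain t where t: "t \<in> S" "v \<in> tri_vs t" using assms unfolding verts_def by blast
  obtain a b where "noncomm a b" "t = yt a b" using component_yt[OF comp t(1)] .
  then show thesis using that t noncomm_carrier by (auto simp: tri_vs_yt)
qed

lemma S_yt:
  assumes "(u, v, w) \<in> S"
  obtains a b where "yt a b \<in> S" "noncomm a b" "u = yt1 a b" "v = yt2 a b" "w = yt3 a b"
proof -
  obtain a b where "noncomm a b" "(u, v, w) = yt a b" using component_yt[OF comp assms] .
  then show thesis using that assms by (simp add: yt_def)
qed

lemma vmap_stab:
  assumes "\<phi> \<in> Fm" shows "tmap (vmap \<phi>) ` S = S"
proof -
  have "tmap (vmap \<phi>) t = tmap (yvmap \<phi>) t" if "t \<in> S" for t
    using in_verts that by (cases t) (simp add: tmap_def vmap_def)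
  then show ?thesis using F_stab[OF assms] by simp
qed

lemma vmap_tri_aut:
  assumes p: "\<phi> \<in> Fm" shows "vmap \<phi> \<in> tri_auts"
proof -
  have "vmap \<phi> ` verts S = (\<Union>t\<in>S. tri_vs (tmap (vmap \<phi>) t))"
    unfolding verts_def by (auto simp: tri_vs_tmap)
  also have "\<dots> = \<Union> (tri_vs ` (tmap (vmap \<phi>) ` S))" by blast
  also have "\<dots> = verts S" unfolding vmap_stab[OF p] verts_def ..
  finally have im: "vmap \<phi> ` verts S = verts S" .
  then have "inj_on (vmap \<phi>) (verts S)" using finite_verts by (simp add: eq_card_imp_inj_on)
  then show ?thesis
    using im vmap_stab[OF p] by (simp add: tri_auts_def bij_betw_def) (simp add: vmap_def)
qed

text \<open>Equal lifts put both triangles on one link circle of (a, 1). Along it, each crossing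
  either exchanges the order of the pair or conjugates the partner of a by a or its inverse, and
  these conjugations fix a and stabilize S.\<close>

lemma star:
  assumes t: "yt a b \<in> S" "yt a b' \<in> S" and eq: "yt1 a b = yt1 a b'"
  shows "\<exists>\<phi>\<in>Fm. \<phi> a = a \<and> \<phi> b = b'"
proof -
  have n: "noncomm a b" "noncomm a b'" using noncomm_component comp t by blast+
  have c: "a \<in> carrier G" "b \<in> carrier G" using noncomm_carrier[OF n(1)] by auto
  \<comment> \<open>The position of a alternates along the circle, hence both orders; the partner
    stays an image of b under a map that fixes a.\<close>
  let ?P = "\<lambda>t. \<exists>\<phi>\<in>Fm. \<phi> a = a \<and> (t = xt a (\<phi> b) \<or> t = xt (\<phi> b) a)"
  have turn: "\<exists>\<psi>\<in>Fm. \<psi> a = a \<and> \<psi> b = conjf G g (\<phi> b)"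
    if ph: "\<phi> \<in> Fm" "\<phi> a = a" "g = a \<or> g = inv a" for \<phi> g
  proof -
    have "a \<in> ConjStab G S" using vertex_in_ConjStab[OF fin comp t(1)] .
    then have g: "g \<in> ConjStab G S" "g \<in> carrier G"
      using ph(3) subgroup.m_inv_closed[OF subgroup_ConjStab[OF fin comp]] t c by auto
    obtain \<kappa> where k: "\<kappa> \<in> Fm" "\<forall>h\<in>carrier G. \<kappa> h = conjf G g h" using F_conj[OF g(1)] by blast
    obtain \<psi> where p: "\<psi> \<in> Fm" "\<forall>h\<in>carrier G. \<psi> h = \<kappa> (\<phi> h)" using F_comp[OF k(1) ph(1)] by blast
    have "\<phi> b \<in> carrier G" using hom_in_carrier[OF iso_hom[OF F_iso[OF ph(1)]] c(2)] .
    moreover have "conjf G g a = a" using ph(3) c by (auto simp: conjf_def m_assoc)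
    ultimately have "\<psi> a = a" "\<psi> b = conjf G g (\<phi> b)" using p k c ph(2) by simp_all
    then show ?thesis using p(1) by blast
  qed
  have "?P (xt a b')"
  proof (rule ylift_path)
    show "ylift G (a, 1) (xt a b) = ylift G (a, 1) (xt a b')" using eq by (simp add: yt1_def)
    show "xt a b \<in> Xtri G" "xt a b' \<in> Xtri G" using n xt_Xtri by auto
    show "(a, 1) \<in> tri_vs (xt a b)" "(a, 1) \<in> tri_vs (xt a b')" by (simp_all add: tri_vs_xt)
    show "?P (xt a b)" using F_one c by metis
  next
    fix s s' w assume s: "s' \<in> Xtri G" "(a, 1) \<in> tri_vs s" "(a, 1) \<in> tri_vs s'"
        "w \<in> tri_vs s" "w \<in> tri_vs s'" "w \<noteq> (a, 1)" "?P s"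
    obtain \<phi> where p: "\<phi> \<in> Fm" "\<phi> a = a" "s = xt a (\<phi> b) \<or> s = xt (\<phi> b) a" using s(7) by blast
    obtain p q where pq: "noncomm p q" "s' = xt p q" using s(1) Xtri_iff by blast
    have nb: "noncomm a (\<phi> b)" using iso_noncomm[OF F_iso[OF p(1)] n(1)] p(2) by simp
    have ap: "p = a \<or> q = a" using s(3) unfolding pq(2) tri_vs_xt by auto
    note nc = noncomm_carrier[OF nb]
    show "?P s'"
      using p(3)
    proof
      assume e: "s = xt a (\<phi> b)"
      have "(p, q) = (a, \<phi> b) \<or> (p, q) = (\<phi> b, a) \<or> (p, q) = (a \<otimes> \<phi> b \<otimes> inv a, a) \<or>
          (p, q) = (\<phi> b, inv (\<phi> b) \<otimes> a \<otimes> \<phi> b)"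
        using shared_edge[OF nb pq(1)] s(2-6) unfolding e pq(2) by blast
      then consider "p = a" "q = \<phi> b" | "p = \<phi> b" "q = a" | "p = a \<otimes> \<phi> b \<otimes> inv a" "q = a"
        | "p = \<phi> b" "q = inv (\<phi> b) \<otimes> a \<otimes> \<phi> b" by blast
      then show ?thesis
      proof cases
        case 3
        then show ?thesis using turn[OF p(1,2), of a] unfolding pq(2) conjf_def by metis
      next
        case 4
        \<comment> \<open>This neighbour lies across the edge opposite to a but has to contain (a,
          1), and p = \<phi> b differs from a.\<close>
        then have "q = a" using ap noncomm_ne[OF nb] by auto
        then show ?thesis using p 4 pq by blast
      qed (use p pq in blast)+
    next
      assume e: "s = xt (\<phi> b) a"
      have "(p, q) = (\<phi> b, a) \<or> (p, q) = (a, \<phi> b) \<or> (p, q) = (\<phi> b \<otimes> a \<otimes> inv (\<phi> b), \<phi> b) \<or>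
          (p, q) = (a, inv a \<otimes> \<phi> b \<otimes> a)"
        using shared_edge[OF noncomm_sym[OF nb] pq(1)] s(2-6) unfolding e pq(2) by blast
      then consider "p = a" "q = \<phi> b" | "p = \<phi> b" "q = a" | "p = \<phi> b \<otimes> a \<otimes> inv (\<phi> b)" "q = \<phi> b"
        | "p = a" "q = inv a \<otimes> \<phi> b \<otimes> a" by blast
      then show ?thesis
      proof cases
        case 3
        then have "p = a" using ap noncomm_ne[OF nb] by auto
        then show ?thesis using p 3 pq by blast
      next
        case 4
        have "conjf G (inv a) (\<phi> b) = inv a \<otimes> \<phi> b \<otimes> a" using nc by (simp add: conjf_def)
        then show ?thesis using turn[OF p(1,2), of "inv a"] 4 unfolding pq(2) by metis
      qed (use p pq in blast)+
    qed
  qed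
  then obtain \<phi> where p: "\<phi> \<in> Fm" "\<phi> a = a" "xt a b' = xt a (\<phi> b) \<or> xt a b' = xt (\<phi> b) a" by blast
  \<comment> \<open>The reversed form would force b' = a, against noncommutation.\<close>
  then have "b' = \<phi> b" using noncomm_ne[OF n(2)] by (auto simp: xt_def)
  then show ?thesis using p by blast
qed

sublocale surface_action S "vmap ` Fm" "yt1 x y" "yt2 x y" "yt3 x y" "yt3 y x"
proof
  show "vmap ` Fm \<subseteq> tri_auts" using vmap_tri_aut by blast
  show "(\<lambda>v\<in>verts S. v) \<in> vmap ` Fm"
  proof -
    obtain \<iota> where i: "\<iota> \<in> Fm" "\<forall>g\<in>carrier G. \<iota> g = g" using F_one by blast
    have "vmap \<iota> v = v" if v: "v \<in> verts S" for v
      using v by (rule verts_yt) (use vmap_yt[OF i(1)] i(2) in auto)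
    then have "vmap \<iota> = (\<lambda>v\<in>verts S. v)" by (auto simp: fun_eq_iff vmap_def)
    then show ?thesis using i(1) by (metis imageI)
  qed
  show "compose (verts S) \<sigma> \<tau> \<in> vmap ` Fm" if st: "\<sigma> \<in> vmap ` Fm" "\<tau> \<in> vmap ` Fm" for \<sigma> \<tau>
  proof -
    obtain \<phi> \<psi> where p: "\<phi> \<in> Fm" "\<psi> \<in> Fm" "\<sigma> = vmap \<phi>" "\<tau> = vmap \<psi>" using st by blast
    obtain \<theta> where c: "\<theta> \<in> Fm" "\<forall>g\<in>carrier G. \<theta> g = \<phi> (\<psi> g)" using F_comp p by blast
    have "vmap \<theta> v = vmap \<phi> (vmap \<psi> v)" if v: "v \<in> verts S" for v
      using v by (rule verts_yt) (use vmap_yt p c F_yt in auto)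
    then have "vmap \<theta> = compose (verts S) \<sigma> \<tau>"
      unfolding p by (auto simp: fun_eq_iff compose_def) (simp add: vmap_def)
    then show ?thesis using c(1) by (metis imageI)
  qed
  show "\<exists>\<tau>\<in>vmap ` Fm. \<forall>v\<in>verts S. \<tau> (\<sigma> v) = v" if s: "\<sigma> \<in> vmap ` Fm" for \<sigma>
  proof -
    obtain \<phi> where p: "\<phi> \<in> Fm" "\<sigma> = vmap \<phi>" using s by blast
    obtain \<psi> where q: "\<psi> \<in> Fm" "\<forall>g\<in>carrier G. \<psi> (\<phi> g) = g" using F_inv p by blast
    have "vmap \<psi> (vmap \<phi> v) = v" if v: "v \<in> verts S" for v
      using v by (rule verts_yt) (use vmap_yt p q F_yt in auto)
    then show ?thesis using p q by blast
  qed
  show "\<exists>\<sigma>\<in>vmap ` Fm. \<sigma> u = u \<and> \<sigma> v = v' \<and> \<sigma> w = w'"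
    if t: "(u, v, w) \<in> S" and t': "(u, v', w') \<in> S" for u v w v' w'
  proof -
    obtain a b where ab: "yt a b \<in> S" "u = yt1 a b" "v = yt2 a b" "w = yt3 a b" using S_yt[OF t] by metis
    obtain a' b' where ab': "yt a' b' \<in> S" "u = yt1 a' b'" "v' = yt2 a' b'" "w' = yt3 a' b'"
      using S_yt[OF t'] by metis
    \<comment> \<open>The common lift u fixes the group element a and, being equal as a lift,
      supplies the link circle condition of \<open>star\<close>.\<close>
    have "fst u = (a, 1)" "fst u = (a', 1)" using ab(2) ab'(2) fst_yt(1) by metis+
    then have a: "a' = a" by simp
    obtain \<phi> where "\<phi> \<in> Fm" "\<phi> a = a" "\<phi> b = b'" using star[of a b b'] ab ab' unfolding a by metis
    then show ?thesis
      using vmap_yt[of \<phi> a b] ab ab' unfolding a by (intro bexI[of _ "vmap \<phi>"]) auto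
  qed
  have n: "noncomm x y" using noncomm_component[OF comp xy] .
  show "(yt1 x y, yt2 x y, yt3 x y) \<in> S" using xy by (simp add: yt_def)
  show "(yt2 x y, yt1 x y, yt3 y x) \<in> S"
    using component_nb(1)[OF comp xy] by (simp add: yt_def yt_swap[OF n])
qed

text \<open>A symmetry is determined on S by the image of the base triangle, and that by the images
  of x and y. Hence exactly the maps fixing x and y act trivially, and dividing by them leaves a
  faithful action.\<close>

lemma vmap_eq_iff:
  assumes "\<phi> \<in> Fm" "\<psi> \<in> Fm"
  shows "vmap \<phi> = vmap \<psi> \<longleftrightarrow> \<phi> x = \<psi> x \<and> \<phi> y = \<psi> y"
proof
  assume "vmap \<phi> = vmap \<psi>"
  then have "yt1 (\<phi> x) (\<phi> y) = yt1 (\<psi> x) (\<psi> y)" "yt2 (\<phi> x) (\<phi> y) = yt2 (\<psi> x) (\<psi> y)"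
    using vmap_yt[OF assms(1) xy] vmap_yt[OF assms(2) xy] by simp_all
  then have "fst (yt1 (\<phi> x) (\<phi> y)) = fst (yt1 (\<psi> x) (\<psi> y))" "fst (yt2 (\<phi> x) (\<phi> y)) = fst (yt2 (\<psi> x) (\<psi> y))"
    by simp_all
  then show "\<phi> x = \<psi> x \<and> \<phi> y = \<psi> y" by simp
next
  assume "\<phi> x = \<psi> x \<and> \<phi> y = \<psi> y"
  then show "vmap \<phi> = vmap \<psi>"
    using A_eq[OF imageI[OF assms(1)] imageI[OF assms(2)] base(1)]
      vmap_yt[OF assms(1) xy] vmap_yt[OF assms(2) xy] by simp
qed

lemma vtype_yt [simp]: "vtype (yt1 a b) = 1" "vtype (yt2 a b) = 1" "vtype (yt3 a b) = 2"
  by (simp_all add: vtype_def)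

lemma type1_verts_eq: "type1_verts S = fst ` S"
proof (intro equalityI subsetI)
  fix v assume "v \<in> type1_verts S"
  then have v: "v \<in> verts S" "vtype v = 1" by (auto simp: type1_verts_def)
  show "v \<in> fst ` S"
    using v(1)
  proof (cases rule: verts_cases)
    case (one b c)
    then show ?thesis by force
  next
    case (two a b)
    then show ?thesis by (rule S_yt) (use v(2) in simp)
  qed
next
  fix v assume "v \<in> fst ` S"
  then obtain b c where t: "(v, b, c) \<in> S" using first_verts by blast
  then have "vtype v = 1" by (rule S_yt) simp
  then show "v \<in> type1_verts S" using in_verts[OF t] by (simp add: type1_verts_def)
qed

lemma centres_eq: "centres S = (snd \<circ> snd) ` S"
proof (intro equalityI subsetI)
  fix v assume "v \<in> centres S"
  then have v: "v \<in> verts S" "vtype v = 2" by (auto simp: centres_def)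
  show "v \<in> (snd \<circ> snd) ` S"
    using v(1)
  proof (cases rule: verts_cases)
    case (one b c)
    then show ?thesis by (rule S_yt) (use v(2) in simp)
  next
    case (two a b)
    then show ?thesis by force
  qed
next
  fix v assume "v \<in> (snd \<circ> snd) ` S"
  then obtain a b where t: "(a, b, v) \<in> S" by force
  then have "vtype v = 2" by (rule S_yt) simp
  then show "v \<in> centres S" using in_verts[OF t] by (simp add: centres_def)
qed

text \<open>Preservation of types is automatic: a map of ordered triples keeps the type 2 vertex in
  last place.\<close>

lemma cell_aut_plus_eq: "cell_aut_plus S = tri_auts"
proof (intro equalityI subsetI)
  fix \<sigma> assume s: "\<sigma> \<in> tri_auts"
  have "vtype (\<sigma> v) = vtype v" if v: "v \<in> verts S" for v
    using v
  proof (cases rule: verts_cases)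
    case (one b c)
    then show ?thesis using S_yt[OF one] S_yt[OF tri_auts_tri[OF s one]] by (metis vtype_yt(1))
  next
    case (two a b)
    then show ?thesis using S_yt[OF two] S_yt[OF tri_auts_tri[OF s two]] by (metis vtype_yt(3))
  qed
  then show "\<sigma> \<in> cell_aut_plus S" using s by (simp add: cell_aut_plus_def tri_auts_def)
qed (simp add: cell_aut_plus_def tri_auts_def)

lemma vpush_vmap: "p \<in> realize S \<Longrightarrow> vpush (vmap \<phi>) p = vpush (yvmap \<phi>) p"
  by (erule realizeE) (use in_verts in \<open>simp add: vpush_bary vmap_def\<close>)

lemma quotient_description:
  assumes n: "\<forall>c \<in> centres S. card {t \<in> S. c \<in> tri_vs t} = n"
    and q: "q = card (vmap ` Fm)"
    and M: "M = yvmap ` Fm" and Q: "QI = vmap ` Fm"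
    and Orb: "Orb = (\<lambda>v. {\<sigma> v | \<sigma>. \<sigma> \<in> M}) ` type1_verts S"
    and vx: "vx = yt1 x y" and vy: "vy = yt2 x y"
  shows "\<exists>pr B.
     quotient_map (geo S) (nsphere 2) pr \<and>
     (\<forall>p \<in> realize S. \<forall>p' \<in> realize S. pr p = pr p' \<longleftrightarrow> (\<exists>\<sigma> \<in> M. vpush \<sigma> p = p')) \<and>
     branched_cover (geo S) (nsphere 2) pr q B \<and> card B = 3 \<and>
     (card Orb = 2 \<longrightarrow>
        (\<exists>c. pr ` vpt ` centres S = {c} \<and> B = {pr (vpt vx), pr (vpt vy), c}) \<and>
        ram_index (geo S) (nsphere 2) pr (vpt vx) (valency S vx) \<and>
        ram_index (geo S) (nsphere 2) pr (vpt vy) (valency S vy) \<and>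
        (\<forall>c \<in> centres S. ram_index (geo S) (nsphere 2) pr (vpt c) (n div 2)) \<and>
        subgroup QI (BijGroup (verts S)) \<and> QI \<subseteq> cell_aut_plus S \<and>
        card (cell_aut_plus S) \<le> 2 * card QI \<and>
        q = card (cell_edges S) \<and>
        (valency S vx \<noteq> valency S vy \<longrightarrow> QI = cell_aut_plus S)) \<and>
     (card Orb = 1 \<longrightarrow>
        (\<exists>m c. pr ` edge_midpoints S = {m} \<and> pr ` vpt ` centres S = {c} \<and>
               B = {pr (vpt vx), m, c}) \<and>
        ram_index (geo S) (nsphere 2) pr (vpt vx) (valency S vx) \<and>
        (\<forall>m \<in> edge_midpoints S. ram_index (geo S) (nsphere 2) pr m 2) \<and>
        (\<forall>c \<in> centres S. ram_index (geo S) (nsphere 2) pr (vpt c) n) \<and>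
        QI = cell_aut_plus S \<and>
        q = 2 * card (cell_edges S))"
proof -
  have orb: "Orb = orb ` (fst ` S)"
  proof -
    have "{\<sigma> v | \<sigma>. \<sigma> \<in> M} = orb v" if "v \<in> fst ` S" for v
    proof -
      have "v \<in> verts S" using that in_verts by auto
      then have "vmap \<phi> v = yvmap \<phi> v" for \<phi> by (simp add: vmap_def)
      moreover have "orb v = (\<lambda>\<phi>. vmap \<phi> v) ` Fm" unfolding orb_def by blast
      moreover have "{\<sigma> v | \<sigma>. \<sigma> \<in> M} = (\<lambda>\<phi>. yvmap \<phi> v) ` Fm" unfolding M by blast
      ultimately show ?thesis by simp
    qed
    then show ?thesis unfolding Orb type1_verts_eq by (intro image_cong) auto
  qed
  have fib: "(\<exists>\<sigma>\<in>vmap ` Fm. vpush \<sigma> p = p') \<longleftrightarrow> (\<exists>\<sigma>\<in>M. vpush \<sigma> p = p')" if "p \<in> realize S" for p p'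
    using vpush_vmap[OF that] unfolding M by simp
  have n': "card {t \<in> S. c \<in> tri_vs t} = n" if "c \<in> (snd \<circ> snd) ` S" for c
    using n that unfolding centres_eq by blast
  have fib': "(\<forall>p\<in>realize S. \<forall>p'\<in>realize S. pr p = pr p' \<longleftrightarrow> (\<exists>\<sigma>\<in>vmap ` Fm. vpush \<sigma> p = p')) \<longleftrightarrow>
      (\<forall>p\<in>realize S. \<forall>p'\<in>realize S. pr p = pr p' \<longleftrightarrow> (\<exists>\<sigma>\<in>M. vpush \<sigma> p = p'))"
    for pr :: "('a yvert \<Rightarrow> real) \<Rightarrow> nat \<Rightarrow> real"
    by (intro ball_cong refl) (simp only: fib)
  show ?thesis
    using quotient_sphere[OF n']
    unfolding Q q vx vy centres_eq orb cell_aut_plus_eq fib'[symmetric] .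
qed

end

context group
begin

lemma AutStab_family:
  assumes fin: "finite (carrier G)" and S: "S \<in> Y_components G" and xy: "yt x y \<in> S"
  shows "symmetry_family G S (AutStab G S) x y"
proof -
  have ne: "S \<noteq> {}" using xy by blast
  interpret AG: group "AutoGroup G" by (rule AutoGroup)
  note sub = subgroup_AutStab[OF fin S ne]
  have au: "\<phi> \<in> auto G" if "\<phi> \<in> AutStab G S" for \<phi> using that by (simp add: AutStab_def)
  show ?thesis
  proof unfold_locales
    show "\<phi> \<in> iso G G" if "\<phi> \<in> AutStab G S" for \<phi> using auto_iso au that by blast
    show "tmap (yvmap \<phi>) ` S = S" if "\<phi> \<in> AutStab G S" for \<phi> using that by (simp add: AutStab_def)
    show "\<exists>\<iota>\<in>AutStab G S. \<forall>g\<in>carrier G. \<iota> g = g"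
      using subgroup.one_closed[OF sub] unfolding auto_one by (intro bexI) auto
    show "\<exists>\<theta>\<in>AutStab G S. \<forall>g\<in>carrier G. \<theta> g = \<phi> (\<psi> g)"
      if st: "\<phi> \<in> AutStab G S" "\<psi> \<in> AutStab G S" for \<phi> \<psi>
      using subgroup.m_closed[OF sub st] unfolding auto_mult[OF au[OF st(1)] au[OF st(2)]]
      by (intro bexI) (auto simp: compose_def)
    show "\<exists>\<psi>\<in>AutStab G S. \<forall>g\<in>carrier G. \<psi> (\<phi> g) = g" if st: "\<phi> \<in> AutStab G S" for \<phi>
      using subgroup.m_inv_closed[OF sub st] auto_inv(2)[OF au[OF st]] by blast
    show "\<exists>\<phi>\<in>AutStab G S. \<forall>h\<in>carrier G. \<phi> h = conjf G g h" if g: "g \<in> ConjStab G S" for g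
    proof -
      \<comment> \<open>Elements of \<open>auto\<close> are extensional, so the conjugation is cut
        down to the carrier; that it still stabilizes S is seen on one triangle.\<close>
      let ?p = "restrict (conjf G g) (carrier G)"
      have gc: "g \<in> carrier G" and st: "tmap (yvmap (conjf G g)) ` S = S"
        using g by (simp_all add: ConjStab_def)
      note i = conjf_iso[OF gc]
      have "?p \<in> hom G G" using iso_hom[OF i] by (simp add: hom_def Pi_iff)
      moreover have "bij_betw ?p (carrier G) (carrier G)"
        using i by (simp add: iso_def cong: bij_betw_cong)
      ultimately have a: "?p \<in> auto G" by (simp add: auto_def Bij_def)
      have n: "noncomm x y" using noncomm_component[OF S xy] .
      have "yt (conjf G g x) (conjf G g y) \<in> S" using tmap_yt[OF i n] st xy by (metis imageI)
      then have "tmap (yvmap ?p) ` S = S"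
        using noncomm_carrier[OF n] by (intro stabI[OF fin S auto_iso[OF a] xy]) simp
      then have "?p \<in> AutStab G S" using a by (simp add: AutStab_def)
      then show ?thesis by (intro bexI[of _ ?p]) simp_all
    qed
  qed (use fin S xy in auto)
qed

lemma ConjStab_family:
  assumes fin: "finite (carrier G)" and S: "S \<in> Y_components G" and xy: "yt x y \<in> S"
  shows "symmetry_family G S (conjf G ` ConjStab G S) x y"
proof -
  have ne: "S \<noteq> {}" using xy by blast
  note sub = subgroup_ConjStab[OF fin S ne]
  note car = subgroup.mem_carrier[OF sub]
  show ?thesis
  proof unfold_locales
    show "\<phi> \<in> iso G G" if "\<phi> \<in> conjf G ` ConjStab G S" for \<phi> using conjf_iso car that by blast
    show "tmap (yvmap \<phi>) ` S = S" if "\<phi> \<in> conjf G ` ConjStab G S" for \<phi>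
      using that by (auto simp: ConjStab_def)
    show "\<exists>\<iota>\<in>conjf G ` ConjStab G S. \<forall>g\<in>carrier G. \<iota> g = g"
      using subgroup.one_closed[OF sub] conjf_one by (intro bexI[of _ "conjf G \<one>"]) auto
    show "\<exists>\<theta>\<in>conjf G ` ConjStab G S. \<forall>g\<in>carrier G. \<theta> g = \<phi> (\<psi> g)"
      if st: "\<phi> \<in> conjf G ` ConjStab G S" "\<psi> \<in> conjf G ` ConjStab G S" for \<phi> \<psi>
    proof -
      obtain g h where gh: "g \<in> ConjStab G S" "h \<in> ConjStab G S" "\<phi> = conjf G g" "\<psi> = conjf G h"
        using st by blast
      then show ?thesis
        using subgroup.m_closed[OF sub gh(1,2)] conjf_mult[OF car[OF gh(1)] car[OF gh(2)]]
        by (intro bexI[of _ "conjf G (g \<otimes> h)"]) auto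
    qed
    show "\<exists>\<psi>\<in>conjf G ` ConjStab G S. \<forall>g\<in>carrier G. \<psi> (\<phi> g) = g"
      if st: "\<phi> \<in> conjf G ` ConjStab G S" for \<phi>
    proof -
      obtain g where g: "g \<in> ConjStab G S" "\<phi> = conjf G g" using st by blast
      have "conjf G (inv g) (conjf G g h) = h" if "h \<in> carrier G" for h
        using conjf_mult[of "inv g" g h] car[OF g(1)] that conjf_one by simp
      then show ?thesis
        using subgroup.m_inv_closed[OF sub g(1)] g(2) by (intro bexI[of _ "conjf G (inv g)"]) auto
    qed
    show "\<exists>\<phi>\<in>conjf G ` ConjStab G S. \<forall>h\<in>carrier G. \<phi> h = conjf G g h" if "g \<in> ConjStab G S" for g
      using that by blast
  qed (use fin S xy in auto)
qed

text \<open>Cosets of the maps fixing x and y correspond to the distinct maps on S. Maps fixing x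
  and y stabilize S because they fix one of its triangles, so they form a subgroup of
  \<open>AutStab G S\<close>.\<close>

lemma Q_order_eq:
  assumes fin: "finite (carrier G)" and S: "S \<in> Y_components G" and xy: "yt x y \<in> S"
  shows "Q_order G S x y = card ((\<lambda>\<phi>. restrict (yvmap \<phi>) (verts S)) ` AutStab G S)"
proof -
  have ne: "S \<noteq> {}" using xy by blast
  interpret K: symmetry_family G S "AutStab G S" x y by (rule AutStab_family[OF fin S xy])
  interpret AG: group "AutoGroup G" by (rule AutoGroup)
  note sub = subgroup_AutStab[OF fin S ne]
  let ?K = "(AutoGroup G)\<lparr>carrier := AutStab G S\<rparr>"
  let ?H = "{\<phi> \<in> auto G. \<phi> x = x \<and> \<phi> y = y}"
  interpret KG: group ?K by (rule subgroup.subgroup_is_group[OF sub AG.group_axioms])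
  have xyc: "x \<in> carrier G" "y \<in> carrier G"
    using noncomm_carrier[OF noncomm_component[OF S xy]] by auto
  have au: "\<phi> \<in> auto G" if "\<phi> \<in> AutStab G S" for \<phi> using that by (simp add: AutStab_def)
  have HS: "\<phi> \<in> AutStab G S" if "\<phi> \<in> ?H" for \<phi>
  proof -
    have "tmap (yvmap \<phi>) ` S = S" using that xy by (intro stabI[OF fin S auto_iso xy]) auto
    then show ?thesis using that by (simp add: AutStab_def)
  qed
  have "card (rcosets\<^bsub>?K\<^esub> ?H) = card (K.vmap ` carrier ?K)"
  proof (rule KG.card_rcosets_pair_stabilizer[where act = "\<lambda>\<phi>. \<phi>", OF _ xyc])
    show "finite (carrier ?K)" using finite_auto[OF fin] finite_subset[of "AutStab G S" "auto G"] au by auto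
    show "\<phi> z \<in> carrier G" if "\<phi> \<in> carrier ?K" "z \<in> carrier G" for \<phi> z
      using hom_in_carrier[OF iso_hom[OF auto_iso[OF au]]] that by simp
    show "\<one>\<^bsub>?K\<^esub> z = z" if "z \<in> carrier G" for z using that by (simp add: auto_one)
    show "(\<phi> \<otimes>\<^bsub>?K\<^esub> \<psi>) z = \<phi> (\<psi> z)" if "\<phi> \<in> carrier ?K" "\<psi> \<in> carrier ?K" "z \<in> carrier G" for \<phi> \<psi> z
      using that auto_mult au by (simp add: compose_def)
    show "?H = {\<phi> \<in> carrier ?K. \<phi> x = x \<and> \<phi> y = y}" using HS au by auto
    show "K.vmap \<phi> = K.vmap \<psi> \<longleftrightarrow> \<phi> x = \<psi> x \<and> \<phi> y = \<psi> y"
      if "\<phi> \<in> carrier ?K" "\<psi> \<in> carrier ?K" for \<phi> \<psi>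
      using K.vmap_eq_iff that by simp
  qed
  then show ?thesis by (simp add: Q_order_def K.vmap_def image_def)
qed

lemma Qbar_order_eq:
  assumes fin: "finite (carrier G)" and S: "S \<in> Y_components G" and xy: "yt x y \<in> S"
  shows "Qbar_order G S x y = card ((\<lambda>\<phi>. restrict (yvmap \<phi>) (verts S)) ` (conjf G ` ConjStab G S))"
proof -
  have ne: "S \<noteq> {}" using xy by blast
  interpret K: symmetry_family G S "conjf G ` ConjStab G S" x y by (rule ConjStab_family[OF fin S xy])
  note sub = subgroup_ConjStab[OF fin S ne]
  note car = subgroup.mem_carrier[OF sub]
  let ?K = "G\<lparr>carrier := ConjStab G S\<rparr>"
  let ?H = "centralizer_of G x \<inter> centralizer_of G y"
  interpret KG: group ?K by (rule subgroup.subgroup_is_group[OF sub group_axioms])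
  have xyc: "x \<in> carrier G" "y \<in> carrier G"
    using noncomm_carrier[OF noncomm_component[OF S xy]] by auto
  \<comment> \<open>Commuting with z means being fixed under conjugation, which turns the
    intersection of the centralizers into a pair stabilizer.\<close>
  have cent: "g \<in> centralizer_of G z \<longleftrightarrow> conjf G g z = z" if g: "g \<in> carrier G" and z: "z \<in> carrier G" for g z
  proof
    assume "g \<in> centralizer_of G z"
    then show "conjf G g z = z" using g z by (simp add: centralizer_of_def conjf_def m_assoc)
  next
    assume "conjf G g z = z"
    then have "g \<otimes> z \<otimes> inv g \<otimes> g = z \<otimes> g" by (simp add: conjf_def)
    then show "g \<in> centralizer_of G z" using g z by (simp add: centralizer_of_def m_assoc)
  qed
  have HC: "g \<in> ?H \<longleftrightarrow> g \<in> carrier G \<and> conjf G g x = x \<and> conjf G g y = y" for g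
  proof (cases "g \<in> carrier G")
    case True
    then show ?thesis using cent[OF True xyc(1)] cent[OF True xyc(2)] by blast
  next
    case False
    then show ?thesis by (simp add: centralizer_of_def)
  qed
  have HS: "g \<in> ConjStab G S" if "g \<in> ?H" for g
  proof -
    have g: "g \<in> carrier G" "conjf G g x = x" "conjf G g y = y" using that HC by blast+
    then have "tmap (yvmap (conjf G g)) ` S = S" using xy by (intro stabI[OF fin S conjf_iso xy]) auto
    then show ?thesis using g by (simp add: ConjStab_def)
  qed
  have "card (rcosets\<^bsub>?K\<^esub> ?H) = card ((\<lambda>g. K.vmap (conjf G g)) ` carrier ?K)"
  proof (rule KG.card_rcosets_pair_stabilizer[where act = "conjf G", OF _ xyc])
    show "finite (carrier ?K)" using fin finite_subset[of "ConjStab G S" "carrier G"] car by auto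
    show "?H = {g \<in> carrier ?K. conjf G g x = x \<and> conjf G g y = y}" using HS HC car by auto
  qed (use car conjf_closed conjf_one conjf_mult K.vmap_eq_iff in simp_all)
  then show ?thesis by (simp add: Qbar_order_def K.vmap_def image_image)
qed

end

theorem theorem3p3:
  fixes G :: "('g, 'b) monoid_scheme" and S :: "'g yvert tri set"
    and x y :: 'g and t0 :: "'g yvert tri" and vx vy :: "'g yvert"
    and useQS :: bool and n :: nat
  assumes "group G" and "finite (carrier G)"
    and "\<exists>a \<in> carrier G. \<exists>b \<in> carrier G. a \<otimes>\<^bsub>G\<^esub> b \<noteq> b \<otimes>\<^bsub>G\<^esub> a"
    and "S \<in> Y_components G"
    and "t0 \<in> S"
    and "vx \<in> {fst t0, fst (snd t0)}" and "fst vx = (x, 1)"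
    and "vy \<in> {fst t0, fst (snd t0)}" and "fst vy = (y, 1)" and "vx \<noteq> vy"
    and "\<forall>c \<in> centres S. card {t \<in> S. c \<in> tri_vs t} = n"
  defines "M \<equiv> (if useQS then Q_maps G S else Qbar_maps G S)"
    and "q \<equiv> (if useQS then Q_order G S x y else Qbar_order G S x y)"
    and "QI \<equiv> (\<lambda>\<sigma>. restrict \<sigma> (verts S)) ` (if useQS then Q_maps G S else Qbar_maps G S)"
    and "Orb \<equiv> (\<lambda>v. {\<sigma> v | \<sigma>. \<sigma> \<in> (if useQS then Q_maps G S else Qbar_maps G S)}) ` type1_verts S"
  shows "\<exists>pr B.
     quotient_map (geo S) (nsphere 2) pr \<and>
     (\<forall>p \<in> realize S. \<forall>p' \<in> realize S. pr p = pr p' \<longleftrightarrow> (\<exists>\<sigma> \<in> M. vpush \<sigma> p = p')) \<and>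
     branched_cover (geo S) (nsphere 2) pr q B \<and> card B = 3 \<and>
     (card Orb = 2 \<longrightarrow>
        (\<exists>c. pr ` vpt ` centres S = {c} \<and> B = {pr (vpt vx), pr (vpt vy), c}) \<and>
        ram_index (geo S) (nsphere 2) pr (vpt vx) (valency S vx) \<and>
        ram_index (geo S) (nsphere 2) pr (vpt vy) (valency S vy) \<and>
        (\<forall>c \<in> centres S. ram_index (geo S) (nsphere 2) pr (vpt c) (n div 2)) \<and>
        subgroup QI (BijGroup (verts S)) \<and> QI \<subseteq> cell_aut_plus S \<and>
        card (cell_aut_plus S) \<le> 2 * card QI \<and>
        q = card (cell_edges S) \<and>
        (valency S vx \<noteq> valency S vy \<longrightarrow> QI = cell_aut_plus S)) \<and>
     (card Orb = 1 \<longrightarrow>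
        (\<exists>m c. pr ` edge_midpoints S = {m} \<and> pr ` vpt ` centres S = {c} \<and>
               B = {pr (vpt vx), m, c}) \<and>
        ram_index (geo S) (nsphere 2) pr (vpt vx) (valency S vx) \<and>
        (\<forall>m \<in> edge_midpoints S. ram_index (geo S) (nsphere 2) pr m 2) \<and>
        (\<forall>c \<in> centres S. ram_index (geo S) (nsphere 2) pr (vpt c) n) \<and>
        QI = cell_aut_plus S \<and>
        q = 2 * card (cell_edges S))"
proof -
  interpret group G by fact
  note fin = \<open>finite (carrier G)\<close> and S = \<open>S \<in> Y_components G\<close>
  obtain a b where ab: "noncomm a b" "t0 = yt a b" using component_yt[OF S \<open>t0 \<in> S\<close>] .
  have "vx \<in> {yt1 a b, yt2 a b}" "vy \<in> {yt1 a b, yt2 a b}"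
    using assms(6,8) unfolding ab(2) yt_def by simp_all
  \<comment> \<open>The edge may be listed in either order; in the second case the neighbouring
    triangle across it lies in S as well and has the vertices in the order x, y.\<close>
  then consider "vx = yt1 a b" "vy = yt2 a b" | "vx = yt2 a b" "vy = yt1 a b"
    using \<open>vx \<noteq> vy\<close> by blast
  then have "vx = yt1 x y \<and> vy = yt2 x y \<and> yt x y \<in> S"
  proof cases
    case 1
    then have "a = x" "b = y" using assms(7,9) by simp_all
    then show ?thesis using 1 ab \<open>t0 \<in> S\<close> by simp
  next
    case 2
    then have "b = x" "a = y" using assms(7,9) by simp_all
    then show ?thesis
      using 2 ab(2) yt_swap[OF ab(1)] component_nb(1)[OF S, of a b] \<open>t0 \<in> S\<close> by simp
  qed
  then have v: "vx = yt1 x y" "vy = yt2 x y" and xy: "yt x y \<in> S" by auto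
  define Fm where "Fm = (if useQS then AutStab G S else conjf G ` ConjStab G S)"
  interpret K: symmetry_family G S Fm x y
    unfolding Fm_def using AutStab_family[OF fin S xy] ConjStab_family[OF fin S xy] by simp
  have M: "(if useQS then Q_maps G S else Qbar_maps G S) = yvmap ` Fm"
    by (simp add: Fm_def Q_maps_def Qbar_maps_def image_image)
  have "q = card (K.vmap ` Fm)"
    unfolding q_def Fm_def using Q_order_eq[OF fin S xy] Qbar_order_eq[OF fin S xy]
    by (simp add: K.vmap_def)
  moreover have "M = yvmap ` Fm" "QI = K.vmap ` Fm"
    "Orb = (\<lambda>v. {\<sigma> v | \<sigma>. \<sigma> \<in> M}) ` type1_verts S"
    unfolding M_def QI_def Orb_def M by (simp_all add: image_image K.vmap_def)
  ultimately show ?thesis using K.quotient_description[OF assms(11) _ _ _ _ v] by blast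
qed

end
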